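(* Let $a>0$, let $\boldsymbol\rho:\mathbb{R}^2\to\mathbb{R}^3$ be $C^\infty$ with $\boldsymbol\rho_u(\mathbf 0),\boldsymbol\rho_v(\mathbf 0)$ linearly independent and $\boldsymbol\rho(\mathbf u)\neq\boldsymbol\rho(\mathbf 0)$ for $\mathbf u\in[-a,a]^2\setminus\{\mathbf 0\}$; set $r(\mathbf u):=|\boldsymbol\rho(\mathbf u)-\boldsymbol\rho(\mathbf 0)|$ and let $Q$ be the first fundamental form at $\mathbf 0$. Let $p$ be a positive odd integer, $q\ge0$ an integer and $P$ a positive integer. Let $\varphi$ be $C^\infty$ and either compactly supported in $(-a,a)^2$ or such that $\varphi/r^p$ is doubly periodic on $[-a,a]^2$, and suppose $\varphi(\mathbf u)=O(|\mathbf u|^{2q})$ as $\mathbf u\to\mathbf 0$. For $N\in\mathbb{Z}^+$ let $h=a/N$. Assume the linear systems defining the weights $\tau^m_{\mu,\nu}$ below are uniquely solvable. Then $$\int_{[-a,a]^2}\frac{\varphi(\mathbf u)}{r(\mathbf u)^p}\,\mathrm d\mathbf u=\sum_{\substack{-N\le i,j\le N-1\\(i,j)\ne(0,0)}}\frac{\varphi(ih,jh)}{r(ih,jh)^p}h^2+C^h_p[\varphi;P,q]+O(h^P)\qquad(h\to0),$$ where, with $M:=2\lceil\frac{P+p}{2}\rceil-2q-4$, $K_1^m:=q+\lceil\frac{3m}{2}\rceil$, $K_2^m:=\lceil\frac{P+p}{2}\rceil+m-2$ and $\tilde\varphi_m(\mathbf u):=[r(\mathbf u)^2-Q(\mathbf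 u)]^m\varphi(\mathbf u)$, $$C^h_p[\varphi;P,q]:=\sum_{m=0}^{M}\ \sum_{(\mu,\nu)\in U(K_1^m,K_2^m)}\binom{-p/2}{m}\tilde\varphi_m(\mu h,\nu h)\,\tau^m_{\mu,\nu}\,h^{2-p-2m}$$ (and $C^h_p:=0$ if $M<0$).
   Context: First fundamental form at $\mathbf 0$: $Q(\mathbf u)=Eu^2+2Fuv+Gv^2$ with $E=\boldsymbol\rho_u(\mathbf 0)\cdot\boldsymbol\rho_u(\mathbf 0)$, $F=\boldsymbol\rho_u(\mathbf 0)\cdot\boldsymbol\rho_v(\mathbf 0)$, $G=\boldsymbol\rho_v(\mathbf 0)\cdot\boldsymbol\rho_v(\mathbf 0)$. Notation: $|\mathbf u|:=\max(|u|,|v|)$, $|\mathbf i|:=\max(|i|,|j|)$. Wigner limit: for $s\in\mathbb{C}$, $s\ne 2$, and a polynomial $f$, $$\mathcal W^s[f]:=\lim_{h\to0}\lim_{N\to\infty}\Big\{\sum_{\mathbf i\in\mathbb{Z}^2,\,0<|\mathbf i|\le N}\frac{f(\mathbf i)}{Q(\mathbf i)^{s/2}}\eta(\mathbf i h)-\int_{|\mathbf u|\le N+\frac12}\frac{f(\mathbf u)}{Q(\mathbf u)^{s/2}}\eta(\mathbf u h)\,\mathrm d\mathbf u\Big\},$$ with $\eta$ any $C^\infty$ compactly supported even function with $\eta(\mathbf 0)=1$, the integral in the Hadamard finite-part sense when needed. Stencil: for integers $0\le K_1\le K_2$, $U(K_1,K_2):=\{(\mu,\nu)\in\mathbb{Z}^2: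 K_1\le|\mu|+|\nu|\le K_2+1,\ \max(|\mu|,|\nu|)\le K_2\}$. Weights: for each $m$ with $0\le m\le M$, let $s:=2m+p$, $K_1=K_1^m$, $K_2=K_2^m$; the weights $\tau^m_{\mu,\nu}$, $(\mu,\nu)\in U(K_1,K_2)$, are the solution of the linear system consisting of (i) the moment conditions $\sum_{(\mu,\nu)\in U(K_1,K_2)}\mu^{2k-l}\nu^{l}\,\tau^m_{\mu,\nu}=-\mathcal W^{s}[u^{2k-l}v^{l}]$ for all $K_1\le k\le K_2$ and $0\le l\le 2k$; and (ii) the symmetry conditions $\tau^m_{\mu,\nu}=\tau^m_{-\mu,-\nu}$ for all $(\mu,\nu)\in U(K_1,K_2)$, $\tau^m_{\mu,\nu}=-\tau^m_{-\mu,\nu}$ whenever $|\mu|+|\nu|=K_2+1$, and $\tau^m_{\mu,\nu}=\tau^m_{-\mu,\nu}$ whenever $|\mu|+|\nu|=K_1$. *)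

theory Defs
  imports "HOL-Analysis.Analysis" "HOL-Library.Landau_Symbols"
begin

definition pu :: "(real \<times> real \<Rightarrow> 'a::real_normed_vector) \<Rightarrow> real \<times> real \<Rightarrow> 'a" where
  "pu f x = vector_derivative (\<lambda>t. f (t, snd x)) (at (fst x))"

definition pv :: "(real \<times> real \<Rightarrow> 'a::real_normed_vector) \<Rightarrow> real \<times> real \<Rightarrow> 'a" where
  "pv f x = vector_derivative (\<lambda>t. f (fst x, t)) (at (snd x))"

inductive_set derivs :: "(real \<times> real \<Rightarrow> 'a::real_normed_vector) \<Rightarrow> (real \<times> real \<Rightarrow> 'a) set"
  for f where
    self: "f \<in> derivs f"
  | du: "g \<in> derivs f \<Longrightarrow> pu g \<in> derivs f"
  | dv: "g \<in> derivs f \<Longrightarrow> pv g \<in> derivs f"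

definition smooth_on :: "(real \<times> real) set \<Rightarrow> (real \<times> real \<Rightarrow> 'a::real_normed_vector) \<Rightarrow> bool" where
  "smooth_on S f \<longleftrightarrow> (\<forall>g\<in>derivs f. \<forall>x\<in>S. g differentiable (at x))"

definition mnorm :: "real \<times> real \<Rightarrow> real" where
  "mnorm u = max \<bar>fst u\<bar> \<bar>snd u\<bar>"

text \<open>Hadamard finite part of the integral of F over the square mnorm u \<le> L:
  remove the square mnorm u \<le> eps, subtract a finite combination of negative powers of eps,
  and take the limit eps \<rightarrow> 0+.  (Coincides with the ordinary integral when it exists.)\<close>
definition fp_has :: "(real \<times> real \<Rightarrow> real) \<Rightarrow> real \<Rightarrow> real \<Rightarrow> bool" where
  "fp_has F L c \<longleftrightarrow>
     (\<exists>bs :: (real \<times> real) list. (\<forall>(b, _) \<in> set bs. b > 0) \<and>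
        ((\<lambda>\<epsilon>. integral {u. \<epsilon> < mnorm u \<and> mnorm u \<le> L} F
               - (\<Sum>(b, d) \<leftarrow> bs. d * \<epsilon> powr (- b))) \<longlongrightarrow> c) (at_right 0))"

definition fp_integral :: "(real \<times> real \<Rightarrow> real) \<Rightarrow> real \<Rightarrow> real" where
  "fp_integral F L = (THE c. fp_has F L c)"

definition admissible_cutoff :: "(real \<times> real \<Rightarrow> real) \<Rightarrow> bool" where
  "admissible_cutoff \<eta> \<longleftrightarrow> smooth_on UNIV \<eta> \<and> bounded {x. \<eta> x \<noteq> 0}
      \<and> (\<forall>x. \<eta> (- x) = \<eta> x) \<and> \<eta> (0, 0) = 1"

definition wigner :: "(real \<times> real \<Rightarrow> real) \<Rightarrow> real \<Rightarrow> (real \<times> real \<Rightarrow> real) \<Rightarrow> real" where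
  "wigner Q s f = (THE w. \<forall>\<eta>. admissible_cutoff \<eta> \<longrightarrow>
     (\<exists>g. (\<forall>\<^sub>F h in at 0.
            (\<lambda>N::nat.
               (\<Sum>(i, j) \<in> ({- int N..int N} \<times> {- int N..int N}) - {(0, 0)}.
                  f (of_int i, of_int j) / Q (of_int i, of_int j) powr (s / 2)
                  * \<eta> (h * of_int i, h * of_int j))
               - fp_integral (\<lambda>u. f u / Q u powr (s / 2) * \<eta> (h * fst u, h * snd u))
                   (real N + 1 / 2))
            \<longlonglongrightarrow> g h)
         \<and> (g \<longlongrightarrow> w) (at 0)))"

definition stencil :: "int \<Rightarrow> int \<Rightarrow> (int \<times> int) set" where
  "stencil K1 K2 = {(\<mu>, \<nu>). K1 \<le> \<bar>\<mu>\<bar> + \<bar>\<nu>\<bar> \<and> \<bar>\<mu>\<bar> + \<bar>\<nu>\<bar> \<le> K2 + 1 \<and> max \<bar>\<mu>\<bar> \<bar>\<nu>\<bar> \<le> K2}"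

definition weight_sys :: "(real \<times> real \<Rightarrow> real) \<Rightarrow> real \<Rightarrow> int \<Rightarrow> int \<Rightarrow> (int \<times> int \<Rightarrow> real) \<Rightarrow> bool" where
  "weight_sys Q s K1 K2 \<tau> \<longleftrightarrow>
     (\<forall>x. x \<notin> stencil K1 K2 \<longrightarrow> \<tau> x = 0)
   \<and> (\<forall>k l. K1 \<le> k \<and> k \<le> K2 \<and> 0 \<le> l \<and> l \<le> 2 * k \<longrightarrow>
        (\<Sum>(\<mu>, \<nu>) \<in> stencil K1 K2. of_int \<mu> ^ nat (2 * k - l) * of_int \<nu> ^ nat l * \<tau> (\<mu>, \<nu>))
        = - wigner Q s (\<lambda>u. fst u ^ nat (2 * k - l) * snd u ^ nat l))
   \<and> (\<forall>(\<mu>, \<nu>) \<in> stencil K1 K2. \<tau> (\<mu>, \<nu>) = \<tau> (- \<mu>, - \<nu>))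
   \<and> (\<forall>(\<mu>, \<nu>) \<in> stencil K1 K2. \<bar>\<mu>\<bar> + \<bar>\<nu>\<bar> = K2 + 1 \<longrightarrow> \<tau> (\<mu>, \<nu>) = - \<tau> (- \<mu>, \<nu>))
   \<and> (\<forall>(\<mu>, \<nu>) \<in> stencil K1 K2. \<bar>\<mu>\<bar> + \<bar>\<nu>\<bar> = K1 \<longrightarrow> \<tau> (\<mu>, \<nu>) = \<tau> (- \<mu>, \<nu>))"

definition weights :: "(real \<times> real \<Rightarrow> real) \<Rightarrow> real \<Rightarrow> int \<Rightarrow> int \<Rightarrow> int \<times> int \<Rightarrow> real" where
  "weights Q s K1 K2 = (THE \<tau>. weight_sys Q s K1 K2 \<tau>)"

definition rho_u :: "(real \<times> real \<Rightarrow> real^3) \<Rightarrow> real^3" where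
  "rho_u \<rho> = pu \<rho> (0, 0)"

definition rho_v :: "(real \<times> real \<Rightarrow> real^3) \<Rightarrow> real^3" where
  "rho_v \<rho> = pv \<rho> (0, 0)"

definition fff :: "(real \<times> real \<Rightarrow> real^3) \<Rightarrow> real \<times> real \<Rightarrow> real" where
  "fff \<rho> u = (rho_u \<rho> \<bullet> rho_u \<rho>) * fst u ^ 2 + 2 * (rho_u \<rho> \<bullet> rho_v \<rho>) * fst u * snd u
             + (rho_v \<rho> \<bullet> rho_v \<rho>) * snd u ^ 2"

definition rdist :: "(real \<times> real \<Rightarrow> real^3) \<Rightarrow> real \<times> real \<Rightarrow> real" where
  "rdist \<rho> u = norm (\<rho> u - \<rho> (0, 0))"

definition Mbig :: "nat \<Rightarrow> nat \<Rightarrow> nat \<Rightarrow> int" where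
  "Mbig p P q = 2 * \<lceil>(real P + real p) / 2\<rceil> - 2 * int q - 4"

definition K1m :: "nat \<Rightarrow> int \<Rightarrow> int" where
  "K1m q m = int q + \<lceil>3 * real_of_int m / 2\<rceil>"

definition K2m :: "nat \<Rightarrow> nat \<Rightarrow> int \<Rightarrow> int" where
  "K2m p P m = \<lceil>(real P + real p) / 2\<rceil> + m - 2"

definition corr :: "(real \<times> real \<Rightarrow> real^3) \<Rightarrow> (real \<times> real \<Rightarrow> real) \<Rightarrow> nat \<Rightarrow> nat \<Rightarrow> nat \<Rightarrow> real \<Rightarrow> real" where
  "corr \<rho> \<phi> p P q h =
     (\<Sum>m \<in> {0..Mbig p P q}.
        \<Sum>(\<mu>, \<nu>) \<in> stencil (K1m q m) (K2m p P m).
          ((- real p / 2) gchoose nat m)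
          * ((rdist \<rho> (of_int \<mu> * h, of_int \<nu> * h)) ^ 2 - fff \<rho> (of_int \<mu> * h, of_int \<nu> * h)) ^ nat m
          * \<phi> (of_int \<mu> * h, of_int \<nu> * h)
          * weights (fff \<rho>) (real_of_int (2 * m + int p)) (K1m q m) (K2m p P m) (\<mu>, \<nu>)
          * h powr (2 - real p - 2 * real_of_int m))"

end

theory Submission
  imports Defs
begin

text \<open>
  Near the origin, \<open>\<phi> / r\<^bsup>p\<^esup>\<close> is expanded by the binomial series in \<open>(r\<^sup>2 - Q) / Q\<close> and by Taylor's
  formula into finitely many homogeneous terms \<open>x\<^bsup>i\<^esup> y\<^bsup>j\<^esup> Q\<^bsup>-s/2\<^esup>\<close> with \<open>s = p + 2 m\<close>, up to a remainder
  with as many derivatives vanishing at the origin as we please. On that remainder the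
  trapezoidal rule has order \<open>h\<^bsup>P\<^esup>\<close>, because opposite boundary values match. A cut-off homogeneous
  term \<open>F\<close> of degree \<open>d\<close> has error \<open>h\<^bsup>d+2\<^esup> W + O(h\<^bsup>K\<^esup>)\<close> for every \<open>K\<close>: comparing two mesh sizes is the
  same as comparing two cutoffs, whose difference is smooth, so \<open>h\<^bsup>-d-2\<^esup>\<close> times the error is Cauchy. The constant \<open>W\<close>
  is the Wigner limit of \<open>F\<close>, and it vanishes for odd \<open>i + j\<close>. The moment and symmetry conditions make the
  stencil cancel exactly these contributions, except those of order \<open>h\<^bsup>P\<^esup>\<close> or higher.
\<close>

subsection \<open>Partial derivatives and graded function classes\<close>

text \<open>The constants have no closed form that could be used here, and \<open>wigner\<close> and
  \<open>fp_integral\<close> are definite descriptions: existence and uniqueness of each value come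
  before any statement about it. Hence \<open>W\<close> is produced abstractly as a limit and only
  afterwards identified with the Wigner limit, for every admissible cutoff at once. No Fourier
  analysis or zeta function enters.

  Oddness of \<open>p\<close> makes every \<open>s\<close> odd. A homogeneous term has a logarithm
  in its finite part only at degree -2, that is for i + j = s - 2, which is then odd; there the
  reflection of u to -u makes sum and integral vanish. So pure powers suffice throughout.

  The stencil ranges come from counting degrees. Since r^2 - Q vanishes to third order, layer m
  starts at degree 2q + 3m, whence \<open>K1m\<close>. A term of degree d contributes at order d - s
  + 2, which is at least P once an even d exceeds twice \<open>K2m\<close>. \<open>Mbig\<close> is
  the largest m for which \<open>K1m\<close> does not exceed \<open>K2m\<close>.\<close>

lemma has_partial_vector:
  fixes f :: "real \<times> real \<Rightarrow> 'a::real_normed_vector"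
  assumes "f differentiable (at u)"
  shows "((\<lambda>t. f (t, snd u)) has_vector_derivative pu f u) (at (fst u))"
    "((\<lambda>t. f (fst u, t)) has_vector_derivative pv f u) (at (snd u))"
proof -
  obtain f' where f': "(f has_derivative f') (at (fst u, snd u))"
    using assms unfolding differentiable_def by auto
  have "((\<lambda>t. (t, snd u)) has_derivative (\<lambda>t. (t, 0))) (at (fst u))"
       "((\<lambda>t. (fst u, t)) has_derivative (\<lambda>t. (0, t))) (at (snd u))"
    by (auto intro!: derivative_eq_intros)
  from has_derivative_compose[OF this(1) f'] has_derivative_compose[OF this(2) f']
  have "(\<lambda>t. f (t, snd u)) differentiable (at (fst u))" "(\<lambda>t. f (fst u, t)) differentiable (at (snd u))"
    unfolding differentiable_def by blast+
  then show "((\<lambda>t. f (t, snd u)) has_vector_derivative pu f u) (at (fst u))"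
    "((\<lambda>t. f (fst u, t)) has_vector_derivative pv f u) (at (snd u))"
    unfolding pu_def pv_def by (simp_all add: vector_derivative_works)
qed

lemma has_pu:
  fixes f :: "real \<times> real \<Rightarrow> real"
  assumes "f differentiable (at u)"
  shows "((\<lambda>t. f (t, snd u)) has_real_derivative pu f u) (at (fst u))"
  using has_partial_vector(1)[OF assms] by (simp add: has_real_derivative_iff_has_vector_derivative)

lemma has_pv:
  fixes f :: "real \<times> real \<Rightarrow> real"
  assumes "f differentiable (at u)"
  shows "((\<lambda>t. f (fst u, t)) has_real_derivative pv f u) (at (snd u))"
  using has_partial_vector(2)[OF assms] by (simp add: has_real_derivative_iff_has_vector_derivative)

lemma pu_eqI:
  fixes f :: "real \<times> real \<Rightarrow> real"
  assumes "((\<lambda>t. f (t, snd u)) has_real_derivative d) (at (fst u))"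
  shows "pu f u = d"
  using assms unfolding pu_def has_real_derivative_iff_has_vector_derivative
  by (rule vector_derivative_at)

lemma pv_eqI:
  fixes f :: "real \<times> real \<Rightarrow> real"
  assumes "((\<lambda>t. f (fst u, t)) has_real_derivative d) (at (snd u))"
  shows "pv f u = d"
  using assms unfolding pv_def has_real_derivative_iff_has_vector_derivative
  by (rule vector_derivative_at)

lemma pu_cong_open:
  fixes f :: "real \<times> real \<Rightarrow> real"
  assumes "open S" "u \<in> S" "\<And>x. x \<in> S \<Longrightarrow> f x = g x"
  shows "pu f u = pu g u"
proof -
  have "open ((\<lambda>t. (t, snd u)) -` S)"
    by (intro open_vimage assms continuous_intros)
  then have "eventually (\<lambda>t. t \<in> (\<lambda>t. (t, snd u)) -` S) (nhds (fst u))"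
    by (rule eventually_nhds_in_open) (use assms in auto)
  then have "eventually (\<lambda>t. t \<in> UNIV \<longrightarrow> f (t, snd u) = g (t, snd u)) (nhds (fst u))"
    by eventually_elim (use assms in auto)
  then show ?thesis
    unfolding pu_def by (intro vector_derivative_cong_eq) auto
qed

lemma pv_cong_open:
  fixes f :: "real \<times> real \<Rightarrow> real"
  assumes "open S" "u \<in> S" "\<And>x. x \<in> S \<Longrightarrow> f x = g x"
  shows "pv f u = pv g u"
proof -
  have "open ((\<lambda>t. (fst u, t)) -` S)"
    by (intro open_vimage assms continuous_intros)
  then have "eventually (\<lambda>t. t \<in> (\<lambda>t. (fst u, t)) -` S) (nhds (snd u))"
    by (rule eventually_nhds_in_open) (use assms in auto)
  then have "eventually (\<lambda>t. t \<in> UNIV \<longrightarrow> f (fst u, t) = g (fst u, t)) (nhds (snd u))"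
    by eventually_elim (use assms in auto)
  then show ?thesis
    unfolding pv_def by (intro vector_derivative_cong_eq) auto
qed

lemma differentiable_cong_open:
  assumes "open S" "u \<in> S" "\<And>x. x \<in> S \<Longrightarrow> f x = g x" "f differentiable (at u)"
  shows "g differentiable (at u)"
  using assms unfolding differentiable_def
  by (meson has_derivative_transform_within_open)

lemma pu_add: "f differentiable (at u) \<Longrightarrow> g differentiable (at u) \<Longrightarrow>
    pu (\<lambda>x. f x + g x :: real) u = pu f u + pu g u"
  by (intro pu_eqI) (auto intro!: derivative_eq_intros has_pu)

lemma pv_add: "f differentiable (at u) \<Longrightarrow> g differentiable (at u) \<Longrightarrow>
    pv (\<lambda>x. f x + g x :: real) u = pv f u + pv g u"
  by (intro pv_eqI) (auto intro!: derivative_eq_intros has_pv)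

lemma pu_mult: "f differentiable (at u) \<Longrightarrow> g differentiable (at u) \<Longrightarrow>
    pu (\<lambda>x. f x * g x :: real) u = pu f u * g u + f u * pu g u"
  by (intro pu_eqI) (auto intro!: derivative_eq_intros has_pu)

lemma pv_mult: "f differentiable (at u) \<Longrightarrow> g differentiable (at u) \<Longrightarrow>
    pv (\<lambda>x. f x * g x :: real) u = pv f u * g u + f u * pv g u"
  by (intro pv_eqI) (auto intro!: derivative_eq_intros has_pv)

lemma pu_compose:
  assumes "f differentiable (at u)" "(w has_real_derivative w') (at (f u))"
  shows "pu (\<lambda>x. w (f x)) u = pu f u * w'"
  by (intro pu_eqI, rule DERIV_chain2[THEN DERIV_cong, OF _ has_pu[OF assms(1)]])
     (use assms in \<open>auto simp: mult.commute\<close>)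

lemma pv_compose:
  assumes "f differentiable (at u)" "(w has_real_derivative w') (at (f u))"
  shows "pv (\<lambda>x. w (f x)) u = pv f u * w'"
  by (intro pv_eqI, rule DERIV_chain2[THEN DERIV_cong, OF _ has_pv[OF assms(1)]])
     (use assms in \<open>auto simp: mult.commute\<close>)

lemma differentiable_real_compose:
  fixes f :: "real \<times> real \<Rightarrow> real" and w :: "real \<Rightarrow> real"
  assumes "f differentiable (at u)" "(w has_real_derivative w') (at (f u))"
  shows "(\<lambda>x. w (f x)) differentiable (at u)"
proof -
  have "w differentiable (at (f u))"
    using assms(2) by (meson real_differentiable_def)
  from differentiable_chain_at[OF assms(1) this] show ?thesis
    by (simp add: o_def)
qed

lemma pu_const [simp]: "pu (\<lambda>_. c :: real) = (\<lambda>_. 0)"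
  by (rule ext, rule pu_eqI) auto

lemma pv_const [simp]: "pv (\<lambda>_. c :: real) = (\<lambda>_. 0)"
  by (rule ext, rule pv_eqI) auto

lemma pu_fst [simp]: "pu fst = (\<lambda>_. 1 :: real)"
  by (rule ext, rule pu_eqI) (auto intro!: derivative_eq_intros)

lemma pv_fst [simp]: "pv fst = (\<lambda>_. 0 :: real)"
  by (rule ext, rule pv_eqI) (auto intro!: derivative_eq_intros)

lemma pu_snd [simp]: "pu snd = (\<lambda>_. 0 :: real)"
  by (rule ext, rule pu_eqI) (auto intro!: derivative_eq_intros)

lemma pv_snd [simp]: "pv snd = (\<lambda>_. 1 :: real)"
  by (rule ext, rule pv_eqI) (auto intro!: derivative_eq_intros)

text \<open>\<open>B D f\<close> is an abstract bound \<open>f = O(w\<^bsup>D\<^esup>)\<close> on \<open>\<Omega>\<close>, and each differentiation lowers the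
  degree \<open>D\<close> by one. The trivial bound gives plain \<open>K\<close>-fold differentiability; the bound
  by powers of the distance to the origin gives symbols with a singularity there.\<close>

primrec graded :: "(real \<times> real) set \<Rightarrow> (real \<Rightarrow> (real \<times> real \<Rightarrow> real) \<Rightarrow> bool) \<Rightarrow>
    nat \<Rightarrow> real \<Rightarrow> (real \<times> real \<Rightarrow> real) \<Rightarrow> bool" where
  "graded \<Omega> B 0 D f = B D f"
| "graded \<Omega> B (Suc K) D f = (B D f \<and> (\<forall>u\<in>\<Omega>. f differentiable (at u)) \<and>
     graded \<Omega> B K (D - 1) (pu f) \<and> graded \<Omega> B K (D - 1) (pv f))"

locale grading =
  fixes \<Omega> :: "(real \<times> real) set" and B :: "real \<Rightarrow> (real \<times> real \<Rightarrow> real) \<Rightarrow> bool"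
  assumes open_dom: "open \<Omega>"
    and B_cong: "\<And>f g D. (\<And>u. u \<in> \<Omega> \<Longrightarrow> f u = g u) \<Longrightarrow> B D f \<Longrightarrow> B D g"
    and B_const: "\<And>c. B 0 (\<lambda>_. c)"
    and B_zero: "\<And>D. B D (\<lambda>_. 0)"
    and B_add: "\<And>f g D. B D f \<Longrightarrow> B D g \<Longrightarrow> B D (\<lambda>u. f u + g u)"
    and B_mult: "\<And>f g D E. B D f \<Longrightarrow> B E g \<Longrightarrow> B (D + E) (\<lambda>u. f u * g u)"
    and B_mono: "\<And>f D E. B D f \<Longrightarrow> E \<le> D \<Longrightarrow> B E f"
begin

abbreviation "C \<equiv> graded \<Omega> B"

lemma graded_B: "C K D f \<Longrightarrow> B D f"
  by (cases K) auto

lemma graded_cong: "(\<And>u. u \<in> \<Omega> \<Longrightarrow> f u = g u) \<Longrightarrow> C K D f \<Longrightarrow> C K D g"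
proof (induction K arbitrary: D f g)
  case 0
  then show ?case using B_cong[of f g D] by simp
next
  case (Suc K)
  have "B D g" using Suc.prems B_cong[of f g D] by simp
  moreover have "\<forall>u\<in>\<Omega>. g differentiable (at u)"
    using Suc.prems differentiable_cong_open[OF open_dom, of _ f g] by simp
  moreover have "C K (D - 1) (pu g)"
    by (rule Suc.IH[of "pu f"]) (use Suc.prems pu_cong_open[OF open_dom, of _ f g] in auto)
  moreover have "C K (D - 1) (pv g)"
    by (rule Suc.IH[of "pv f"]) (use Suc.prems pv_cong_open[OF open_dom, of _ f g] in auto)
  ultimately show ?case by simp
qed

lemma graded_Suc: "C (Suc K) D f \<Longrightarrow> C K D f"
proof (induction K arbitrary: D f)
  case (Suc K)
  from Suc.prems have "C (Suc K) (D - 1) (pu f)" "C (Suc K) (D - 1) (pv f)"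
    by simp_all
  with Suc.IH have "C K (D - 1) (pu f)" "C K (D - 1) (pv f)" by blast+
  with Suc.prems show ?case by auto
qed simp

lemma graded_mono: "C K D f \<Longrightarrow> E \<le> D \<Longrightarrow> C K E f"
proof (induction K arbitrary: D E f)
  case (Suc K)
  have "E - 1 \<le> D - 1" using Suc.prems by simp
  then show ?case using Suc.prems Suc.IH[of "D - 1" _ "E - 1"] B_mono by auto
qed (auto intro: B_mono)

text \<open>Zero has to lie in every degree because differentiating a constant of degree 0 asks for
  a member of degree -1; this is the reason for \<open>B_zero\<close> beside
  \<open>B_const\<close>.\<close>

lemma graded_zero: "C K D (\<lambda>_. 0)"
  by (induction K arbitrary: D) (auto intro: B_zero)

lemma graded_const: "C K 0 (\<lambda>_. c)"
  by (cases K) (auto intro: B_const graded_zero)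

lemma graded_add: "C K D f \<Longrightarrow> C K D g \<Longrightarrow> C K D (\<lambda>u. f u + g u)"
proof (induction K arbitrary: D f g)
  case (Suc K)
  have *: "C K (D - 1) (\<lambda>u. pu f u + pu g u)" "C K (D - 1) (\<lambda>u. pv f u + pv g u)"
    using Suc by auto
  show ?case
    using Suc.prems B_add graded_cong[OF _ *(1), of "pu (\<lambda>u. f u + g u)"]
      graded_cong[OF _ *(2), of "pv (\<lambda>u. f u + g u)"]
    by (simp add: pu_add pv_add)
qed (auto intro: B_add)

lemma graded_mult: "C K D f \<Longrightarrow> C K E g \<Longrightarrow> C K (D + E) (\<lambda>u. f u * g u)"
proof (induction K arbitrary: D E f g)
  case (Suc K)
  note f = graded_Suc[OF Suc.prems(1)] and g = graded_Suc[OF Suc.prems(2)]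
  have eq: "D - 1 + E = D + E - 1" "D + (E - 1) = D + E - 1" by simp_all
  have "C K (D - 1 + E) (\<lambda>u. pu f u * g u)" "C K (D + (E - 1)) (\<lambda>u. f u * pu g u)"
       "C K (D - 1 + E) (\<lambda>u. pv f u * g u)" "C K (D + (E - 1)) (\<lambda>u. f u * pv g u)"
    using Suc.prems by (auto intro!: Suc.IH f g)
  then have *: "C K (D + E - 1) (\<lambda>u. pu f u * g u + f u * pu g u)"
      "C K (D + E - 1) (\<lambda>u. pv f u * g u + f u * pv g u)"
    unfolding eq using graded_add by auto
  show ?case
    using Suc.prems B_mult graded_cong[OF _ *(1), of "pu (\<lambda>u. f u * g u)"]
      graded_cong[OF _ *(2), of "pv (\<lambda>u. f u * g u)"]
    by (simp add: pu_mult pv_mult)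
qed (auto intro: B_mult)

lemma graded_cmult: "C K D f \<Longrightarrow> C K D (\<lambda>u. c * f u)"
  using graded_mult[OF graded_const, of K D f c] by simp

lemma graded_diff: "C K D f \<Longrightarrow> C K D g \<Longrightarrow> C K D (\<lambda>u. f u - g u)"
  using graded_add[OF _ graded_cmult[of K D g "-1"], of f] by simp

lemma graded_sum: "finite I \<Longrightarrow> (\<And>i. i \<in> I \<Longrightarrow> C K D (f i)) \<Longrightarrow> C K D (\<lambda>u. \<Sum>i\<in>I. f i u)"
  by (induction I rule: finite_induct) (auto intro: graded_zero graded_add)

lemma graded_power: "C K D f \<Longrightarrow> C K (real n * D) (\<lambda>u. f u ^ n)"
proof (induction n)
  case 0
  then show ?case using graded_const[of K 1] by simp
next
  case (Suc n)
  then show ?case using graded_mult[of K D f "real n * D" "\<lambda>u. f u ^ n"] by (simp add: algebra_simps)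
qed

text \<open>A composition is handled through the family of all derivatives of the outer function:
  no closed form of the iterated derivatives is needed, only that differentiating a member leads
  back into the family, up to factors already known to be in the class.\<close>

lemma graded_family:
  assumes fam: "\<And>w D. (w, D) \<in> W \<Longrightarrow> B D w \<and> (\<forall>u\<in>\<Omega>. w differentiable (at u))"
    and du: "\<And>w D. (w, D) \<in> W \<Longrightarrow> \<exists>z1 w1 D1 z2 w2 D2. (w1, D1) \<in> W \<and> (w2, D2) \<in> W \<and>
        (\<forall>K. C K (D - 1 - D1) z1) \<and> (\<forall>K. C K (D - 1 - D2) z2) \<and>
        (\<forall>u\<in>\<Omega>. pu w u = z1 u * w1 u + z2 u * w2 u)"
    and dv: "\<And>w D. (w, D) \<in> W \<Longrightarrow> \<exists>z1 w1 D1 z2 w2 D2. (w1, D1) \<in> W \<and> (w2, D2) \<in> W \<and>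
        (\<forall>K. C K (D - 1 - D1) z1) \<and> (\<forall>K. C K (D - 1 - D2) z2) \<and>
        (\<forall>u\<in>\<Omega>. pv w u = z1 u * w1 u + z2 u * w2 u)"
  shows "C K E y \<Longrightarrow> (w, D) \<in> W \<Longrightarrow> C K (E + D) (\<lambda>u. y u * w u)"
proof (induction K arbitrary: E y w D)
  case 0
  then show ?case using fam B_mult by simp
next
  case (Suc K)
  note y = graded_Suc[OF Suc.prems(1)]
  have y': "\<And>u. u \<in> \<Omega> \<Longrightarrow> y differentiable (at u)" "C K (E - 1) (pu y)" "C K (E - 1) (pv y)"
    using Suc.prems(1) by auto
  have w': "\<And>u. u \<in> \<Omega> \<Longrightarrow> w differentiable (at u)" using fam Suc.prems by auto
  \<comment> \<open>The factor \<open>z1\<close> is merged into the free multiplier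
    \<open>y\<close>, after which the induction hypothesis applies to \<open>w1\<close>; this is why
    \<open>y\<close> is generalised. Two summands are carried because the derivative of a flat
    exponential has two.\<close>
  have 1: "C K (E + D - 1) (\<lambda>u. y u * (z1 u * w1 u + z2 u * w2 u))"
    if "(w1, D1) \<in> W" "(w2, D2) \<in> W"
        "\<forall>K. C K (D - 1 - D1) z1" "\<forall>K. C K (D - 1 - D2) z2" for z1 w1 D1 z2 w2 D2
  proof -
    have "C K (E + (D - 1 - D1)) (\<lambda>u. y u * z1 u)" "C K (E + (D - 1 - D2)) (\<lambda>u. y u * z2 u)"
      using that y by (auto intro: graded_mult)
    then have "C K (E + (D - 1 - D1) + D1) (\<lambda>u. y u * z1 u * w1 u)"
        "C K (E + (D - 1 - D2) + D2) (\<lambda>u. y u * z2 u * w2 u)"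
      using that Suc.IH by blast+
    then have "C K (E + D - 1) (\<lambda>u. y u * z1 u * w1 u + y u * z2 u * w2 u)"
      by (intro graded_add) (simp_all add: algebra_simps)
    then show ?thesis by (rule graded_cong[rotated]) (simp add: algebra_simps)
  qed
  have 2: "C K (E + D - 1) (\<lambda>u. pu y u * w u)" "C K (E + D - 1) (\<lambda>u. pv y u * w u)"
    using Suc.IH[OF y'(2) Suc.prems(2)] Suc.IH[OF y'(3) Suc.prems(2)] by (simp_all add: algebra_simps)
  obtain z1 w1 D1 z2 w2 D2 where U: "(w1, D1) \<in> W" "(w2, D2) \<in> W"
        "\<forall>K. C K (D - 1 - D1) z1" "\<forall>K. C K (D - 1 - D2) z2"
        "\<forall>u\<in>\<Omega>. pu w u = z1 u * w1 u + z2 u * w2 u"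
    using du[OF Suc.prems(2)] by blast
  have pu: "C K (E + D - 1) (pu (\<lambda>u. y u * w u))"
    by (rule graded_cong[OF _ graded_add[OF 2(1) 1[OF U(1-4)]]]) (use y' w' U in \<open>simp add: pu_mult\<close>)
  obtain z1 w1 D1 z2 w2 D2 where V: "(w1, D1) \<in> W" "(w2, D2) \<in> W"
        "\<forall>K. C K (D - 1 - D1) z1" "\<forall>K. C K (D - 1 - D2) z2"
        "\<forall>u\<in>\<Omega>. pv w u = z1 u * w1 u + z2 u * w2 u"
    using dv[OF Suc.prems(2)] by blast
  have pv: "C K (E + D - 1) (pv (\<lambda>u. y u * w u))"
    by (rule graded_cong[OF _ graded_add[OF 2(2) 1[OF V(1-4)]]]) (use y' w' V in \<open>simp add: pv_mult\<close>)
  show ?case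
    using pu pv y' w' Suc.prems fam B_mult by (auto dest: graded_B)
qed

end

abbreviation kdiff_on :: "(real \<times> real) set \<Rightarrow> nat \<Rightarrow> (real \<times> real \<Rightarrow> real) \<Rightarrow> bool" where
  "kdiff_on \<Omega> K f \<equiv> graded \<Omega> (\<lambda>_ _. True) K 0 f"

lemma grading_trivial: "open \<Omega> \<Longrightarrow> grading \<Omega> (\<lambda>_ _. True)"
  by unfold_locales auto

text \<open>With the trivial bound the degree is a dummy, so \<open>kdiff_on\<close> can fix it at 0
  although the recursion keeps lowering it.\<close>

lemma graded_trivial: "graded \<Omega> (\<lambda>_ _. True) K D f = kdiff_on \<Omega> K f"
proof (induction K arbitrary: D f)
  case (Suc K)
  have "graded \<Omega> (\<lambda>_ _. True) K (D - 1) (pu f) = graded \<Omega> (\<lambda>_ _. True) K (0 - 1) (pu f)"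
       "graded \<Omega> (\<lambda>_ _. True) K (D - 1) (pv f) = graded \<Omega> (\<lambda>_ _. True) K (0 - 1) (pv f)"
    using Suc.IH by (blast+)
  then show ?case by simp
qed simp

lemma kdiff_on_Suc: "kdiff_on \<Omega> (Suc K) f \<longleftrightarrow> (\<forall>u\<in>\<Omega>. f differentiable (at u)) \<and> kdiff_on \<Omega> K (pu f) \<and> kdiff_on \<Omega> K (pv f)"
  by (simp add: graded_trivial[of _ _ "- 1"])

lemma kdiff_on_subset: "kdiff_on \<Omega> K f \<Longrightarrow> \<Omega>' \<subseteq> \<Omega> \<Longrightarrow> kdiff_on \<Omega>' K f"
  by (induction K arbitrary: f) (auto simp: kdiff_on_Suc simp del: graded.simps(2))

text \<open>All conditions are pointwise and use full neighbourhoods (\<open>at u\<close>), so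
  regularity on two sets glues without compatibility conditions. Functions are patched across the
  origin in this way.\<close>

lemma kdiff_on_Un: "kdiff_on \<Omega> K f \<Longrightarrow> kdiff_on \<Omega>' K f \<Longrightarrow> kdiff_on (\<Omega> \<union> \<Omega>') K f"
  by (induction K arbitrary: f) (auto simp: kdiff_on_Suc simp del: graded.simps(2))

lemma smooth_on_pu: "smooth_on S f \<Longrightarrow> smooth_on S (pu f)"
  and smooth_on_pv: "smooth_on S f \<Longrightarrow> smooth_on S (pv f)"
proof -
  have *: "g \<in> derivs f" if "g \<in> derivs f'" "f' \<in> derivs f" for g f'
    using that by (induction rule: derivs.induct) (auto intro: derivs.intros)
  have "pu f \<in> derivs f" "pv f \<in> derivs f" by (auto intro: derivs.intros)
  with * show "smooth_on S f \<Longrightarrow> smooth_on S (pu f)" "smooth_on S f \<Longrightarrow> smooth_on S (pv f)"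
    unfolding smooth_on_def by blast+
qed

text \<open>Links the set of all iterated partials to a recursion that counts orders: the remainders
  at the origin are only known to be finitely often differentiable, so \<open>smooth_on\<close>
  alone cannot describe them.\<close>

lemma smooth_on_iff_kdiff_on: "smooth_on S f \<longleftrightarrow> (\<forall>K. kdiff_on S K f)"
proof
  assume "smooth_on S f"
  then have "kdiff_on S K f" for K
  proof (induction K arbitrary: f)
    case (Suc K)
    then show ?case
      unfolding kdiff_on_Suc using Suc.IH[OF smooth_on_pu] Suc.IH[OF smooth_on_pv] derivs.self[of f]
      by (auto simp: smooth_on_def)
  qed simp
  then show "\<forall>K. kdiff_on S K f" by simp
next
  assume *: "\<forall>K. kdiff_on S K f"
  have "\<forall>K. kdiff_on S K g" if "g \<in> derivs f" for g
    using that
  proof (induction rule: derivs.induct)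
    case (du g)
    then show ?case by (metis kdiff_on_Suc)
  next
    case (dv g)
    then show ?case by (metis kdiff_on_Suc)
  qed (use * in auto)
  then show "smooth_on S f"
    unfolding smooth_on_def by (metis kdiff_on_Suc)
qed

section \<open>The maximum norm and closure properties of smooth functions\<close>

lemma mnorm_nonneg [simp]: "0 \<le> mnorm u"
  unfolding mnorm_def by linarith

lemma mnorm_zero_iff [simp]: "mnorm u = 0 \<longleftrightarrow> u = (0, 0)"
  unfolding mnorm_def by (cases u) (auto simp: max_def)

lemma mnorm_origin [simp]: "mnorm (0, 0) = 0"
  by simp

lemma mnorm_pos: "u \<noteq> (0, 0) \<Longrightarrow> 0 < mnorm u"
  using mnorm_nonneg[of u] mnorm_zero_iff[of u] by linarith

lemma mnorm_scale: "mnorm (c * fst u, c * snd u) = \<bar>c\<bar> * mnorm u"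
  unfolding mnorm_def by (simp add: abs_mult max_mult_distrib_left)

lemma fst_le_mnorm: "\<bar>fst u\<bar> \<le> mnorm u" and snd_le_mnorm: "\<bar>snd u\<bar> \<le> mnorm u"
  unfolding mnorm_def by auto

lemma continuous_on_mnorm [continuous_intros]: "continuous_on S mnorm"
proof -
  have "mnorm = (\<lambda>u. max \<bar>fst u\<bar> \<bar>snd u\<bar>)" by (rule ext) (simp add: mnorm_def)
  show ?thesis unfolding \<open>mnorm = _\<close> by (intro continuous_intros)
qed

lemma open_mnorm_less [simp]: "open {u. mnorm u < r}"
  using open_Collect_less[OF continuous_on_mnorm continuous_on_const] by simp

lemma open_mnorm_greater [simp]: "open {u. r < mnorm u}"
  using open_Collect_less[OF continuous_on_const continuous_on_mnorm] by simp

lemma mnorm_le_cbox: "{u. mnorm u \<le> r} = cbox (- r, - r) (r, r)"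
  by (auto simp: mnorm_def cbox_Pair_eq abs_le_iff)

lemma compact_mnorm_le [simp]: "compact {u. mnorm u \<le> r}"
  unfolding mnorm_le_cbox by (rule compact_cbox)

interpretation plane: grading UNIV "\<lambda>_ _. True"
  by (rule grading_trivial) simp

lemma smooth_differentiable: "smooth_on S f \<Longrightarrow> u \<in> S \<Longrightarrow> f differentiable (at u)"
  unfolding smooth_on_def using derivs.self by blast

lemma smooth_continuous: "smooth_on UNIV f \<Longrightarrow> continuous_on S f"
  by (meson UNIV_I continuous_at_imp_continuous_on differentiable_imp_continuous_within
      smooth_differentiable)

lemma smooth_coords: "smooth_on UNIV (fst :: real \<times> real \<Rightarrow> real)" "smooth_on UNIV (snd :: real \<times> real \<Rightarrow> real)"
proof -
  have "kdiff_on UNIV K (fst :: real \<times> real \<Rightarrow> real)" "kdiff_on UNIV K (snd :: real \<times> real \<Rightarrow> real)" for K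
    by (cases K, simp_all add: kdiff_on_Suc plane.graded_const bounded_linear_imp_differentiable
        bounded_linear_fst bounded_linear_snd del: graded.simps(2))+
  then show "smooth_on UNIV (fst :: real \<times> real \<Rightarrow> real)" "smooth_on UNIV (snd :: real \<times> real \<Rightarrow> real)"
    by (auto simp: smooth_on_iff_kdiff_on)
qed

lemma smooth_const: "smooth_on UNIV (\<lambda>_. c :: real)"
  by (simp add: smooth_on_iff_kdiff_on plane.graded_const)

lemma smooth_add: "smooth_on UNIV f \<Longrightarrow> smooth_on UNIV g \<Longrightarrow> smooth_on UNIV (\<lambda>u. f u + g u :: real)"
  by (simp add: smooth_on_iff_kdiff_on plane.graded_add)

lemma smooth_diff: "smooth_on UNIV f \<Longrightarrow> smooth_on UNIV g \<Longrightarrow> smooth_on UNIV (\<lambda>u. f u - g u :: real)"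
  by (simp add: smooth_on_iff_kdiff_on plane.graded_diff)

lemma smooth_mult: "smooth_on UNIV f \<Longrightarrow> smooth_on UNIV g \<Longrightarrow> smooth_on UNIV (\<lambda>u. f u * g u :: real)"
  using plane.graded_mult[of _ 0 f 0 g] by (simp add: smooth_on_iff_kdiff_on)

lemma smooth_power: "smooth_on UNIV f \<Longrightarrow> smooth_on UNIV (\<lambda>u. f u ^ n :: real)"
  using plane.graded_power[of _ 0 f n] by (simp add: smooth_on_iff_kdiff_on)

lemma smooth_sum: "finite I \<Longrightarrow> (\<And>i. i \<in> I \<Longrightarrow> smooth_on UNIV (f i)) \<Longrightarrow>
    smooth_on UNIV (\<lambda>u. \<Sum>i\<in>I. f i u :: real)"
  using plane.graded_sum[of I _ 0 f] by (simp add: smooth_on_iff_kdiff_on)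

lemmas smooth_intros = smooth_const smooth_add smooth_diff smooth_mult smooth_power smooth_sum
  smooth_coords

subsection \<open>Taylor expansion\<close>

text \<open>Mean value theorem in the first variable for a difference in the second, then in the
  second variable. The next lemma takes the opposite order; comparing the two identifies the mixed
  partials.\<close>

lemma second_difference:
  fixes f :: "real \<times> real \<Rightarrow> real"
  assumes f: "smooth_on UNIV f" and t: "t > 0"
  obtains \<xi> \<zeta> where "x < \<xi>" "\<xi> < x + t" "y < \<zeta>" "\<zeta> < y + t"
    "f (x + t, y + t) - f (x + t, y) - f (x, y + t) + f (x, y) = t * t * pv (pu f) (\<xi>, \<zeta>)"
proof -
  have "\<exists>z>x. z < x + t \<and> (f (x + t, y + t) - f (x + t, y)) - (f (x, y + t) - f (x, y)) =
      (x + t - x) * (pu f (z, y + t) - pu f (z, y))"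
    using t by (intro MVT2) (auto intro!: derivative_eq_intros
      has_pu[of f "(_, _)", simplified] smooth_differentiable[OF f])
  then obtain \<xi> where \<xi>: "x < \<xi>" "\<xi> < x + t" "(f (x + t, y + t) - f (x + t, y)) - (f (x, y + t) - f (x, y)) =
      t * (pu f (\<xi>, y + t) - pu f (\<xi>, y))" by auto
  have "\<exists>z>y. z < y + t \<and> pu f (\<xi>, y + t) - pu f (\<xi>, y) = (y + t - y) * pv (pu f) (\<xi>, z)"
    using t by (intro MVT2) (auto intro!: derivative_eq_intros
      has_pv[of "pu f" "(_, _)", simplified] smooth_differentiable[OF smooth_on_pu[OF f]])
  then obtain \<zeta> where "y < \<zeta>" "\<zeta> < y + t" "pu f (\<xi>, y + t) - pu f (\<xi>, y) = t * pv (pu f) (\<xi>, \<zeta>)"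
    by auto
  with \<xi> show ?thesis by (intro that[of \<xi> \<zeta>]) auto
qed

lemma second_difference':
  fixes f :: "real \<times> real \<Rightarrow> real"
  assumes f: "smooth_on UNIV f" and t: "t > 0"
  obtains \<xi> \<zeta> where "x < \<xi>" "\<xi> < x + t" "y < \<zeta>" "\<zeta> < y + t"
    "f (x + t, y + t) - f (x + t, y) - f (x, y + t) + f (x, y) = t * t * pu (pv f) (\<xi>, \<zeta>)"
proof -
  have "\<exists>z>y. z < y + t \<and> (f (x + t, y + t) - f (x, y + t)) - (f (x + t, y) - f (x, y)) =
      (y + t - y) * (pv f (x + t, z) - pv f (x, z))"
    using t by (intro MVT2) (auto intro!: derivative_eq_intros
      has_pv[of f "(_, _)", simplified] smooth_differentiable[OF f])
  then obtain \<zeta> where \<zeta>: "y < \<zeta>" "\<zeta> < y + t" "(f (x + t, y + t) - f (x, y + t)) - (f (x + t, y) - f (x, y)) =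
      t * (pv f (x + t, \<zeta>) - pv f (x, \<zeta>))" by auto
  have "\<exists>z>x. z < x + t \<and> pv f (x + t, \<zeta>) - pv f (x, \<zeta>) = (x + t - x) * pu (pv f) (z, \<zeta>)"
    using t by (intro MVT2) (auto intro!: derivative_eq_intros
      has_pu[of "pv f" "(_, _)", simplified] smooth_differentiable[OF smooth_on_pv[OF f]])
  then obtain \<xi> where "x < \<xi>" "\<xi> < x + t" "pv f (x + t, \<zeta>) - pv f (x, \<zeta>) = t * pu (pv f) (\<xi>, \<zeta>)"
    by auto
  with \<zeta> show ?thesis by (intro that[of \<xi> \<zeta>]) (auto simp: algebra_simps)
qed

text \<open>Schwarz's theorem. The same second difference over a small square equals
  \<open>t * t\<close> times either mixed partial at some interior point. By continuity both values
  are within \<open>e\<close> of those at \<open>u\<close>, which is contradictory as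
  \<open>e\<close> is half of the assumed gap.\<close>

lemma pu_pv_commute:
  fixes f :: "real \<times> real \<Rightarrow> real"
  assumes f: "smooth_on UNIV f"
  shows "pu (pv f) = pv (pu f)"
proof (rule ext, rule ccontr)
  fix u :: "real \<times> real"
  obtain x y where u: "u = (x, y)" by (cases u)
  assume "pu (pv f) u \<noteq> pv (pu f) u"
  define e where "e = \<bar>pu (pv f) u - pv (pu f) u\<bar> / 2"
  have e: "e > 0" using \<open>pu (pv f) u \<noteq> pv (pu f) u\<close> by (simp add: e_def)
  have "isCont (pu (pv f)) u" "isCont (pv (pu f)) u"
    by (intro differentiable_imp_continuous_within smooth_differentiable[of UNIV]
        smooth_on_pu smooth_on_pv f UNIV_I)+
  then obtain d1 d2 where d: "d1 > 0" "\<And>v. dist v u < d1 \<Longrightarrow> dist (pu (pv f) v) (pu (pv f) u) < e"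
      "d2 > 0" "\<And>v. dist v u < d2 \<Longrightarrow> dist (pv (pu f) v) (pv (pu f) u) < e"
    unfolding continuous_at_eps_delta using e by (metis dist_commute)
  define t where "t = min d1 d2 / 4"
  have t: "t > 0" "2 * t < d1" "2 * t < d2" using d by (auto simp: t_def)
  have near: "dist (\<xi>, \<zeta>) u < 2 * t" if "x < \<xi>" "\<xi> < x + t" "y < \<zeta>" "\<zeta> < y + t" for \<xi> \<zeta>
  proof -
    have "dist (\<xi>, \<zeta>) u \<le> \<bar>\<xi> - x\<bar> + \<bar>\<zeta> - y\<bar>"
      unfolding u dist_norm diff_Pair by (rule order_trans[OF norm_Pair_le]) simp
    then show ?thesis using that by linarith
  qed
  obtain \<xi> \<zeta> where 1: "x < \<xi>" "\<xi> < x + t" "y < \<zeta>" "\<zeta> < y + t"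
    "f (x + t, y + t) - f (x + t, y) - f (x, y + t) + f (x, y) = t * t * pv (pu f) (\<xi>, \<zeta>)"
    using second_difference[OF f t(1)] by metis
  obtain \<xi>' \<zeta>' where 2: "x < \<xi>'" "\<xi>' < x + t" "y < \<zeta>'" "\<zeta>' < y + t"
    "f (x + t, y + t) - f (x + t, y) - f (x, y + t) + f (x, y) = t * t * pu (pv f) (\<xi>', \<zeta>')"
    using second_difference'[OF f t(1)] by metis
  have eq: "pv (pu f) (\<xi>, \<zeta>) = pu (pv f) (\<xi>', \<zeta>')" using 1(5) 2(5) t(1) by simp
  have "dist (pv (pu f) (\<xi>, \<zeta>)) (pv (pu f) u) < e" "dist (pu (pv f) (\<xi>', \<zeta>')) (pu (pv f) u) < e"
    using d near[OF 1(1-4)] near[OF 2(1-4)] t by (meson less_trans)+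
  then have "\<bar>pu (pv f) u - pv (pu f) u\<bar> < e + e"
    unfolding eq dist_real_def by (smt (verit))
  then show False by (simp add: e_def)
qed

primrec vanish :: "nat \<Rightarrow> (real \<times> real \<Rightarrow> real) \<Rightarrow> bool" where
  "vanish 0 f = True"
| "vanish (Suc n) f = (f (0, 0) = 0 \<and> vanish n (pu f) \<and> vanish n (pv f))"

definition tcoeff :: "(real \<times> real \<Rightarrow> real) \<Rightarrow> nat \<times> nat \<Rightarrow> real" where
  "tcoeff f = (\<lambda>(i, j). (pu ^^ i) ((pv ^^ j) f) (0, 0) / (fact i * fact j))"

definition mon :: "nat \<times> nat \<Rightarrow> real \<times> real \<Rightarrow> real" where
  "mon = (\<lambda>(i, j) u. fst u ^ i * snd u ^ j)"

definition low_degrees :: "nat \<Rightarrow> (nat \<times> nat) set" where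
  "low_degrees n = {(i, j). i + j < n}"

text \<open>Degrees run strictly below \<open>n\<close>, so this is the polynomial of degree n - 1
  and its remainder vanishes to order \<open>n\<close>.\<close>

definition taylor :: "nat \<Rightarrow> (real \<times> real \<Rightarrow> real) \<Rightarrow> real \<times> real \<Rightarrow> real" where
  "taylor n f u = (\<Sum>k\<in>low_degrees n. tcoeff f k * mon k u)"

lemma finite_low_degrees [simp]: "finite (low_degrees n)"
  by (rule finite_subset[of _ "{..n} \<times> {..n}"]) (auto simp: low_degrees_def)

lemma finite_sum_less [simp]: "finite {(i, j). i + j < (n :: nat)}"
  using finite_low_degrees[of n] by (simp add: low_degrees_def)

lemma smooth_mon: "smooth_on UNIV (mon k)"
  unfolding mon_def by (cases k) (auto intro!: smooth_intros)

lemma smooth_taylor: "smooth_on UNIV (taylor n f)"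
  unfolding taylor_def[abs_def] by (intro smooth_intros smooth_mon) auto

lemma smooth_pv_iter: "smooth_on UNIV f \<Longrightarrow> smooth_on UNIV ((pv ^^ n) f)"
  by (induction n) (auto intro: smooth_on_pv)

lemma pv_iter_pu: "smooth_on UNIV (f :: real \<times> real \<Rightarrow> real) \<Longrightarrow> (pv ^^ n) (pu f) = pu ((pv ^^ n) f)"
  by (induction n) (auto simp: pu_pv_commute smooth_pv_iter)

lemma tcoeff_pu:
  "smooth_on UNIV f \<Longrightarrow> real (Suc i) * tcoeff f (Suc i, j) = tcoeff (pu f) (i, j)"
  by (simp add: tcoeff_def pv_iter_pu funpow_swap1 del: of_nat_Suc)

lemma tcoeff_pv: "real (Suc j) * tcoeff f (i, Suc j) = tcoeff (pv f) (i, j)"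
  by (simp add: tcoeff_def funpow_swap1 del: of_nat_Suc)

text \<open>Terms free of the first variable drop out and the others are shifted by
  \<open>Suc\<close>, the exponent being absorbed by the factorial. Commuting partials enter because
  \<open>tcoeff\<close> applies \<open>pv\<close> first.\<close>

lemma pu_taylor:
  assumes f: "smooth_on UNIV f"
  shows "pu (taylor (Suc n) f) = taylor n (pu f)"
proof
  fix u
  have "((\<lambda>t. taylor (Suc n) f (t, snd u)) has_real_derivative
      (\<Sum>k\<in>low_degrees (Suc n). tcoeff f k * (real (fst k) * fst u ^ (fst k - 1) * snd u ^ snd k))) (at (fst u))"
    unfolding taylor_def mon_def
    by (auto intro!: derivative_eq_intros sum.cong simp: split_beta)
  moreover have "(\<Sum>k\<in>low_degrees (Suc n). tcoeff f k * (real (fst k) * fst u ^ (fst k - 1) * snd u ^ snd k)) =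
    (\<Sum>k\<in>(\<lambda>(i, j). (Suc i, j)) ` low_degrees n. tcoeff f k * (real (fst k) * fst u ^ (fst k - 1) * snd u ^ snd k))"
  proof (rule sum.mono_neutral_right, goal_cases)
    case 3
    show ?case
    proof
      fix k assume k: "k \<in> low_degrees (Suc n) - (\<lambda>(i, j). (Suc i, j)) ` low_degrees n"
      have "fst k = 0"
      proof (cases "fst k")
        case (Suc i)
        with k show ?thesis by (force simp: low_degrees_def image_iff)
      qed
      then show "tcoeff f k * (real (fst k) * fst u ^ (fst k - 1) * snd u ^ snd k) = 0" by simp
    qed
  qed (auto simp: low_degrees_def)
  moreover have "\<dots> = taylor n (pu f) u"
    unfolding taylor_def
    by (subst sum.reindex) (auto simp: inj_on_def mon_def tcoeff_pu[OF f, symmetric]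
        mult_ac intro!: sum.cong)
  ultimately show "pu (taylor (Suc n) f) u = taylor n (pu f) u" by (simp add: pu_eqI)
qed

lemma pv_taylor:
  "pv (taylor (Suc n) f) = taylor n (pv f)"
proof
  fix u
  have "((\<lambda>t. taylor (Suc n) f (fst u, t)) has_real_derivative
      (\<Sum>k\<in>low_degrees (Suc n). tcoeff f k * (fst u ^ fst k * (real (snd k) * snd u ^ (snd k - 1))))) (at (snd u))"
    unfolding taylor_def mon_def
    by (auto intro!: derivative_eq_intros sum.cong simp: split_beta)
  moreover have "(\<Sum>k\<in>low_degrees (Suc n). tcoeff f k * (fst u ^ fst k * (real (snd k) * snd u ^ (snd k - 1)))) =
    (\<Sum>k\<in>(\<lambda>(i, j). (i, Suc j)) ` low_degrees n. tcoeff f k * (fst u ^ fst k * (real (snd k) * snd u ^ (snd k - 1))))"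
  proof (rule sum.mono_neutral_right, goal_cases)
    case 3
    show ?case
    proof
      fix k assume k: "k \<in> low_degrees (Suc n) - (\<lambda>(i, j). (i, Suc j)) ` low_degrees n"
      have "snd k = 0"
      proof (cases "snd k")
        case (Suc i)
        with k show ?thesis by (force simp: low_degrees_def image_iff)
      qed
      then show "tcoeff f k * (fst u ^ fst k * (real (snd k) * snd u ^ (snd k - 1))) = 0" by simp
    qed
  qed (auto simp: low_degrees_def)
  moreover have "\<dots> = taylor n (pv f) u"
    unfolding taylor_def
    by (subst sum.reindex) (auto simp: inj_on_def mon_def tcoeff_pv[symmetric]
        mult_ac intro!: sum.cong)
  ultimately show "pv (taylor (Suc n) f) u = taylor n (pv f) u" by (simp add: pv_eqI)
qed

lemma taylor_zero: "taylor (Suc n) f (0, 0) = f (0, 0)"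
proof -
  have "taylor (Suc n) f (0, 0) = (\<Sum>k\<in>{(0, 0)}. tcoeff f k * mon k (0, 0))"
    unfolding taylor_def by (rule sum.mono_neutral_right) (auto simp: low_degrees_def mon_def)
  then show ?thesis by (simp add: tcoeff_def mon_def)
qed

lemma pu_diff: "f differentiable (at u) \<Longrightarrow> g differentiable (at u) \<Longrightarrow>
    pu (\<lambda>x. f x - g x :: real) u = pu f u - pu g u"
  by (intro pu_eqI) (auto intro!: derivative_eq_intros has_pu)

lemma pv_diff: "f differentiable (at u) \<Longrightarrow> g differentiable (at u) \<Longrightarrow>
    pv (\<lambda>x. f x - g x :: real) u = pv f u - pv g u"
  by (intro pv_eqI) (auto intro!: derivative_eq_intros has_pv)

lemma vanish_taylor: "smooth_on UNIV f \<Longrightarrow> vanish n (\<lambda>u. f u - taylor n f u)"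
proof (induction n arbitrary: f)
  case (Suc n)
  have "pu (\<lambda>u. f u - taylor (Suc n) f u) = (\<lambda>u. pu f u - taylor n (pu f) u)"
       "pv (\<lambda>u. f u - taylor (Suc n) f u) = (\<lambda>u. pv f u - taylor n (pv f) u)"
    by (auto simp: fun_eq_iff pu_diff pv_diff smooth_differentiable[OF Suc.prems]
        smooth_differentiable[OF smooth_taylor] pu_taylor[OF Suc.prems] pv_taylor)
  then show ?case
    using Suc.IH[OF smooth_on_pu[OF Suc.prems]] Suc.IH[OF smooth_on_pv[OF Suc.prems]]
    by (simp add: taylor_zero)
qed simp

text \<open>Induction on the order: the point is reached from the origin along the second axis and
  then parallel to the first. On both legs \<open>mnorm\<close> never exceeds
  \<open>mnorm u\<close>, so the mean value inequality gains one power over the bounds on the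
  partials.\<close>

lemma vanish_bound:
  assumes "smooth_on UNIV f" "vanish n f"
  shows "\<exists>C. \<forall>u. mnorm u \<le> r \<longrightarrow> \<bar>f u\<bar> \<le> C * mnorm u ^ n"
  using assms
proof (induction n arbitrary: f)
  case 0
  have "bounded (f ` {u. mnorm u \<le> r})"
    by (intro compact_imp_bounded compact_continuous_image smooth_continuous 0 compact_mnorm_le)
  then show ?case unfolding bounded_iff by auto
next
  case (Suc n)
  obtain C1 C2 where C: "\<And>u. mnorm u \<le> r \<Longrightarrow> \<bar>pu f u\<bar> \<le> C1 * mnorm u ^ n"
      "\<And>u. mnorm u \<le> r \<Longrightarrow> \<bar>pv f u\<bar> \<le> C2 * mnorm u ^ n"
    using Suc.IH[of "pu f"] Suc.IH[of "pv f"] Suc.prems smooth_on_pu smooth_on_pv by (metis vanish.simps(2))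
  have "\<bar>f u\<bar> \<le> (\<bar>C1\<bar> + \<bar>C2\<bar>) * mnorm u ^ Suc n" if u: "mnorm u \<le> r" for u
  proof -
    have le: "C * mnorm v ^ n \<le> \<bar>C\<bar> * mnorm u ^ n" if "mnorm v \<le> mnorm u" for v C
      by (intro mult_mono power_mono that) auto
    have "norm (f (fst u, snd u) - f (0, snd u)) \<le> (\<bar>C1\<bar> * mnorm u ^ n) * norm (fst u - 0)"
    proof (rule field_differentiable_bound[where S = "{-\<bar>fst u\<bar>..\<bar>fst u\<bar>}" and f' = "\<lambda>t. pu f (t, snd u)"])
      fix z assume z: "z \<in> {-\<bar>fst u\<bar>..\<bar>fst u\<bar>}"
      show "((\<lambda>t. f (t, snd u)) has_field_derivative pu f (z, snd u)) (at z within {-\<bar>fst u\<bar>..\<bar>fst u\<bar>})"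
        using has_pu[of f "(z, snd u)"] smooth_differentiable[OF Suc.prems(1)]
        by (auto intro: DERIV_subset)
      have m: "mnorm (z, snd u) \<le> mnorm u" using z unfolding mnorm_def by auto
      show "norm (pu f (z, snd u)) \<le> \<bar>C1\<bar> * mnorm u ^ n"
        using C(1)[of "(z, snd u)"] le[OF m, of C1] m u by simp
    qed auto
    moreover have "norm (f (0, snd u) - f (0, 0)) \<le> (\<bar>C2\<bar> * mnorm u ^ n) * norm (snd u - 0)"
    proof (rule field_differentiable_bound[where S = "{-\<bar>snd u\<bar>..\<bar>snd u\<bar>}" and f' = "\<lambda>t. pv f (0, t)"])
      fix z assume z: "z \<in> {-\<bar>snd u\<bar>..\<bar>snd u\<bar>}"
      show "((\<lambda>t. f (0, t)) has_field_derivative pv f (0, z)) (at z within {-\<bar>snd u\<bar>..\<bar>snd u\<bar>})"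
        using has_pv[of f "(0, z)"] smooth_differentiable[OF Suc.prems(1)]
        by (auto intro: DERIV_subset)
      have m: "mnorm (0, z) \<le> mnorm u" using z unfolding mnorm_def by auto
      show "norm (pv f (0, z)) \<le> \<bar>C2\<bar> * mnorm u ^ n"
        using C(2)[of "(0, z)"] le[OF m, of C2] m u by simp
    qed auto
    moreover have "(\<bar>C1\<bar> * mnorm u ^ n) * \<bar>fst u\<bar> \<le> (\<bar>C1\<bar> * mnorm u ^ n) * mnorm u"
      "(\<bar>C2\<bar> * mnorm u ^ n) * \<bar>snd u\<bar> \<le> (\<bar>C2\<bar> * mnorm u ^ n) * mnorm u"
      by (intro mult_left_mono fst_le_mnorm snd_le_mnorm; simp)+
    moreover have "f (0, 0) = 0" using Suc.prems by simp
    ultimately have "\<bar>f u\<bar> \<le> (\<bar>C1\<bar> * mnorm u ^ n) * mnorm u + (\<bar>C2\<bar> * mnorm u ^ n) * mnorm u"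
      unfolding real_norm_def prod.collapse diff_0_right by linarith
    then show ?thesis by (simp add: algebra_simps)
  qed
  then show ?case by blast
qed

lemma mon_scale: "mon k (t * fst u, t * snd u) = t ^ (fst k + snd k) * mon k u"
  unfolding mon_def by (cases k) (simp add: power_mult_distrib power_add)

text \<open>Degree by degree: if all lower terms vanish, the homogeneous part \<open>H\<close> of
  degree \<open>k\<close> is compared with \<open>f\<close> at the shrunk point t u, and letting t
  tend to 0 kills it. This turns growth assumptions into vanishing Taylor coefficients.\<close>

lemma taylor_eq_zero:
  assumes f: "smooth_on UNIV f" and \<delta>: "\<delta> > 0"
    and bound: "\<And>u. mnorm u < \<delta> \<Longrightarrow> u \<noteq> (0, 0) \<Longrightarrow> \<bar>f u\<bar> \<le> C * mnorm u ^ n"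
  shows "k \<le> n \<Longrightarrow> taylor k f u = 0"
proof (induction k arbitrary: u)
  case (Suc k)
  obtain C' where C': "\<And>u. mnorm u \<le> \<delta> \<Longrightarrow> \<bar>f u - taylor (Suc k) f u\<bar> \<le> C' * mnorm u ^ Suc k"
    using vanish_bound[OF smooth_diff[OF f smooth_taylor] vanish_taylor[OF f]] by blast
  define H where "H u = (\<Sum>k'\<in>{(i, j). i + j = k}. tcoeff f k' * mon k' u)" for u
  have fin: "finite {(i, j). i + j = k}" by (rule finite_subset[of _ "{..k} \<times> {..k}"]) auto
  have "taylor (Suc k) f u = taylor k f u + H u" for u
  proof -
    have "low_degrees (Suc k) = low_degrees k \<union> {(i, j). i + j = k}" by (auto simp: low_degrees_def)
    moreover have "low_degrees k \<inter> {(i, j). i + j = k} = {}" by (auto simp: low_degrees_def)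
    ultimately show ?thesis unfolding taylor_def H_def using fin by (simp add: sum.union_disjoint)
  qed
  with Suc have T: "taylor (Suc k) f u = H u" for u by simp
  have "H u = 0"
  proof (cases "u = (0, 0)")
    case True
    \<comment> \<open>The bound excludes the origin itself, so the value there comes from continuity
      along an axis; \<open>n\<close> is positive because \<open>Suc k \<le> n\<close>.\<close>
    have "f (0, 0) = 0"
    proof -
      have "continuous (at (0, 0)) f"
        using smooth_differentiable[OF f] differentiable_imp_continuous_within by blast
      then have lim: "((\<lambda>t. f (t, 0)) \<longlongrightarrow> f (0, 0)) (at_right 0)"
        by (rule isCont_tendsto_compose) (auto intro!: tendsto_eq_intros)
      have "((\<lambda>t. f (t, 0)) \<longlongrightarrow> 0) (at_right 0)"
      proof (rule Lim_null_comparison)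
        show "\<forall>\<^sub>F t in at_right 0. norm (f (t, 0)) \<le> \<bar>C\<bar> * t ^ n"
          unfolding eventually_at_right_field
        proof (intro exI conjI allI impI)
          fix t :: real assume "0 < t" "t < \<delta>"
          then have "\<bar>f (t, 0)\<bar> \<le> C * mnorm (t, 0) ^ n" by (intro bound) (auto simp: mnorm_def)
          also have "\<dots> \<le> \<bar>C\<bar> * t ^ n" using \<open>0 < t\<close> by (auto simp: mnorm_def intro!: mult_right_mono)
          finally show "norm (f (t, 0)) \<le> \<bar>C\<bar> * t ^ n" by simp
        qed (rule \<delta>)
        have "n \<noteq> 0" using Suc.prems by auto
        then show "((\<lambda>t. \<bar>C\<bar> * t ^ n) \<longlongrightarrow> 0) (at_right 0)"
          by (auto intro!: tendsto_eq_intros)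
      qed
      with lim show ?thesis using tendsto_unique trivial_limit_at_right_real by blast
    qed
    then show ?thesis using T[of "(0, 0)"] taylor_zero[of k f] True by simp
  next
    case False
    define m where "m = mnorm u"
    have m: "m > 0" using mnorm_pos[OF False] by (simp add: m_def)
    \<comment> \<open>Homogeneity pulls out t^k on the left, while the given bound and the Taylor
      remainder are both of order t^(k+1), because \<open>Suc k \<le> n\<close> and
      \<open>t * m < 1\<close>.\<close>
    have H: "\<bar>H u\<bar> \<le> t * ((\<bar>C\<bar> + \<bar>C'\<bar>) * m ^ Suc k)" if t: "0 < t" "t * m < \<delta>" "t * m < 1" for t
    proof -
      let ?v = "(t * fst u, t * snd u)"
      have mv: "mnorm ?v = t * m" using mnorm_scale[of t u] t by (simp add: m_def)
      have "t * m > 0" using t m by simp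
      then have v0: "?v \<noteq> (0, 0)" using mv mnorm_zero_iff[of ?v] by linarith
      have "t ^ k * \<bar>H u\<bar> = \<bar>H ?v\<bar>"
      proof -
        have "H ?v = t ^ k * H u"
          unfolding H_def mon_scale sum_distrib_left by (intro sum.cong) auto
        then show ?thesis using t by (simp add: abs_mult)
      qed
      also have "\<dots> \<le> \<bar>f ?v\<bar> + \<bar>f ?v - taylor (Suc k) f ?v\<bar>" unfolding T by linarith
      also have "\<dots> \<le> C * (t * m) ^ n + C' * (t * m) ^ Suc k"
        using bound[of ?v] C'[of ?v] mv v0 t by simp
      also have "\<dots> \<le> \<bar>C\<bar> * (t * m) ^ Suc k + \<bar>C'\<bar> * (t * m) ^ Suc k"
      proof (intro add_mono)
        have "(t * m) ^ n \<le> (t * m) ^ Suc k"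
          using Suc.prems t \<open>t * m > 0\<close> by (intro power_decreasing) auto
        then show "C * (t * m) ^ n \<le> \<bar>C\<bar> * (t * m) ^ Suc k"
          using \<open>t * m > 0\<close> by (intro mult_mono) auto
        show "C' * (t * m) ^ Suc k \<le> \<bar>C'\<bar> * (t * m) ^ Suc k"
          using \<open>t * m > 0\<close> by (intro mult_right_mono) auto
      qed
      also have "\<dots> = t ^ k * (t * ((\<bar>C\<bar> + \<bar>C'\<bar>) * m ^ Suc k))"
        by (simp add: power_mult_distrib algebra_simps)
      finally show ?thesis using t by simp
    qed
    have "\<bar>H u\<bar> \<le> 0"
    proof (rule tendsto_le[of "at_right (0::real)"])
      show "((\<lambda>t. t * ((\<bar>C\<bar> + \<bar>C'\<bar>) * m ^ Suc k)) \<longlongrightarrow> 0) (at_right 0)"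
        by (auto intro!: tendsto_eq_intros)
      show "\<forall>\<^sub>F t in at_right 0. \<bar>H u\<bar> \<le> t * ((\<bar>C\<bar> + \<bar>C'\<bar>) * m ^ Suc k)"
        unfolding eventually_at_right_field
        by (rule exI[of _ "min \<delta> 1 / m"]) (use H m \<delta> in \<open>auto simp: field_simps min_less_iff_conj split: if_splits\<close>)
    qed auto
    then show ?thesis by simp
  qed
  then show ?case using T by simp
qed (simp add: taylor_def low_degrees_def)

lemma taylor_expansion:
  assumes f: "smooth_on UNIV f" and "\<delta> > 0"
    and "\<And>u. mnorm u < \<delta> \<Longrightarrow> u \<noteq> (0, 0) \<Longrightarrow> \<bar>f u\<bar> \<le> C * mnorm u ^ n" "n \<le> N"
  obtains R where "smooth_on UNIV R" "vanish N R"
    "\<And>u. f u = (\<Sum>k\<in>low_degrees N - low_degrees n. tcoeff f k * mon k u) + R u"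
proof (rule that)
  let ?R = "\<lambda>u. f u - taylor N f u"
  show "smooth_on UNIV ?R" by (intro smooth_diff f smooth_taylor)
  show "vanish N ?R" by (rule vanish_taylor[OF f])
  fix u
  have "low_degrees n \<subseteq> low_degrees N" using assms by (auto simp: low_degrees_def)
  then have "taylor N f u = taylor n f u + (\<Sum>k\<in>low_degrees N - low_degrees n. tcoeff f k * mon k u)"
    unfolding taylor_def by (subst sum.subset_diff[of "low_degrees n" "low_degrees N"]) auto
  then show "f u = (\<Sum>k\<in>low_degrees N - low_degrees n. tcoeff f k * mon k u) + ?R u"
    using taylor_eq_zero[OF assms(1-3)] by simp
qed

subsection \<open>Symbol classes at the origin\<close>

definition punctured :: "real \<Rightarrow> (real \<times> real) set" where
  "punctured \<delta> = {u. u \<noteq> (0, 0) \<and> mnorm u < \<delta>}"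

definition power_bounded :: "real \<Rightarrow> real \<Rightarrow> (real \<times> real \<Rightarrow> real) \<Rightarrow> bool" where
  "power_bounded \<delta> D f \<longleftrightarrow> (\<exists>C. \<forall>u\<in>punctured \<delta>. \<bar>f u\<bar> \<le> C * mnorm u powr D)"

abbreviation symbol_class :: "real \<Rightarrow> nat \<Rightarrow> real \<Rightarrow> (real \<times> real \<Rightarrow> real) \<Rightarrow> bool" where
  "symbol_class \<delta> \<equiv> graded (punctured \<delta>) (power_bounded \<delta>)"

lemma open_punctured [simp]: "open (punctured \<delta>)"
proof -
  have "punctured \<delta> = {u. mnorm u < \<delta>} - {(0, 0)}" by (auto simp: punctured_def)
  then show ?thesis by (metis open_Diff open_mnorm_less closed_singleton)
qed

text \<open>The restriction \<open>\<delta> \<le> 1\<close> serves \<open>B_mono\<close>: only for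
  \<open>mnorm u \<le> 1\<close> is a higher power the smaller one. It recurs wherever the closure
  rules for symbol classes are used.\<close>

lemma grading_power_bounded:
  assumes "\<delta> \<le> 1"
  shows "grading (punctured \<delta>) (power_bounded \<delta>)"
proof
  fix f g :: "real \<times> real \<Rightarrow> real" and D E :: real
  show "open (punctured \<delta>)" by simp
  show "power_bounded \<delta> D g" if "\<And>u. u \<in> punctured \<delta> \<Longrightarrow> f u = g u" "power_bounded \<delta> D f"
    using that unfolding power_bounded_def by metis
  show "power_bounded \<delta> 0 (\<lambda>_. c)" for c
    unfolding power_bounded_def by (intro exI[of _ "\<bar>c\<bar>"]) (auto simp: punctured_def)
  show "power_bounded \<delta> D (\<lambda>_. 0)" unfolding power_bounded_def by (intro exI[of _ 0]) auto
  show "power_bounded \<delta> D (\<lambda>u. f u + g u)" if "power_bounded \<delta> D f" "power_bounded \<delta> D g"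
  proof -
    obtain C1 C2 where C: "\<And>u. u \<in> punctured \<delta> \<Longrightarrow> \<bar>f u\<bar> \<le> C1 * mnorm u powr D"
        "\<And>u. u \<in> punctured \<delta> \<Longrightarrow> \<bar>g u\<bar> \<le> C2 * mnorm u powr D"
      using \<open>power_bounded \<delta> D f\<close> \<open>power_bounded \<delta> D g\<close> unfolding power_bounded_def by blast
    have "\<bar>f u + g u\<bar> \<le> (C1 + C2) * mnorm u powr D" if "u \<in> punctured \<delta>" for u
      using C[OF that] abs_triangle_ineq[of "f u" "g u"] by (simp add: algebra_simps)
    then show ?thesis unfolding power_bounded_def by blast
  qed
  show "power_bounded \<delta> (D + E) (\<lambda>u. f u * g u)" if "power_bounded \<delta> D f" "power_bounded \<delta> E g"
  proof -
    obtain C1 C2 where C: "\<And>u. u \<in> punctured \<delta> \<Longrightarrow> \<bar>f u\<bar> \<le> C1 * mnorm u powr D"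
        "\<And>u. u \<in> punctured \<delta> \<Longrightarrow> \<bar>g u\<bar> \<le> C2 * mnorm u powr E"
      using \<open>power_bounded \<delta> D f\<close> \<open>power_bounded \<delta> E g\<close> unfolding power_bounded_def by blast
    have "\<bar>f u * g u\<bar> \<le> (C1 * C2) * mnorm u powr (D + E)" if "u \<in> punctured \<delta>" for u
      using mult_mono[OF C[OF that]] C[OF that] by (auto simp: abs_mult powr_add mult_ac)
    then show ?thesis unfolding power_bounded_def by blast
  qed
  show "power_bounded \<delta> E f" if "power_bounded \<delta> D f" "E \<le> D"
  proof -
    obtain C1 where C: "\<And>u. u \<in> punctured \<delta> \<Longrightarrow> \<bar>f u\<bar> \<le> C1 * mnorm u powr D"
      using \<open>power_bounded \<delta> D f\<close> unfolding power_bounded_def by blast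
    have "\<bar>f u\<bar> \<le> \<bar>C1\<bar> * mnorm u powr E" if "u \<in> punctured \<delta>" for u
    proof -
      have "mnorm u powr D \<le> mnorm u powr E"
        using that assms mnorm_pos[of u] \<open>E \<le> D\<close> by (intro powr_mono') (auto simp: punctured_def)
      then have "C1 * mnorm u powr D \<le> \<bar>C1\<bar> * mnorm u powr E"
        by (intro mult_mono) auto
      with C[OF that] show ?thesis by linarith
    qed
    then show ?thesis unfolding power_bounded_def by blast
  qed
qed

lemma vanish_symbol_class:
  assumes "\<delta> \<le> 1" "smooth_on UNIV f" "vanish n f"
  shows "symbol_class \<delta> K (real n) f"
  using assms(2,3)
proof (induction K arbitrary: n f)
  case K: 0
  obtain M where "\<And>u. mnorm u \<le> \<delta> \<Longrightarrow> \<bar>f u\<bar> \<le> M * mnorm u ^ n"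
    using vanish_bound[OF K] by blast
  then show ?case
    by (auto simp: power_bounded_def punctured_def powr_realpow mnorm_pos intro!: exI[of _ M])
next
  case (Suc K)
  interpret grading "punctured \<delta>" "power_bounded \<delta>" by (rule grading_power_bounded[OF assms(1)])
  obtain M where "\<And>u. mnorm u \<le> \<delta> \<Longrightarrow> \<bar>f u\<bar> \<le> M * mnorm u ^ n"
    using vanish_bound[OF Suc.prems] by blast
  then have "power_bounded \<delta> (real n) f"
    by (auto simp: power_bounded_def punctured_def powr_realpow mnorm_pos intro!: exI[of _ M])
  moreover have "C K (real n - 1) (pu f) \<and> C K (real n - 1) (pv f)"
  proof (cases n)
    \<comment> \<open>At order 0 the partials are merely bounded; degree 0 is more than the required
      degree -1.\<close>
    case 0
    have "C K (real 0) (pu f)" "C K (real 0) (pv f)"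
      using Suc.IH[of "pu f" 0, OF smooth_on_pu] Suc.IH[of "pv f" 0, OF smooth_on_pv] Suc.prems
      by simp_all
    then show ?thesis using graded_mono 0 by (auto intro!: graded_mono[of _ 0])
  next
    case (Suc m)
    then show ?thesis using Suc.prems Suc.IH[of "pu f" m] Suc.IH[of "pv f" m] smooth_on_pu smooth_on_pv
      by auto
  qed
  ultimately show ?case using smooth_differentiable[OF Suc.prems(1)] by auto
qed

text \<open>A function of order above 1 at the origin is o(|u|) there, so its extension by 0 is
  differentiable with derivative 0, and the partials of the extension are the extended partials.
  Iterating costs one degree per derivative. In this way a singular remainder becomes an admissible
  integrand for the trapezoidal rule.\<close>

lemma symbol_class_extend:
  assumes "\<delta> > 0"
  shows "symbol_class \<delta> K D f \<Longrightarrow> D > real K \<Longrightarrow> kdiff_on {u. mnorm u < \<delta>} K (f((0, 0) := 0))"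
proof (induction K arbitrary: D f)
  case (Suc K)
  let ?f = "f((0, 0) := 0)"
  interpret grading "{u. mnorm u < \<delta>}" "\<lambda>_ _. True" by (rule grading_trivial) simp
  obtain C where C: "\<And>u. u \<in> punctured \<delta> \<Longrightarrow> \<bar>f u\<bar> \<le> C * mnorm u powr D"
    using Suc.prems unfolding power_bounded_def by auto
  have D: "D > 1" using Suc.prems by simp
  have bound: "norm (?f v - ?f (0, 0) - 0) \<le> (\<bar>C\<bar> * mnorm v powr (D - 1)) * norm (v - (0, 0))"
    if "v \<in> {u. mnorm u < \<delta>}" for v
  proof (cases "v = (0, 0)")
    case False
    have "mnorm v \<le> norm v"
      unfolding mnorm_def using norm_fst_le[of "fst v" "snd v"] norm_snd_le[of "snd v" "fst v"] by auto
    have "\<bar>f v\<bar> \<le> C * mnorm v powr D" using False that by (intro C) (auto simp: punctured_def)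
    also have "\<dots> \<le> \<bar>C\<bar> * mnorm v powr D" by (intro mult_right_mono) auto
    also have "\<dots> = \<bar>C\<bar> * mnorm v powr (D - 1) * mnorm v"
      using mnorm_pos[OF False] by (simp add: powr_diff)
    also have "\<dots> \<le> \<bar>C\<bar> * mnorm v powr (D - 1) * norm v"
      by (intro mult_left_mono \<open>mnorm v \<le> norm v\<close>) auto
    finally show ?thesis using False by (simp add: zero_prod_def[symmetric])
  qed simp
  have tends: "((\<lambda>v. \<bar>C\<bar> * mnorm v powr (D - 1)) \<longlongrightarrow> 0) (at (0, 0))"
  proof -
    have "(mnorm \<longlongrightarrow> mnorm (0, 0)) (at (0, 0))"
      using continuous_on_mnorm[of UNIV] unfolding continuous_on_eq_continuous_within isCont_def[symmetric]
      by (metis UNIV_I isCont_def)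
    then have "(mnorm \<longlongrightarrow> 0) (at (0, 0))" by (simp add: mnorm_def)
    then show ?thesis using D by (auto intro!: tendsto_eq_intros)
  qed
  have d0: "(?f has_derivative (\<lambda>_. 0)) (at (0, 0))"
    unfolding has_derivative_iff_norm
  proof (intro conjI)
    show "((\<lambda>v. norm (?f v - ?f (0, 0) - 0) / norm (v - (0, 0))) \<longlongrightarrow> 0) (at (0, 0))"
    proof (rule Lim_null_comparison[OF _ tends])
      show "\<forall>\<^sub>F v in at (0, 0). norm (norm (?f v - ?f (0, 0) - 0) / norm (v - (0, 0)))
          \<le> \<bar>C\<bar> * mnorm v powr (D - 1)"
        unfolding eventually_at_topological
      proof (intro exI conjI ballI impI)
        show "open {u. mnorm u < \<delta>}" by simp
        show "(0, 0) \<in> {u. mnorm u < \<delta>}" using assms by (simp add: mnorm_def)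
        fix v :: "real \<times> real" assume v: "v \<in> {u. mnorm u < \<delta>}" "v \<noteq> (0, 0)"
        then have "norm (v - (0, 0)) > 0" by simp
        with bound[OF v(1)] show "norm (norm (?f v - ?f (0, 0) - 0) / norm (v - (0, 0)))
          \<le> \<bar>C\<bar> * mnorm v powr (D - 1)"
          by (simp add: divide_le_eq)
      qed
    qed
  qed simp
  have diff: "?f differentiable (at u)" if "mnorm u < \<delta>" for u
  proof (cases "u = (0, 0)")
    case True
    then show ?thesis using differentiableI[OF d0] by (simp only:)
  next
    case False
    then have u: "u \<in> punctured \<delta>" using that by (simp add: punctured_def)
    with Suc.prems have "f differentiable (at u)" by auto
    then show ?thesis
      by (rule differentiable_cong_open[OF open_punctured u, rotated]) (auto simp: punctured_def)
  qed
  have "((\<lambda>t. (t, 0)) has_derivative (\<lambda>t. (t, 0 :: real))) (at (0 :: real))"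
       "((\<lambda>t. (0, t)) has_derivative (\<lambda>t. (0 :: real, t))) (at (0 :: real))"
    by (auto intro!: derivative_eq_intros)
  from has_derivative_compose[OF this(1) d0] has_derivative_compose[OF this(2) d0]
  have "((\<lambda>t. ?f (t, 0)) has_real_derivative 0) (at 0)" "((\<lambda>t. ?f (0, t)) has_real_derivative 0) (at 0)"
    by (auto intro!: has_derivative_imp_has_field_derivative simp del: fun_upd_apply)
  then have p0: "pu ?f (0, 0) = 0" "pv ?f (0, 0) = 0"
    by (auto intro!: pu_eqI pv_eqI simp del: fun_upd_apply)
  have pu: "pu ?f u = ((pu f)((0, 0) := 0)) u" if "mnorm u < \<delta>" for u
  proof (cases "u = (0, 0)")
    case False
    then have "u \<in> punctured \<delta>" using that by (simp add: punctured_def)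
    from pu_cong_open[OF open_punctured this, of ?f f] False show ?thesis by (auto simp: punctured_def)
  qed (simp add: p0)
  have pv: "pv ?f u = ((pv f)((0, 0) := 0)) u" if "mnorm u < \<delta>" for u
  proof (cases "u = (0, 0)")
    case False
    then have "u \<in> punctured \<delta>" using that by (simp add: punctured_def)
    from pv_cong_open[OF open_punctured this, of ?f f] False show ?thesis by (auto simp: punctured_def)
  qed (simp add: p0)
  have "kdiff_on {u. mnorm u < \<delta>} K ((pu f)((0, 0) := 0))" "kdiff_on {u. mnorm u < \<delta>} K ((pv f)((0, 0) := 0))"
    using Suc.prems by (auto intro!: Suc.IH[of "D - 1"] simp del: fun_upd_apply)
  then have "kdiff_on {u. mnorm u < \<delta>} K (pu ?f)" "kdiff_on {u. mnorm u < \<delta>} K (pv ?f)"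
    using graded_cong[of "(pu f)((0, 0) := 0)" "pu ?f" K 0] graded_cong[of "(pv f)((0, 0) := 0)" "pv ?f" K 0]
      pu pv by (auto simp del: fun_upd_apply)
  then show ?case unfolding kdiff_on_Suc using diff by auto
qed simp

context grading
begin

text \<open>Specialises \<open>graded_family\<close> to members \<open>h i\<close> composed with one
  fixed \<open>f\<close>: the chain rule puts the partials of \<open>f\<close> into the factors
  \<open>z1\<close> and \<open>z2\<close>. Real powers, flat exponentials and binomial remainders
  are such families.\<close>

lemma graded_compose:
  fixes h :: "'i \<Rightarrow> real \<Rightarrow> real" and deg :: "'i \<Rightarrow> real"
  assumes f: "\<forall>u\<in>\<Omega>. f differentiable (at u)"
    and B: "\<And>i. i \<in> I \<Longrightarrow> B (deg i) (\<lambda>u. h i (f u))"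
    and der: "\<And>i. i \<in> I \<Longrightarrow> \<exists>j\<in>I. \<exists>k\<in>I. \<exists>a b.
        (\<forall>u\<in>\<Omega>. (h i has_real_derivative a * h j (f u) + b * h k (f u)) (at (f u))) \<and>
        (\<forall>K. C K (deg i - 1 - deg j) (pu f) \<and> C K (deg i - 1 - deg j) (pv f)) \<and>
        (\<forall>K. C K (deg i - 1 - deg k) (pu f) \<and> C K (deg i - 1 - deg k) (pv f))"
    and y: "C K E y" and i: "i \<in> I"
  shows "C K (E + deg i) (\<lambda>u. y u * h i (f u))"
proof (rule graded_family[where W = "{(\<lambda>u. h i (f u), deg i) | i. i \<in> I}", OF _ _ _ y])
  show "((\<lambda>u. h i (f u)), deg i) \<in> {(\<lambda>u. h i (f u), deg i) | i. i \<in> I}" using i by blast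
next
  fix w D assume "(w, D) \<in> {(\<lambda>u. h i (f u), deg i) | i. i \<in> I}"
  then obtain i where i: "i \<in> I" "w = (\<lambda>u. h i (f u))" "D = deg i" by blast
  obtain j k a b where jk: "j \<in> I" "k \<in> I"
      "\<forall>u\<in>\<Omega>. (h i has_real_derivative a * h j (f u) + b * h k (f u)) (at (f u))"
      "\<forall>K. C K (deg i - 1 - deg j) (pu f) \<and> C K (deg i - 1 - deg j) (pv f)"
      "\<forall>K. C K (deg i - 1 - deg k) (pu f) \<and> C K (deg i - 1 - deg k) (pv f)"
    using der[OF i(1)] by blast
  show "B D w \<and> (\<forall>u\<in>\<Omega>. w differentiable (at u))"
    unfolding i using B[OF i(1)] f jk(3) differentiable_real_compose by blast
  let ?W = "{(\<lambda>u. h i (f u), deg i) | i. i \<in> I}"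
  show "\<exists>z1 w1 D1 z2 w2 D2. (w1, D1) \<in> ?W \<and> (w2, D2) \<in> ?W \<and>
        (\<forall>K. C K (D - 1 - D1) z1) \<and> (\<forall>K. C K (D - 1 - D2) z2) \<and>
        (\<forall>u\<in>\<Omega>. pu w u = z1 u * w1 u + z2 u * w2 u)"
    apply (rule exI[of _ "\<lambda>u. a * pu f u"], rule exI[of _ "\<lambda>u. h j (f u)"], rule exI[of _ "deg j"],
        rule exI[of _ "\<lambda>u. b * pu f u"], rule exI[of _ "\<lambda>u. h k (f u)"], rule exI[of _ "deg k"])
    using jk f unfolding i by (auto intro!: graded_cmult simp: pu_compose algebra_simps)
  show "\<exists>z1 w1 D1 z2 w2 D2. (w1, D1) \<in> ?W \<and> (w2, D2) \<in> ?W \<and>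
        (\<forall>K. C K (D - 1 - D1) z1) \<and> (\<forall>K. C K (D - 1 - D2) z2) \<and>
        (\<forall>u\<in>\<Omega>. pv w u = z1 u * w1 u + z2 u * w2 u)"
    apply (rule exI[of _ "\<lambda>u. a * pv f u"], rule exI[of _ "\<lambda>u. h j (f u)"], rule exI[of _ "deg j"],
        rule exI[of _ "\<lambda>u. b * pv f u"], rule exI[of _ "\<lambda>u. h k (f u)"], rule exI[of _ "deg k"])
    using jk f unfolding i by (auto intro!: graded_cmult simp: pv_compose algebra_simps)
qed

lemma graded_powr:
  assumes f: "\<And>K. C K 2 f" "\<And>u. u \<in> \<Omega> \<Longrightarrow> f u > 0" and B: "\<And>\<beta>. B (2 * \<beta>) (\<lambda>u. f u powr \<beta>)"
  shows "C K (2 * \<beta>) (\<lambda>u. f u powr \<beta>)"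
proof -
  have f': "\<forall>u\<in>\<Omega>. f differentiable (at u)" "C K 1 (pu f)" "C K 1 (pv f)" for K
    using f(1)[of "Suc K"] by auto
  have "C K (0 + 2 * \<beta>) (\<lambda>u. 1 * f u powr \<beta>)"
  proof (rule graded_compose[where I = UNIV and deg = "\<lambda>\<beta>. 2 * \<beta>" and h = "\<lambda>\<beta> x. x powr \<beta>", OF f'(1) B _ graded_const UNIV_I])
    fix \<beta> :: real
    \<comment> \<open>Both slots take the exponent \<beta> - 1, the second with coefficient 0. The
      degree left for the partials of \<open>f\<close> is 2\<beta> - 1 - 2(\<beta> - 1) = 1.\<close>
    show "\<exists>j\<in>UNIV. \<exists>k\<in>UNIV. \<exists>a b.
        (\<forall>u\<in>\<Omega>. ((\<lambda>x. x powr \<beta>) has_real_derivative a * f u powr j + b * f u powr k) (at (f u))) \<and>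
        (\<forall>K. C K (2 * \<beta> - 1 - 2 * j) (pu f) \<and> C K (2 * \<beta> - 1 - 2 * j) (pv f)) \<and>
        (\<forall>K. C K (2 * \<beta> - 1 - 2 * k) (pu f) \<and> C K (2 * \<beta> - 1 - 2 * k) (pv f))"
      by (intro bexI[of _ "\<beta> - 1"] exI[of _ \<beta>] exI[of _ 0])
         (use f f' in \<open>auto intro!: derivative_eq_intros\<close>)
  qed
  then show ?thesis by simp
qed

end

lemma kdiff_on_powr:
  assumes "open \<Omega>" "\<And>K. kdiff_on \<Omega> K f" "\<And>u. u \<in> \<Omega> \<Longrightarrow> f u > 0"
  shows "kdiff_on \<Omega> K (\<lambda>u. f u powr \<beta>)"
proof -
  interpret grading \<Omega> "\<lambda>_ _. True" by (rule grading_trivial) fact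
  have "\<And>K. C K 2 f" using assms(2) graded_trivial by blast
  from graded_powr[OF this assms(3), of K \<beta>] show ?thesis using graded_trivial[of \<Omega> K "2 * \<beta>"] by simp
qed

section \<open>A smooth even cutoff from flat exponentials\<close>

definition flat_exp :: "nat \<Rightarrow> real \<Rightarrow> real" where
  "flat_exp n x = (if x > 0 then exp (- 1 / x) / x ^ n else 0)"

text \<open>Keeping the single term of order n + 1 in the series of exp(1/x) beats the factor x^(-n)
  and leaves one power of x.\<close>

lemma flat_exp_le: "0 \<le> flat_exp n x" "x > 0 \<Longrightarrow> flat_exp n x \<le> fact (Suc n) * x"
proof -
  show "0 \<le> flat_exp n x" by (simp add: flat_exp_def)
  assume x: "x > 0"
  have "(1 / x) ^ Suc n / fact (Suc n) \<le> exp (1 / x)"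
  proof -
    have "exp (1 / x) = (\<Sum>m. (1 / x) ^ m /\<^sub>R fact m)" by (simp add: exp_def)
    moreover have "(\<Sum>m\<in>{Suc n}. (1 / x) ^ m /\<^sub>R fact m) \<le> (\<Sum>m. (1 / x) ^ m /\<^sub>R fact m)"
      by (intro sum_le_suminf summable_exp_generic) (use x in auto)
    ultimately show ?thesis by (simp add: divide_inverse_commute)
  qed
  then show "flat_exp n x \<le> fact (Suc n) * x"
    using x by (simp add: flat_exp_def exp_minus field_simps power_one_over del: fact_Suc)
qed

text \<open>The negative powers belong to the family so that it is closed under differentiation. At
  0 the difference quotient from the right is \<open>flat_exp (Suc n)\<close>, which tends to 0 by
  \<open>flat_exp_le\<close>.\<close>

lemma flat_exp_deriv: "(flat_exp n has_real_derivative (- real n) * flat_exp (n + 1) x + 1 * flat_exp (n + 2) x) (at x)"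
proof -
  consider "x > 0" | "x < 0" | "x = 0" by linarith
  then show ?thesis
  proof cases
    case 1
    have "((\<lambda>x. exp (- 1 / x) / x ^ n) has_real_derivative (- real n) * flat_exp (n + 1) x + 1 * flat_exp (n + 2) x) (at x)"
      using 1 by (auto intro!: derivative_eq_intros simp: flat_exp_def field_simps power2_eq_square)
        (cases n, auto simp: field_simps)
    then show ?thesis
      by (rule DERIV_cong_ev[THEN iffD1, rotated -1, OF _ refl _ refl])
        (use 1 eventually_nhds_in_open[of "{0<..}" x] in \<open>auto simp: flat_exp_def elim!: eventually_mono\<close>)
  next
    case 2
    have "((\<lambda>x. 0) has_real_derivative (- real n) * flat_exp (n + 1) x + 1 * flat_exp (n + 2) x) (at x)"
      using 2 by (auto simp: flat_exp_def)
    then show ?thesis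
      by (rule DERIV_cong_ev[THEN iffD1, rotated -1, OF _ refl _ refl])
        (use 2 eventually_nhds_in_open[of "{..<0}" x] in \<open>auto simp: flat_exp_def elim!: eventually_mono\<close>)
  next
    case 3
    have "((\<lambda>t. (flat_exp n (0 + t) - flat_exp n 0) / t) \<longlongrightarrow> 0) (at 0)"
    proof (rule Lim_null_comparison)
      show "((\<lambda>t. fact (Suc (Suc n)) * \<bar>t\<bar>) \<longlongrightarrow> (0 :: real)) (at 0)"
        by (auto intro!: tendsto_eq_intros)
      have "norm ((flat_exp n (0 + t) - flat_exp n 0) / t) \<le> fact (Suc (Suc n)) * \<bar>t\<bar>" for t
      proof (cases "t > 0")
        case True
        then show ?thesis using flat_exp_le(2)[OF True, of "Suc n"] by (simp add: flat_exp_def mult_ac del: fact_Suc)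
      next
        case False
        then have "flat_exp n (0 + t) = 0" "flat_exp n 0 = 0" by (simp_all add: flat_exp_def)
        then show ?thesis by (simp only: diff_self div_0 norm_zero) (intro mult_nonneg_nonneg; simp)
      qed
      then show "\<forall>\<^sub>F t in at 0. norm ((flat_exp n (0 + t) - flat_exp n 0) / t) \<le> fact (Suc (Suc n)) * \<bar>t\<bar>"
        by (intro always_eventually allI)
    qed
    then show ?thesis using 3 by (simp add: DERIV_def flat_exp_def)
  qed
qed

lemma smooth_flat_exp:
  assumes "smooth_on UNIV f"
  shows "smooth_on UNIV (\<lambda>u. flat_exp n (f u))"
proof -
  have f': "\<forall>u\<in>UNIV. f differentiable (at u)" "plane.C K D (pu f)" "plane.C K D (pv f)" for K D
    using smooth_differentiable[OF assms] smooth_on_pu[OF assms] smooth_on_pv[OF assms]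
    by (auto simp: smooth_on_iff_kdiff_on graded_trivial[of _ _ D])
  have "plane.C K (0 + 0) (\<lambda>u. 1 * flat_exp n (f u))" for K
  proof (rule plane.graded_compose[where I = UNIV and deg = "\<lambda>_. 0" and h = flat_exp, OF f'(1) TrueI _ plane.graded_const UNIV_I])
    fix n
    show "\<exists>j\<in>UNIV. \<exists>k\<in>UNIV. \<exists>a b.
        (\<forall>u\<in>UNIV. (flat_exp n has_real_derivative a * flat_exp j (f u) + b * flat_exp k (f u)) (at (f u))) \<and>
        (\<forall>K. plane.C K (0 - 1 - 0) (pu f) \<and> plane.C K (0 - 1 - 0) (pv f)) \<and>
        (\<forall>K. plane.C K (0 - 1 - 0) (pu f) \<and> plane.C K (0 - 1 - 0) (pv f))"
      using flat_exp_deriv[of n] f'(2,3) by blast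
  qed
  then show ?thesis by (simp add: smooth_on_iff_kdiff_on)
qed

text \<open>Equal to 1 where \<open>12 |u|\<^sup>2 \<le> 1\<close>, and 0 once the inner exponential exceeds one half.\<close>

definition chi :: "real \<times> real \<Rightarrow> real" where
  "chi u = flat_exp 0 (1 - 2 * flat_exp 0 (12 * ((fst u)\<^sup>2 + (snd u)\<^sup>2) - 1)) / flat_exp 0 1"

lemma smooth_chi: "smooth_on UNIV chi"
  unfolding chi_def divide_inverse by (intro smooth_intros smooth_flat_exp)

lemma chi_minus: "chi (- u) = chi u"
  by (simp add: chi_def)

text \<open>With both coordinates at most 1/5 in absolute value the inner argument is at most 24/25
  - 1 < 0, so the inner exponential is exactly 0.\<close>

lemma chi_one: "mnorm u \<le> 1 / 5 \<Longrightarrow> chi u = 1"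
proof -
  assume *: "mnorm u \<le> 1 / 5"
  have "(fst u)\<^sup>2 \<le> (1 / 5)\<^sup>2" "(snd u)\<^sup>2 \<le> (1 / 5)\<^sup>2"
    using * fst_le_mnorm[of u] snd_le_mnorm[of u] by (auto intro!: abs_le_square_iff[THEN iffD1])
  then have "\<not> 12 * ((fst u)\<^sup>2 + (snd u)\<^sup>2) - 1 > 0" by (simp add: power2_eq_square)
  then have "flat_exp 0 (12 * ((fst u)\<^sup>2 + (snd u)\<^sup>2) - 1) = 0" by (simp add: flat_exp_def)
  moreover have "flat_exp 0 1 \<noteq> 0" by (simp add: flat_exp_def)
  ultimately show ?thesis by (simp add: chi_def)
qed

text \<open>Some coordinate is at least 1/2 in absolute value, so the inner argument is at least
  12/4 - 1 = 2, and exp(-1/2) \<ge> 1/2 makes the outer argument nonpositive. The constant 12 serves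
  both this and \<open>chi_one\<close>.\<close>

lemma chi_zero: "1 / 2 \<le> mnorm u \<Longrightarrow> chi u = 0"
proof -
  assume *: "1 / 2 \<le> mnorm u"
  have "(1 / 2)\<^sup>2 \<le> (fst u)\<^sup>2 + (snd u)\<^sup>2"
  proof (cases "1 / 2 \<le> \<bar>fst u\<bar>")
    case True
    then have "(1 / 2)\<^sup>2 \<le> (fst u)\<^sup>2" by (auto intro!: abs_le_square_iff[THEN iffD1])
    then show ?thesis by (simp add: add_increasing2)
  next
    case False
    then have "1 / 2 \<le> \<bar>snd u\<bar>" using * by (auto simp: mnorm_def)
    then have "(1 / 2)\<^sup>2 \<le> (snd u)\<^sup>2" by (auto intro!: abs_le_square_iff[THEN iffD1])
    then show ?thesis by (simp add: add_increasing)
  qed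
  then have t: "12 * ((fst u)\<^sup>2 + (snd u)\<^sup>2) - 1 \<ge> 2" (is "?t \<ge> 2") by (simp add: power2_eq_square)
  have "1 / 2 \<le> 1 + (- 1 / ?t)" using t by (simp add: field_simps)
  also have "\<dots> \<le> exp (- 1 / ?t)" by (rule exp_ge_add_one_self)
  also have "\<dots> = flat_exp 0 ?t" using t by (simp add: flat_exp_def)
  finally show ?thesis by (simp add: chi_def) (simp add: flat_exp_def)
qed

lemma smooth_scale:
  assumes "smooth_on UNIV f"
  shows "smooth_on UNIV (\<lambda>u. f (c * fst u, c * snd u) :: real)"
proof -
  have "kdiff_on UNIV K (\<lambda>u. f (c * fst u, c * snd u))" if "smooth_on UNIV f" for K
    using that
  proof (induction K arbitrary: f)
    case (Suc K)
    have d: "f differentiable (at v)" for v using smooth_differentiable[OF Suc.prems] by simp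
    have "pu (\<lambda>u. f (c * fst u, c * snd u)) = (\<lambda>u. c * pu f (c * fst u, c * snd u))"
    proof
      fix u
      show "pu (\<lambda>u. f (c * fst u, c * snd u)) u = c * pu f (c * fst u, c * snd u)"
        using DERIV_chain2[of "\<lambda>t. f (t, c * snd u)" _ "\<lambda>t. c * t" "fst u", OF has_pu[OF d, of "(c * fst u, c * snd u)", simplified] DERIV_cmult_Id]
        by (intro pu_eqI) (simp add: mult.commute)
    qed
    moreover have "pv (\<lambda>u. f (c * fst u, c * snd u)) = (\<lambda>u. c * pv f (c * fst u, c * snd u))"
    proof
      fix u
      show "pv (\<lambda>u. f (c * fst u, c * snd u)) u = c * pv f (c * fst u, c * snd u)"
        using DERIV_chain2[of "\<lambda>t. f (c * fst u, t)" _ "\<lambda>t. c * t" "snd u", OF has_pv[OF d, of "(c * fst u, c * snd u)", simplified] DERIV_cmult_Id]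
        by (intro pv_eqI) (simp add: mult.commute)
    qed
    moreover have "(\<lambda>u. f (c * fst u, c * snd u)) differentiable (at u)" for u
    proof -
      have "(\<lambda>u. (c * fst u, c * snd u)) differentiable (at u)"
        by (intro derivative_intros bounded_linear_imp_differentiable bounded_linear_fst bounded_linear_snd)
      from differentiable_chain_at[OF this d] show ?thesis by (simp add: o_def)
    qed
    ultimately show ?case
      unfolding kdiff_on_Suc using Suc.IH[OF smooth_on_pu[OF Suc.prems]] Suc.IH[OF smooth_on_pv[OF Suc.prems]]
      by (auto intro!: plane.graded_cmult)
  qed simp
  then show ?thesis using assms by (simp add: smooth_on_iff_kdiff_on)
qed

subsection \<open>Remainders of the binomial series\<close>

definition binom_rem :: "real \<Rightarrow> nat \<Rightarrow> real \<Rightarrow> real" where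
  "binom_rem \<beta> n x = (1 + x) powr \<beta> - (\<Sum>m<n. (\<beta> gchoose m) * x ^ m)"

text \<open>The absorption identity for binomial coefficients moves the pair (\<beta>, n) to
  (\<beta> - 1, n - 1), so the remainders form a family for \<open>graded_compose\<close>. Truncated
  subtraction is right at n = 0, where the sum is empty.\<close>

lemma binom_rem_deriv:
  assumes "\<bar>x\<bar> < 1"
  shows "(binom_rem \<beta> n has_real_derivative \<beta> * binom_rem (\<beta> - 1) (n - 1) x) (at x)"
proof -
  have "(binom_rem \<beta> n has_real_derivative \<beta> * (1 + x) powr (\<beta> - 1) -
      (\<Sum>m<n. (\<beta> gchoose m) * (real m * x ^ (m - 1)))) (at x)"
    unfolding binom_rem_def using assms by (auto intro!: derivative_eq_intros sum.cong simp: mult_ac)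
  moreover have "(\<Sum>m<n. (\<beta> gchoose m) * (real m * x ^ (m - 1))) =
      \<beta> * (\<Sum>m<n - 1. (\<beta> - 1 gchoose m) * x ^ m)"
  proof (cases n)
    case (Suc k)
    have "(\<beta> gchoose Suc m) * (real (Suc m) * x ^ m) = \<beta> * ((\<beta> - 1 gchoose m) * x ^ m)" for m
      using gbinomial_absorption[of m \<beta>] by (simp add: mult_ac)
    note eq = this
    show ?thesis
      unfolding Suc sum.lessThan_Suc_shift by (simp add: sum_distrib_left eq[symmetric] del: of_nat_Suc)
  qed simp
  ultimately show ?thesis by (simp add: binom_rem_def algebra_simps)
qed

lemma binom_rem_bound: "\<exists>C. \<forall>x. \<bar>x\<bar> \<le> 1 / 2 \<longrightarrow> \<bar>binom_rem \<beta> n x\<bar> \<le> C * \<bar>x\<bar> ^ n"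
proof -
  \<comment> \<open>Convergence at 3/4 yields absolute convergence at the smaller point 1/2; the
    tail of the series without its factor x^n is then bounded uniformly by \<open>M\<close>.\<close>
  have "summable (\<lambda>k. (\<beta> gchoose k) * (3 / 4) ^ k)"
    using gen_binomial_real[of "3 / 4" \<beta>] by (auto simp: summable_def)
  from powser_insidea[OF this, of "1 / 2"]
  have S: "summable (\<lambda>k. \<bar>\<beta> gchoose k\<bar> * (1 / 2) ^ k)" by (simp add: abs_mult power_abs)
  have S': "summable (\<lambda>k. \<bar>\<beta> gchoose (k + n)\<bar> * (1 / 2) ^ k)"
  proof -
    have "summable (\<lambda>k. 2 ^ n * (\<bar>\<beta> gchoose (k + n)\<bar> * (1 / 2) ^ (k + n)))"
      by (intro summable_mult summable_ignore_initial_segment[OF S])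
    then show ?thesis by (simp add: power_add power_one_over field_simps)
  qed
  define M where "M = (\<Sum>k. \<bar>\<beta> gchoose (k + n)\<bar> * (1 / 2) ^ k)"
  have "\<bar>binom_rem \<beta> n x\<bar> \<le> M * \<bar>x\<bar> ^ n" if x: "\<bar>x\<bar> \<le> 1 / 2" for x
  proof -
    have s: "(\<lambda>k. (\<beta> gchoose k) * x ^ k) sums (1 + x) powr \<beta>"
      using x by (intro gen_binomial_real) auto
    have "(\<lambda>k. (\<beta> gchoose (k + n)) * x ^ (k + n)) sums binom_rem \<beta> n x"
      using sums_split_initial_segment[OF s, of n] by (simp add: binom_rem_def)
    moreover have le: "norm ((\<beta> gchoose (k + n)) * x ^ (k + n)) \<le> \<bar>x\<bar> ^ n * (\<bar>\<beta> gchoose (k + n)\<bar> * (1 / 2) ^ k)" for k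
    proof -
      have "\<bar>x\<bar> ^ k \<le> (1 / 2) ^ k" using x by (intro power_mono) auto
      then have "\<bar>\<beta> gchoose (k + n)\<bar> * \<bar>x\<bar> ^ n * \<bar>x\<bar> ^ k \<le> \<bar>\<beta> gchoose (k + n)\<bar> * \<bar>x\<bar> ^ n * (1 / 2) ^ k"
        by (intro mult_left_mono) auto
      then show ?thesis by (simp add: abs_mult power_abs power_add mult_ac)
    qed
    ultimately have "norm (binom_rem \<beta> n x) \<le> (\<Sum>k. \<bar>x\<bar> ^ n * (\<bar>\<beta> gchoose (k + n)\<bar> * (1 / 2) ^ k))"
      using norm_suminf_le[OF le summable_mult[OF S']] by (simp add: sums_iff)
    then show ?thesis using suminf_mult[OF S'] by (simp add: M_def mult.commute)
  qed
  then show ?thesis by blast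
qed

lemma symbol_class_binom_rem:
  assumes \<delta>: "\<delta> \<le> 1" and x: "\<And>K. symbol_class \<delta> K 1 x" "\<And>u. u \<in> punctured \<delta> \<Longrightarrow> \<bar>x u\<bar> \<le> 1 / 2"
    and y: "symbol_class \<delta> K E y"
  shows "symbol_class \<delta> K (E + real n) (\<lambda>u. y u * binom_rem \<beta> n (x u))"
proof -
  interpret grading "punctured \<delta>" "power_bounded \<delta>" by (rule grading_power_bounded[OF \<delta>])
  have x': "\<forall>u\<in>punctured \<delta>. x differentiable (at u)" "C K 0 (pu x)" "C K 0 (pv x)" for K
    using x(1)[of "Suc K"] by auto
  have "C K (E + real (snd (\<beta>, n))) (\<lambda>u. y u * (\<lambda>(\<beta>, n). binom_rem \<beta> n) (\<beta>, n) (x u))"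
  proof (rule graded_compose[where I = UNIV and deg = "\<lambda>i. real (snd i)" and h = "\<lambda>(\<beta>, n). binom_rem \<beta> n", OF x'(1) _ _ y UNIV_I])
    fix i :: "real \<times> nat"
    obtain \<beta> n where i: "i = (\<beta>, n)" by (cases i)
    obtain M where M: "\<And>x. \<bar>x\<bar> \<le> 1 / 2 \<Longrightarrow> \<bar>binom_rem \<beta> n x\<bar> \<le> M * \<bar>x\<bar> ^ n"
      using binom_rem_bound by blast
    have "power_bounded \<delta> (real n * 1) (\<lambda>u. x u ^ n)" by (rule graded_B[of 0, OF graded_power[OF x(1)]])
    then obtain M' where M': "\<And>u. u \<in> punctured \<delta> \<Longrightarrow> \<bar>x u ^ n\<bar> \<le> M' * mnorm u powr real n"
      unfolding power_bounded_def by auto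
    have "\<bar>binom_rem \<beta> n (x u)\<bar> \<le> (\<bar>M\<bar> * M') * mnorm u powr real n" if u: "u \<in> punctured \<delta>" for u
    proof -
      have "\<bar>binom_rem \<beta> n (x u)\<bar> \<le> M * \<bar>x u ^ n\<bar>" using M[OF x(2)[OF u]] by (simp add: power_abs)
      also have "\<dots> \<le> \<bar>M\<bar> * (M' * mnorm u powr real n)" by (intro mult_mono M' u) auto
      finally show ?thesis by simp
    qed
    then show "power_bounded \<delta> (real (snd i)) (\<lambda>u. (case i of (\<beta>, n) \<Rightarrow> binom_rem \<beta> n) (x u))"
      unfolding power_bounded_def i by (simp only: snd_conv case_prod_conv) blast
    let ?j = "(\<beta> - 1, n - 1)"
    have d: "\<forall>u\<in>punctured \<delta>. (binom_rem \<beta> n has_real_derivative \<beta> * binom_rem (\<beta> - 1) (n - 1) (x u)) (at (x u))"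
      using x(2) by (intro ballI binom_rem_deriv) force
    \<comment> \<open>The gap is 0 for positive \<open>n\<close> and -1 for n = 0, where
      \<open>n - 1\<close> is truncated; partials of degree 0 serve both.\<close>
    have "C K (real n - 1 - real (n - 1)) (pu x) \<and> C K (real n - 1 - real (n - 1)) (pv x)" for K
      using x'(2,3)[of K] by (auto intro!: graded_mono[of _ 0])
    then show "\<exists>j\<in>UNIV. \<exists>k\<in>UNIV. \<exists>a b.
        (\<forall>u\<in>punctured \<delta>. ((case i of (\<beta>, n) \<Rightarrow> binom_rem \<beta> n) has_real_derivative
            a * (case j of (\<beta>, n) \<Rightarrow> binom_rem \<beta> n) (x u) + b * (case k of (\<beta>, n) \<Rightarrow> binom_rem \<beta> n) (x u)) (at (x u))) \<and>
        (\<forall>K. C K (real (snd i) - 1 - real (snd j)) (pu x) \<and> C K (real (snd i) - 1 - real (snd j)) (pv x)) \<and>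
        (\<forall>K. C K (real (snd i) - 1 - real (snd k)) (pu x) \<and> C K (real (snd i) - 1 - real (snd k)) (pv x))"
      unfolding i by (intro bexI[of _ ?j] exI[of _ \<beta>] exI[of _ 0]) (use d in auto)
  qed
  then show ?thesis by simp
qed

subsection \<open>The trapezoidal rule\<close>

text \<open>Left end points only: for matched end values this is the usual trapezoidal sum.\<close>

definition trap_sum :: "nat \<Rightarrow> real \<Rightarrow> (real \<Rightarrow> real) \<Rightarrow> real" where
  "trap_sum N h g = h * (\<Sum>i\<in>{- int N..int N - 1}. g (of_int i * h))"

lemma sum_int_telescope:
  fixes G :: "int \<Rightarrow> real"
  shows "(\<Sum>i\<in>{- int N..int N - 1}. G (i + 1) - G i) = G (int N) - G (- int N)"
proof -
  have "{- int N..int N - 1} = (\<lambda>k. int k - int N) ` {..<2 * N}"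
  proof (intro set_eqI iffI)
    fix i assume "i \<in> {- int N..int N - 1}"
    then show "i \<in> (\<lambda>k. int k - int N) ` {..<2 * N}"
      by (intro image_eqI[of _ _ "nat (i + int N)"]) auto
  qed auto
  then have "(\<Sum>i\<in>{- int N..int N - 1}. G (i + 1) - G i) =
      (\<Sum>k<2 * N. G (int (Suc k) - int N) - G (int k - int N))"
    by (simp add: sum.reindex inj_on_def algebra_simps)
  also have "\<dots> = G (int (2 * N) - int N) - G (int 0 - int N)"
    by (rule sum_lessThan_telescope)
  finally show ?thesis by simp
qed

text \<open>Taylor's formula for the antiderivative of \<open>g 0\<close> over one cell. Integrals
  start at the fixed point \<open>-a\<close> so that summation over the cells telescopes.\<close>

lemma cell_taylor:
  fixes g :: "nat \<Rightarrow> real \<Rightarrow> real"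
  assumes "a < b" "0 < a"
    and der: "\<And>k x. k < n \<Longrightarrow> x \<in> {-b<..<b} \<Longrightarrow> (g k has_real_derivative g (Suc k) x) (at x)"
    and n: "0 < n" and bound: "\<And>x. x \<in> {-a..a} \<Longrightarrow> \<bar>g n x\<bar> \<le> B"
    and x: "-a \<le> x" "x + h \<le> a" "0 < h"
  shows "\<bar>integral {-a..x + h} (g 0) - integral {-a..x} (g 0) - (\<Sum>k<n. g k x * h ^ Suc k / fact (Suc k))\<bar>
      \<le> B * h ^ Suc n"
proof -
  \<comment> \<open>An interval strictly between [-a, a] and (-b, b) makes the antiderivative
    differentiable from both sides at the end points.\<close>
  define c where "c = (a + b) / 2"
  have c: "a < c" "c < b" using assms by (auto simp: c_def)
  define G where "G y = integral {-c..y} (g 0)" for y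
  have cont: "continuous_on {-c..c} (g 0)"
    by (intro continuous_at_imp_continuous_on ballI DERIV_isCont[OF der[OF n]]) (use c in auto)
  have G': "(G has_real_derivative g 0 y) (at y)" if "y \<in> {-a..a}" for y
  proof -
    have "(G has_real_derivative g 0 y) (at y within {-c..c})"
      unfolding G_def by (rule integral_has_real_derivative[OF cont]) (use that c in auto)
    moreover have "at y within {-c..c} = at y"
      by (rule at_within_interior) (use that c in auto)
    ultimately show ?thesis by simp
  qed
  define diff where "diff k = (case k of 0 \<Rightarrow> G | Suc k \<Rightarrow> g k)" for k
  have "\<exists>t>x. t < x + h \<and> G (x + h) =
      (\<Sum>m<Suc n. diff m x / fact m * (x + h - x) ^ m) + diff (Suc n) t / fact (Suc n) * (x + h - x) ^ Suc n"
  proof (rule Taylor_up)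
    show "\<forall>m t. m < Suc n \<and> x \<le> t \<and> t \<le> x + h \<longrightarrow> (diff m has_real_derivative diff (Suc m) t) (at t)"
      using G' der x assms(1) unfolding diff_def by (auto split: nat.split)
  qed (use x in \<open>auto simp: diff_def\<close>)
  then obtain t where t: "x < t" "t < x + h" "G (x + h) =
      (\<Sum>m<Suc n. diff m x / fact m * h ^ m) + diff (Suc n) t / fact (Suc n) * h ^ Suc n"
    by auto
  have "(\<Sum>m<Suc n. diff m x / fact m * h ^ m) = G x + (\<Sum>k<n. g k x * h ^ Suc k / fact (Suc k))"
    unfolding sum.lessThan_Suc_shift by (simp add: diff_def)
  then have eq: "G (x + h) - G x - (\<Sum>k<n. g k x * h ^ Suc k / fact (Suc k)) = g n t / fact (Suc n) * h ^ Suc n"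
    using t(3) by (simp add: diff_def)
  have Gint: "G y = G (-a) + integral {-a..y} (g 0)" if "y \<in> {-a..a}" for y
  proof -
    have "continuous_on {-c..y} (g 0)" by (rule continuous_on_subset[OF cont]) (use that c in auto)
    then show ?thesis unfolding G_def
      using that c by (intro Henstock_Kurzweil_Integration.integral_combine[symmetric] integrable_continuous_real) auto
  qed
  have "\<bar>g n t / fact (Suc n) * h ^ Suc n\<bar> \<le> B * h ^ Suc n"
  proof -
    have "\<bar>g n t\<bar> / fact (Suc n) \<le> \<bar>g n t\<bar> / 1"
      by (intro divide_left_mono fact_ge_1) auto
    then have "\<bar>g n t\<bar> / fact (Suc n) \<le> B" using bound[of t] t x by auto
    then have "\<bar>g n t\<bar> / fact (Suc n) * h ^ Suc n \<le> B * h ^ Suc n"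
      using x by (intro mult_right_mono) auto
    then show ?thesis using x by (simp add: abs_mult)
  qed
  then show ?thesis using eq Gint[of "x + h"] Gint[of x] x by simp
qed

text \<open>Euler-Maclaurin without Bernoulli numbers. Adding up the cell expansions expresses the
  integral through the sums for g 0, g 1, and so on. For k \<ge> 1 the integral of
  \<open>g k\<close> vanishes by the matched end values, so the induction hypothesis at n - k bounds
  its sum.\<close>

lemma trapezoid_1d:
  fixes g :: "nat \<Rightarrow> real \<Rightarrow> real"
  assumes "0 < h" "0 < N" "a = real N * h" "a < b"
  shows "\<lbrakk>0 < n; \<And>k x. k < n \<Longrightarrow> x \<in> {-b<..<b} \<Longrightarrow> (g k has_real_derivative g (Suc k) x) (at x);
     \<And>x. x \<in> {-a..a} \<Longrightarrow> \<bar>g n x\<bar> \<le> B; \<And>k. k < n \<Longrightarrow> g k a = g k (-a)\<rbrakk> \<Longrightarrow>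
     \<bar>trap_sum N h (g 0) - integral {-a..a} (g 0)\<bar> \<le> 2 ^ n * (2 * a * B * h ^ n)"
proof (induction n arbitrary: g rule: less_induct)
  case (less n)
  have a: "a > 0" using assms by simp
  have B: "B \<ge> 0" using less.prems(3)[of 0] a by auto
  define M where "M = 2 * a * B * h ^ n"
  have M: "M \<ge> 0" using a B assms by (simp add: M_def)
  let ?I = "{- int N..int N - 1}"
  have mem: "-a \<le> of_int i * h" "of_int i * h + h \<le> a" if "i \<in> ?I" for i
  proof -
    have "real_of_int (- int N) \<le> of_int i" "real_of_int (i + 1) \<le> of_int (int N)"
      using that unfolding of_int_le_iff by auto
    then have "- real N \<le> of_int i" "of_int i + 1 \<le> real N" by simp_all
    then have "- real N * h \<le> of_int i * h" "(of_int i + 1) * h \<le> real N * h"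
      using assms(1) by (intro mult_right_mono; simp)+
    then show "-a \<le> of_int i * h" "of_int i * h + h \<le> a" using assms by (auto simp: algebra_simps)
  qed
  have "(\<Sum>i\<in>?I. integral {-a..of_int i * h + h} (g 0) - integral {-a..of_int i * h} (g 0)) =
      integral {-a..a} (g 0)"
    using sum_int_telescope[of "\<lambda>i. integral {-a..of_int i * h} (g 0)" N] assms
    by (simp add: algebra_simps)
  moreover have "(\<Sum>i\<in>?I. \<Sum>k<n. g k (of_int i * h) * h ^ Suc k / fact (Suc k)) =
      (\<Sum>k<n. h ^ k / fact (Suc k) * trap_sum N h (g k))"
    by (subst sum.swap) (simp add: trap_sum_def sum_distrib_left sum_divide_distrib mult_ac)
  ultimately have "\<bar>integral {-a..a} (g 0) - (\<Sum>k<n. h ^ k / fact (Suc k) * trap_sum N h (g k))\<bar> =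
    \<bar>\<Sum>i\<in>?I. integral {-a..of_int i * h + h} (g 0) - integral {-a..of_int i * h} (g 0) -
       (\<Sum>k<n. g k (of_int i * h) * h ^ Suc k / fact (Suc k))\<bar>"
    by (simp add: sum_subtractf)
  also have "\<dots> \<le> (\<Sum>i\<in>?I. B * h ^ Suc n)"
    by (intro order_trans[OF sum_abs] sum_mono cell_taylor[OF assms(4) a less.prems(2,1,3)] mem assms(1))
  also have "\<dots> = M" using assms by (simp add: M_def)
  finally have 1: "\<bar>integral {-a..a} (g 0) - (\<Sum>k<n. h ^ k / fact (Suc k) * trap_sum N h (g k))\<bar> \<le> M" .
  have 2: "\<bar>h ^ k / fact (Suc k) * trap_sum N h (g k)\<bar> \<le> 2 ^ (n - k) * M" if k: "0 < k" "k < n" for k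
  proof -
    have "\<bar>trap_sum N h (\<lambda>x. g (k + 0) x) - integral {-a..a} (g (k + 0))\<bar> \<le> 2 ^ (n - k) * (2 * a * B * h ^ (n - k))"
      by (rule less.IH[of "n - k" "\<lambda>j. g (k + j)"]) (use less.prems k in auto)
    moreover have "integral {-a..a} (g k) = 0"
    proof -
      have "(g k has_integral (g (k - 1) a - g (k - 1) (-a))) {-a..a}"
      proof (rule fundamental_theorem_of_calculus)
        fix x assume "x \<in> {-a..a}"
        then have "(g (k - 1) has_real_derivative g (Suc (k - 1)) x) (at x)"
          using k assms by (intro less.prems) auto
        then show "(g (k - 1) has_vector_derivative g k x) (at x within {-a..a})"
          using k by (simp add: has_real_derivative_iff_has_vector_derivative has_vector_derivative_at_within)
      qed (use a in auto)
      moreover have "g (k - 1) a = g (k - 1) (-a)" using k by (intro less.prems) auto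
      ultimately show ?thesis by (simp add: integral_unique)
    qed
    ultimately have t: "\<bar>trap_sum N h (g k)\<bar> \<le> 2 ^ (n - k) * (2 * a * B * h ^ (n - k))" by simp
    have "h ^ k / fact (Suc k) \<le> h ^ k / 1"
      using assms by (intro divide_left_mono fact_ge_1) auto
    then have "h ^ k / fact (Suc k) * \<bar>trap_sum N h (g k)\<bar> \<le> h ^ k * (2 ^ (n - k) * (2 * a * B * h ^ (n - k)))"
      using t assms by (intro mult_mono) auto
    also have "\<dots> = 2 ^ (n - k) * (2 * a * B * (h ^ k * h ^ (n - k)))" by (simp add: mult_ac)
    also have "h ^ k * h ^ (n - k) = h ^ n" using k by (simp flip: power_add)
    finally show ?thesis using assms by (simp add: abs_mult M_def)
  qed
  obtain m where m: "n = Suc m" using less.prems by (cases n) auto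
  have "(\<Sum>k<n. h ^ k / fact (Suc k) * trap_sum N h (g k)) =
      trap_sum N h (g 0) + (\<Sum>k<m. h ^ Suc k / fact (Suc (Suc k)) * trap_sum N h (g (Suc k)))"
    unfolding m sum.lessThan_Suc_shift by simp
  moreover have "\<bar>\<Sum>k<m. h ^ Suc k / fact (Suc (Suc k)) * trap_sum N h (g (Suc k))\<bar> \<le> (\<Sum>k<m. 2 ^ (m - k) * M)"
    by (intro order_trans[OF sum_abs] sum_mono order_trans[OF 2[of "Suc _"]]) (auto simp: m)
  \<comment> \<open>The factor 2^n in the claim is made for this step: the contributions of k \<ge>
    1 add up to 2^n - 2, which leaves room for the cell error \<open>M\<close>.\<close>
  moreover have "(\<Sum>k<m. 2 ^ (m - k) * M) = (2 ^ n - 2) * M"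
  proof -
    have "(\<Sum>k<m. 2 ^ (m - k) :: real) = 2 ^ Suc m - 2"
      by (induction m) (simp_all add: sum.lessThan_Suc_shift del: sum.lessThan_Suc)
    then show ?thesis by (simp add: m sum_distrib_right[symmetric])
  qed
  ultimately have "\<bar>trap_sum N h (g 0) - integral {-a..a} (g 0)\<bar> \<le> M + (2 ^ n - 2) * M"
    using 1 by linarith
  also have "\<dots> \<le> 2 ^ n * M" using M by (simp add: algebra_simps)
  finally show ?case by (simp add: M_def)
qed

lemma kdiff_on_iter:
  assumes "kdiff_on \<Omega> (j + K) f"
  shows "kdiff_on \<Omega> K ((pu ^^ j) f)" "kdiff_on \<Omega> K ((pv ^^ j) f)"
  using assms
proof (induction j arbitrary: f)
  case (Suc j)
  { case 1 then show ?case using Suc.IH(1)[of "pu f"] by (simp add: kdiff_on_Suc funpow_swap1 del: graded.simps(2)) }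
  { case 2 then show ?case using Suc.IH(2)[of "pv f"] by (simp add: kdiff_on_Suc funpow_swap1 del: graded.simps(2)) }
qed simp_all

text \<open>Only pure derivatives normal to the respective side occur, since the one-dimensional
  rule is applied to one variable at a time.\<close>

definition matched :: "nat \<Rightarrow> real \<Rightarrow> (real \<times> real \<Rightarrow> real) \<Rightarrow> bool" where
  "matched K a f \<longleftrightarrow> (\<forall>j<K. \<forall>t\<in>{-a..a}. (pu ^^ j) f (a, t) = (pu ^^ j) f (-a, t)
      \<and> (pv ^^ j) f (t, a) = (pv ^^ j) f (t, -a))"

text \<open>The sum over the second variable is replaced by an integral, then, under that integral,
  the sum over the first. One derivative beyond \<open>K\<close> makes the \<open>K\<close>-th
  partials continuous, hence bounded, so a single \<open>C\<close> serves all \<open>N\<close> and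
  \<open>h\<close> with \<open>real N * h \<le> A\<close>.\<close>

lemma trapezoid_2d:
  assumes K: "0 < K" and f: "kdiff_on {u. mnorm u < b} (Suc K) f" and A: "A < b"
  obtains C where "\<And>h N. 0 < h \<Longrightarrow> 0 < N \<Longrightarrow> real N * h \<le> A \<Longrightarrow> matched K (real N * h) f \<Longrightarrow>
    \<bar>h\<^sup>2 * (\<Sum>(i, j)\<in>{- int N..int N - 1} \<times> {- int N..int N - 1}. f (of_int i * h, of_int j * h))
      - integral {u. mnorm u \<le> real N * h} f\<bar> \<le> C * h ^ K"
proof -
  have it: "(pu ^^ j) f differentiable (at u)" "(pv ^^ j) f differentiable (at u)"
    if "j \<le> K" "mnorm u < b" for j u
  proof -
    have "kdiff_on {u. mnorm u < b} (Suc (K - j)) ((pu ^^ j) f)" "kdiff_on {u. mnorm u < b} (Suc (K - j)) ((pv ^^ j) f)"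
      using that f by (auto intro!: kdiff_on_iter simp: Suc_diff_le[symmetric] simp del: graded.simps(2))
    then show "(pu ^^ j) f differentiable (at u)" "(pv ^^ j) f differentiable (at u)"
      using that unfolding kdiff_on_Suc by blast+
  qed
  have sub: "{u. mnorm u \<le> A} \<subseteq> {u. mnorm u < b}" using A by auto
  have "bounded ((pu ^^ K) f ` {u. mnorm u \<le> A})" "bounded ((pv ^^ K) f ` {u. mnorm u \<le> A})"
    using it sub by (intro compact_imp_bounded compact_continuous_image compact_mnorm_le
      continuous_at_imp_continuous_on ballI differentiable_imp_continuous_within; auto)+
  then obtain B1 B2 where B12: "\<And>u. mnorm u \<le> A \<Longrightarrow> \<bar>(pu ^^ K) f u\<bar> \<le> B1"
      "\<And>u. mnorm u \<le> A \<Longrightarrow> \<bar>(pv ^^ K) f u\<bar> \<le> B2"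
    unfolding bounded_iff by (metis imageI mem_Collect_eq real_norm_def)
  define B where "B = \<bar>B1\<bar> + \<bar>B2\<bar>"
  have B: "\<bar>(pu ^^ K) f u\<bar> \<le> B" "\<bar>(pv ^^ K) f u\<bar> \<le> B" if "mnorm u \<le> A" for u
    using B12[OF that] by (auto simp: B_def)
  have B0: "B \<ge> 0" by (simp add: B_def)
  show ?thesis
  proof (rule that[of "2 * (2 * A * (2 ^ K * (2 * A * B)))"])
    fix h :: real and N :: nat
    assume h: "0 < h" "0 < N" "real N * h \<le> A" and m: "matched K (real N * h) f"
    define a where "a = real N * h"
    define M where "M = 2 ^ K * (2 * a * B * h ^ K)"
    have a: "0 < a" "a \<le> A" "a < b" using h A by (auto simp: a_def)
    have M0: "M \<ge> 0" using a B0 h by (simp add: M_def)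
    let ?I = "{- int N..int N - 1}"
    have mn: "mnorm (x, y) < b" if "x \<in> {-b<..<b}" "y \<in> {-a..a}" for x y
      using that a by (auto simp: mnorm_def)
    have mn': "mnorm (y, x) < b" if "x \<in> {-b<..<b}" "y \<in> {-a..a}" for x y
      using that a by (auto simp: mnorm_def)
    have 1: "\<bar>trap_sum N h (\<lambda>x. f (x, y)) - integral {-a..a} (\<lambda>x. f (x, y))\<bar> \<le> M" if y: "y \<in> {-a..a}" for y
    proof -
      have "\<bar>trap_sum N h ((\<lambda>k x. (pu ^^ k) f (x, y)) 0) - integral {-a..a} ((\<lambda>k x. (pu ^^ k) f (x, y)) 0)\<bar>
          \<le> 2 ^ K * (2 * a * B * h ^ K)"
      proof (rule trapezoid_1d[OF h(1,2) a_def a(3) K])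
        fix k x assume "k < K" "x \<in> {-b<..<b}"
        then show "((\<lambda>x. (pu ^^ k) f (x, y)) has_real_derivative (pu ^^ Suc k) f (x, y)) (at x)"
          using has_pu[OF it(1)[of k "(x, y)"]] mn y by simp
      next
        fix x assume "x \<in> {-a..a}"
        then show "\<bar>(pu ^^ K) f (x, y)\<bar> \<le> B" using y a by (intro B) (auto simp: mnorm_def)
      next
        fix k assume "k < K"
        then show "(pu ^^ k) f (a, y) = (pu ^^ k) f (-a, y)"
          using m y unfolding matched_def a_def by blast
      qed
      then show ?thesis by (simp add: M_def)
    qed
    have 2: "\<bar>trap_sum N h (\<lambda>y. f (x, y)) - integral {-a..a} (\<lambda>y. f (x, y))\<bar> \<le> M" if x: "x \<in> {-a..a}" for x
    proof -
      have "\<bar>trap_sum N h ((\<lambda>k y. (pv ^^ k) f (x, y)) 0) - integral {-a..a} ((\<lambda>k y. (pv ^^ k) f (x, y)) 0)\<bar>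
          \<le> 2 ^ K * (2 * a * B * h ^ K)"
      proof (rule trapezoid_1d[OF h(1,2) a_def a(3) K])
        fix k y assume "k < K" "y \<in> {-b<..<b}"
        then show "((\<lambda>y. (pv ^^ k) f (x, y)) has_real_derivative (pv ^^ Suc k) f (x, y)) (at y)"
          using has_pv[OF it(2)[of k "(x, y)"]] mn' x by simp
      next
        fix y assume "y \<in> {-a..a}"
        then show "\<bar>(pv ^^ K) f (x, y)\<bar> \<le> B" using x a by (intro B) (auto simp: mnorm_def)
      next
        fix k assume "k < K"
        then show "(pv ^^ k) f (x, a) = (pv ^^ k) f (x, -a)"
          using m x unfolding matched_def a_def by blast
      qed
      then show ?thesis by (simp add: M_def)
    qed
    have contf: "continuous_on (cbox (-a, -a) (a, a)) f"
      using it(1)[of 0] a by (intro continuous_at_imp_continuous_on ballI differentiable_imp_continuous_within)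
        (auto simp: mnorm_le_cbox[symmetric])
    have conty: "continuous_on {-a..a} (\<lambda>y. f (x, y))" if "x \<in> {-a..a}" for x
      by (rule continuous_on_compose2[OF contf]) (use that in \<open>auto intro!: continuous_intros\<close>)
    have I: "integral {u. mnorm u \<le> a} f = integral {-a..a} (\<lambda>y. integral {-a..a} (\<lambda>x. f (x, y)))"
      unfolding mnorm_le_cbox
      using integral_prod_continuous[OF contf] integral_swap_continuous[of "-a" "-a" a a "\<lambda>x y. f (x, y)"] contf
      by (simp add: cbox_interval)
    have mem: "of_int i * h \<in> {-a..a}" if "i \<in> ?I" for i
    proof -
      have "real_of_int (- int N) \<le> of_int i" "real_of_int i \<le> of_int (int N)"
        using that unfolding of_int_le_iff by auto
      then have "- real N \<le> of_int i" "of_int i \<le> real N" by simp_all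
      then have "- real N * h \<le> of_int i * h" "of_int i * h \<le> real N * h"
        using h by (intro mult_right_mono; simp)+
      then show ?thesis by (simp add: a_def)
    qed
    \<comment> \<open>The intermediate quantity: summed in the first variable, integrated in the
      second.\<close>
    define S where "S = h * (\<Sum>i\<in>?I. integral {-a..a} (\<lambda>y. f (of_int i * h, y)))"
    have cardI: "h * (\<Sum>i\<in>?I. M) = 2 * a * M" by (simp add: a_def)
    have "h\<^sup>2 * (\<Sum>(i, j)\<in>?I \<times> ?I. f (of_int i * h, of_int j * h)) =
        h * (\<Sum>i\<in>?I. trap_sum N h (\<lambda>y. f (of_int i * h, y)))"
      by (simp add: sum.cartesian_product[symmetric] trap_sum_def sum_distrib_left power2_eq_square mult.assoc)
    then have "\<bar>h\<^sup>2 * (\<Sum>(i, j)\<in>?I \<times> ?I. f (of_int i * h, of_int j * h)) - S\<bar> =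
        \<bar>h * (\<Sum>i\<in>?I. trap_sum N h (\<lambda>y. f (of_int i * h, y)) - integral {-a..a} (\<lambda>y. f (of_int i * h, y)))\<bar>"
      by (simp add: S_def sum_subtractf right_diff_distrib)
    also have "\<dots> \<le> h * (\<Sum>i\<in>?I. M)"
    proof -
      have "\<bar>\<Sum>i\<in>?I. trap_sum N h (\<lambda>y. f (of_int i * h, y)) - integral {-a..a} (\<lambda>y. f (of_int i * h, y))\<bar> \<le> (\<Sum>i\<in>?I. M)"
        by (intro order_trans[OF sum_abs] sum_mono 2 mem)
      then show ?thesis using h by (simp add: abs_mult)
    qed
    finally have 3: "\<bar>h\<^sup>2 * (\<Sum>(i, j)\<in>?I \<times> ?I. f (of_int i * h, of_int j * h)) - S\<bar> \<le> 2 * a * M"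
      unfolding cardI .
    have "S = integral {-a..a} (\<lambda>y. trap_sum N h (\<lambda>x. f (x, y)))"
      unfolding S_def trap_sum_def
      by (subst integral_mult_right, subst integral_sum)
         (auto intro!: integrable_continuous_real conty mem)
    moreover have "(\<lambda>y. trap_sum N h (\<lambda>x. f (x, y))) integrable_on {-a..a}"
      unfolding trap_sum_def by (intro integrable_continuous_real continuous_intros conty mem)
    moreover have "(\<lambda>y. integral {-a..a} (\<lambda>x. f (x, y))) integrable_on {-a..a}"
    proof (rule integrable_continuous_real)
      have "continuous_on (cbox (-a) a) (\<lambda>y. integral (cbox (-a) a) (\<lambda>x. f (x, y)))"
      proof (rule integral_continuous_on_param)
        show "continuous_on (cbox (-a) a \<times> cbox (-a) a) (\<lambda>(y, x). f (x, y))"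
          unfolding split_beta
          by (rule continuous_on_compose2[OF contf]) (auto intro!: continuous_intros)
      qed
      then show "continuous_on {-a..a} (\<lambda>y. integral {-a..a} (\<lambda>x. f (x, y)))" by simp
    qed
    ultimately have "S - integral {u. mnorm u \<le> a} f =
        integral {-a..a} (\<lambda>y. trap_sum N h (\<lambda>x. f (x, y)) - integral {-a..a} (\<lambda>x. f (x, y)))"
      unfolding I by (simp add: Henstock_Kurzweil_Integration.integral_diff)
    moreover have "norm (integral {-a..a} (\<lambda>y. trap_sum N h (\<lambda>x. f (x, y)) - integral {-a..a} (\<lambda>x. f (x, y)))) \<le> M * (a - (-a))"
    proof (rule integral_bound)
      show "continuous_on {-a..a} (\<lambda>y. trap_sum N h (\<lambda>x. f (x, y)) - integral {-a..a} (\<lambda>x. f (x, y)))"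
      proof (intro continuous_intros)
        show "continuous_on {-a..a} (\<lambda>y. trap_sum N h (\<lambda>x. f (x, y)))"
          unfolding trap_sum_def by (intro continuous_intros conty mem)
        have "continuous_on (cbox (-a) a) (\<lambda>y. integral (cbox (-a) a) (\<lambda>x. f (x, y)))"
        proof (rule integral_continuous_on_param)
          show "continuous_on (cbox (-a) a \<times> cbox (-a) a) (\<lambda>(y, x). f (x, y))"
            unfolding split_beta
            by (rule continuous_on_compose2[OF contf]) (auto intro!: continuous_intros)
        qed
        then show "continuous_on {-a..a} (\<lambda>y. integral {-a..a} (\<lambda>x. f (x, y)))" by simp
      qed
    qed (use a 1 in auto)
    ultimately have 4: "\<bar>S - integral {u. mnorm u \<le> a} f\<bar> \<le> 2 * a * M" by (simp add: mult_ac)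
    have "2 * a * M + 2 * a * M \<le> 2 * (2 * A * (2 ^ K * (2 * A * B))) * h ^ K"
    proof -
      have "a * M \<le> A * (2 ^ K * (2 * A * B * h ^ K))"
        unfolding M_def using a B0 h by (intro mult_mono order_refl) auto
      then show ?thesis by (simp add: algebra_simps)
    qed
    with 3 4 show "\<bar>h\<^sup>2 * (\<Sum>(i, j)\<in>?I \<times> ?I. f (of_int i * h, of_int j * h))
      - integral {u. mnorm u \<le> real N * h} f\<bar> \<le> 2 * (2 * A * (2 ^ K * (2 * A * B))) * h ^ K"
      unfolding a_def[symmetric] by linarith
  qed
qed

subsection \<open>Finite parts\<close>

lemma filterlim_times_at_right:
  assumes "m > 0"
  shows "filterlim (\<lambda>\<epsilon>. m * \<epsilon>) (at_right 0) (at_right (0 :: real))"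
proof -
  have "\<forall>\<^sub>F \<epsilon> in at_right 0. m * \<epsilon> \<in> {0<..} \<and> m * \<epsilon> \<noteq> 0"
    using eventually_at_right_less[of "0 :: real"] by eventually_elim (use assms in auto)
  moreover have "((\<lambda>\<epsilon>. m * \<epsilon>) \<longlongrightarrow> 0) (at_right 0)" by (auto intro!: tendsto_eq_intros)
  ultimately show ?thesis unfolding filterlim_at by blast
qed

text \<open>\<open>S (\<epsilon> / 2) - 2\<^bsup>b\<^esup> S \<epsilon>\<close> has one term less than \<open>S\<close> and tends to \<open>(1 - 2\<^bsup>b\<^esup>) c\<close>.\<close>

lemma sum_powr_tendsto_zero:
  fixes bs :: "(real \<times> real) list"
  assumes "\<forall>(b, _)\<in>set bs. b > 0"
    and "((\<lambda>\<epsilon>. (\<Sum>(b, d)\<leftarrow>bs. d * \<epsilon> powr (- b))) \<longlongrightarrow> c) (at_right (0 :: real))"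
  shows "c = 0"
  using assms
proof (induction "length bs" arbitrary: bs c)
  case 0
  then show ?case using tendsto_unique[OF trivial_limit_at_right_real 0(3), of 0] by simp
next
  case (Suc n)
  obtain p bs' where bs': "bs = p # bs'" using Suc.hyps(2) by (cases bs) auto
  note prems = Suc.prems[unfolded bs']
  obtain b d where p: "p = (b, d)" by (cases p)
  have b: "b > 0" using prems p by auto
  let ?f = "\<lambda>\<epsilon>. (\<Sum>(b, d)\<leftarrow>p # bs'. d * \<epsilon> powr (- b))"
  have half: "filterlim (\<lambda>\<epsilon>. \<epsilon> / 2) (at_right 0) (at_right (0 :: real))"
    using filterlim_times_at_right[of "1 / 2"] by simp
  have "((\<lambda>\<epsilon>. ?f (\<epsilon> / 2) - 2 powr b * ?f \<epsilon>) \<longlongrightarrow> c - 2 powr b * c) (at_right 0)"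
    by (intro tendsto_intros filterlim_compose[OF prems(2) half] prems(2))
  moreover have "\<forall>\<^sub>F \<epsilon> in at_right 0. ?f (\<epsilon> / 2) - 2 powr b * ?f \<epsilon> =
      (\<Sum>(b', d')\<leftarrow>map (\<lambda>(b', d'). (b', (2 powr b' - 2 powr b) * d')) bs'. d' * \<epsilon> powr (- b'))"
    using eventually_at_right_less[of "0 :: real"]
  proof eventually_elim
    case (elim \<epsilon>)
    have pw: "(\<epsilon> / 2) powr (- b') = 2 powr b' * \<epsilon> powr (- b')" for b'
      using elim by (simp add: powr_divide powr_minus field_simps)
    have "(\<Sum>(b', d')\<leftarrow>bs'. d' * (\<epsilon> / 2) powr (- b')) - 2 powr b * (\<Sum>(b', d')\<leftarrow>bs'. d' * \<epsilon> powr (- b')) =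
        (\<Sum>(b', d')\<leftarrow>map (\<lambda>(b', d'). (b', (2 powr b' - 2 powr b) * d')) bs'. d' * \<epsilon> powr (- b'))"
      by (induction bs') (auto simp: pw algebra_simps)
    then show ?case by (simp add: p pw algebra_simps)
  qed
  ultimately have "((\<lambda>\<epsilon>. \<Sum>(b', d')\<leftarrow>map (\<lambda>(b', d'). (b', (2 powr b' - 2 powr b) * d')) bs'. d' * \<epsilon> powr (- b'))
      \<longlongrightarrow> c - 2 powr b * c) (at_right 0)"
    by (rule Lim_transform_eventually)
  then have "c - 2 powr b * c = 0"
    using prems(1) Suc.hyps(2) by (intro Suc.hyps(1)) (auto simp: bs' simp del: map_map)
  then have "c * (1 - 2 powr b) = 0" by (simp add: algebra_simps)
  moreover have "2 powr b \<noteq> 1" using b by simp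
  ultimately show ?case by (metis mult_eq_0_iff right_minus_eq)
qed

text \<open>The difference of two regularisations is a list of negative powers converging to
  \<open>c' - c\<close>. Lists may repeat exponents, so concatenation suffices.\<close>

lemma fp_has_unique:
  assumes "fp_has f L c" "fp_has f L c'"
  shows "c = c'"
proof -
  obtain bs where bs: "\<forall>(b, _)\<in>set bs. b > 0"
      "((\<lambda>\<epsilon>. integral {u. \<epsilon> < mnorm u \<and> mnorm u \<le> L} f
               - (\<Sum>(b, d) \<leftarrow> bs. d * \<epsilon> powr (- b))) \<longlongrightarrow> c) (at_right 0)"
    using assms(1) unfolding fp_has_def by blast
  obtain bs' where bs': "\<forall>(b, _)\<in>set bs'. b > 0"
      "((\<lambda>\<epsilon>. integral {u. \<epsilon> < mnorm u \<and> mnorm u \<le> L} f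
               - (\<Sum>(b, d) \<leftarrow> bs'. d * \<epsilon> powr (- b))) \<longlongrightarrow> c') (at_right 0)"
    using assms(2) unfolding fp_has_def by blast
  let ?cs = "bs @ map (\<lambda>(b, d). (b, - d)) bs'"
  have neg: "(\<Sum>(b, d)\<leftarrow>map (\<lambda>(b, d). (b, - d)) bs'. d * \<epsilon> powr (- b)) = - (\<Sum>(b, d)\<leftarrow>bs'. d * \<epsilon> powr (- b))"
    for \<epsilon> :: real by (induction bs') auto
  have "((\<lambda>\<epsilon>. (\<Sum>(b, d)\<leftarrow>?cs. d * \<epsilon> powr (- b))) \<longlongrightarrow> c' - c) (at_right 0)"
    using tendsto_diff[OF bs'(2) bs(2)] by (simp add: neg algebra_simps del: map_map)
  then have "c' - c = 0"
    by (rule sum_powr_tendsto_zero[rotated]) (use bs bs' in auto)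
  then show ?thesis by simp
qed

lemma fp_integral_eq: "fp_has f L c \<Longrightarrow> fp_integral f L = c"
  unfolding fp_integral_def using fp_has_unique by blast

text \<open>Every removed square contains the origin, so the value there is irrelevant; remainders
  can be reset to 0 at that point.\<close>

lemma fp_has_cong:
  assumes "fp_has f L c" "\<And>u. u \<noteq> (0, 0) \<Longrightarrow> mnorm u \<le> L \<Longrightarrow> f u = g u"
  shows "fp_has g L c"
proof -
  obtain bs where bs: "\<forall>(b, _)\<in>set bs. b > 0"
      "((\<lambda>\<epsilon>. integral {u. \<epsilon> < mnorm u \<and> mnorm u \<le> L} f
               - (\<Sum>(b, d) \<leftarrow> bs. d * \<epsilon> powr (- b))) \<longlongrightarrow> c) (at_right 0)"
    using assms(1) unfolding fp_has_def by blast
  have "\<forall>\<^sub>F \<epsilon> in at_right 0. integral {u. \<epsilon> < mnorm u \<and> mnorm u \<le> L} f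
               - (\<Sum>(b, d) \<leftarrow> bs. d * \<epsilon> powr (- b)) = integral {u. \<epsilon> < mnorm u \<and> mnorm u \<le> L} g
               - (\<Sum>(b, d) \<leftarrow> bs. d * \<epsilon> powr (- b))"
    using eventually_at_right_less[of "0 :: real"]
  proof eventually_elim
    case (elim \<epsilon>)
    have "integral {u. \<epsilon> < mnorm u \<and> mnorm u \<le> L} f = integral {u. \<epsilon> < mnorm u \<and> mnorm u \<le> L} g"
    proof (rule integral_cong)
      fix u assume u: "u \<in> {u. \<epsilon> < mnorm u \<and> mnorm u \<le> L}"
      then have "u \<noteq> (0, 0)" using elim by auto
      then show "f u = g u" using u assms(2) by simp
    qed
    then show ?case by simp
  qed
  from Lim_transform_eventually[OF bs(2) this] bs(1) show ?thesis
    unfolding fp_has_def by blast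
qed

lemma fp_has_cmult:
  assumes "fp_has f L c"
  shows "fp_has (\<lambda>u. k * f u) L (k * c)"
proof -
  obtain bs where bs: "\<forall>(b, _)\<in>set bs. b > 0"
      "((\<lambda>\<epsilon>. integral {u. \<epsilon> < mnorm u \<and> mnorm u \<le> L} f
               - (\<Sum>(b, d) \<leftarrow> bs. d * \<epsilon> powr (- b))) \<longlongrightarrow> c) (at_right 0)"
    using assms(1) unfolding fp_has_def by blast
  have m: "(\<Sum>(b, d)\<leftarrow>map (\<lambda>(b, d). (b, k * d)) bs. d * \<epsilon> powr (- b)) = k * (\<Sum>(b, d)\<leftarrow>bs. d * \<epsilon> powr (- b))"
    for \<epsilon> :: real by (induction bs) (auto simp: algebra_simps)
  show ?thesis unfolding fp_has_def
    by (rule exI[of _ "map (\<lambda>(b, d). (b, k * d)) bs"])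
       (use bs tendsto_mult_left[OF bs(2), of k] in \<open>auto simp: m right_diff_distrib simp del: map_map\<close>)
qed

lemma mnorm_scaleR: "mnorm (m *\<^sub>R u) = \<bar>m\<bar> * mnorm u"
  using mnorm_scale[of m u] by (simp add: scaleR_prod_def)

text \<open>The change of variables is done on a square containing \<open>S\<close>, with the
  function extended by 0. Negative \<open>m\<close> is included for the sake of reflections.\<close>

lemma has_integral_scale:
  fixes f :: "real \<times> real \<Rightarrow> real"
  assumes "m \<noteq> 0" "bounded S" "(f has_integral i) S"
  shows "((\<lambda>u. f (m *\<^sub>R u)) has_integral i / m\<^sup>2) {u. m *\<^sub>R u \<in> S}"
proof -
  let ?F = "\<lambda>u. if u \<in> S then f u else 0"
  obtain r where r: "S \<subseteq> cbox (- r, - r) (r, r)"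
  proof -
    obtain B where B: "\<And>u. u \<in> S \<Longrightarrow> norm u \<le> B" using assms(2) by (auto simp: bounded_iff)
    have "S \<subseteq> cbox (- B, - B) (B, B)"
    proof
      fix u assume u: "u \<in> S"
      have "mnorm u \<le> norm u"
        unfolding mnorm_def using norm_fst_le[of "fst u" "snd u"] norm_snd_le[of "snd u" "fst u"] by auto
      then have "mnorm u \<le> B" using B[OF u] by linarith
      then show "u \<in> cbox (- B, - B) (B, B)" using mnorm_le_cbox[of B] by blast
    qed
    then show ?thesis using that by blast
  qed
  have img: "(\<lambda>u. (1 / m) *\<^sub>R u + - ((1 / m) *\<^sub>R 0)) ` cbox (- r, - r) (r, r) = cbox (- (r / \<bar>m\<bar>), - (r / \<bar>m\<bar>)) (r / \<bar>m\<bar>, r / \<bar>m\<bar>)"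
  proof (intro set_eqI iffI)
    fix v assume "v \<in> (\<lambda>u. (1 / m) *\<^sub>R u + - ((1 / m) *\<^sub>R 0)) ` cbox (- r, - r) (r, r)"
    then obtain u where u: "mnorm u \<le> r" "v = (1 / m) *\<^sub>R u" unfolding mnorm_le_cbox[symmetric] by auto
    then show "v \<in> cbox (- (r / \<bar>m\<bar>), - (r / \<bar>m\<bar>)) (r / \<bar>m\<bar>, r / \<bar>m\<bar>)"
      unfolding mnorm_le_cbox[symmetric] using assms by (auto simp: mnorm_scaleR field_simps)
  next
    fix v assume "v \<in> cbox (- (r / \<bar>m\<bar>), - (r / \<bar>m\<bar>)) (r / \<bar>m\<bar>, r / \<bar>m\<bar>)"
    then have v: "mnorm v \<le> r / \<bar>m\<bar>" unfolding mnorm_le_cbox[symmetric] by auto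
    show "v \<in> (\<lambda>u. (1 / m) *\<^sub>R u + - ((1 / m) *\<^sub>R 0)) ` cbox (- r, - r) (r, r)"
      by (rule image_eqI[of _ _ "m *\<^sub>R v"])
        (use v assms in \<open>auto simp: mnorm_le_cbox[symmetric] mnorm_scaleR field_simps\<close>)
  qed
  let ?S' = "{u. m *\<^sub>R u \<in> S}"
  have r': "?S' \<subseteq> cbox (- (r / \<bar>m\<bar>), - (r / \<bar>m\<bar>)) (r / \<bar>m\<bar>, r / \<bar>m\<bar>)"
  proof
    fix u assume "u \<in> ?S'"
    then have "mnorm (m *\<^sub>R u) \<le> r" using r unfolding mnorm_le_cbox[symmetric] by auto
    then show "u \<in> cbox (- (r / \<bar>m\<bar>), - (r / \<bar>m\<bar>)) (r / \<bar>m\<bar>, r / \<bar>m\<bar>)"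
      unfolding mnorm_le_cbox[symmetric] using assms by (simp add: mnorm_scaleR field_simps)
  qed
  have "(?F has_integral i) (cbox (- r, - r) (r, r))"
    using has_integral_restrict[OF r, of f i] assms(3) by simp
  from has_integral_affinity[OF this assms(1), of 0]
  have "((\<lambda>u. ?F (m *\<^sub>R u)) has_integral i / m\<^sup>2) (cbox (- (r / \<bar>m\<bar>), - (r / \<bar>m\<bar>)) (r / \<bar>m\<bar>, r / \<bar>m\<bar>))"
    unfolding img by (simp add: power2_eq_square cong: if_cong)
  then show ?thesis
    using has_integral_restrict[OF r', of "\<lambda>u. f (m *\<^sub>R u)" "i / m\<^sup>2"] by simp
qed

lemma integral_scale:
  fixes f :: "real \<times> real \<Rightarrow> real"
  assumes "m \<noteq> 0" "bounded S"
  shows "integral S f = m\<^sup>2 * integral {u. m *\<^sub>R u \<in> S} (\<lambda>u. f (m *\<^sub>R u))"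
proof (cases "f integrable_on S")
  case True
  then show ?thesis
    using has_integral_scale[OF assms integrable_integral[OF True]] assms(1) by (simp add: integral_unique)
next
  \<comment> \<open>Neither side is integrable, and both integrals take the default value 0.\<close>
  case False
  let ?S = "{u. m *\<^sub>R u \<in> S}" and ?f = "\<lambda>u. f (m *\<^sub>R u)"
  have "?S = (\<lambda>u. (1 / m) *\<^sub>R u) ` S"
  proof (intro set_eqI iffI)
    fix u assume "u \<in> ?S"
    then show "u \<in> (\<lambda>u. (1 / m) *\<^sub>R u) ` S"
      using assms(1) by (intro image_eqI[of _ _ "m *\<^sub>R u"]) auto
  qed (use assms(1) in auto)
  then have bS: "bounded ?S" using bounded_scaling[OF assms(2), of "1 / m"] by simp
  have "\<not> ?f integrable_on ?S"
  proof
    assume "?f integrable_on ?S"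
    then obtain i where "(?f has_integral i) ?S" by blast
    from has_integral_scale[OF _ bS this, of "1 / m"] assms(1)
    have "(f has_integral i / (1 / m)\<^sup>2) S" by simp
    with False show False by blast
  qed
  with False show ?thesis by (simp add: not_integrable_integral)
qed

lemma bounded_ann [simp]: "bounded {u. \<epsilon> < mnorm u \<and> mnorm u \<le> L}"
  by (rule bounded_subset[OF compact_imp_bounded[OF compact_mnorm_le[of L]]]) auto

lemma ann_scale:
  assumes "m \<noteq> 0"
  shows "integral {u. \<epsilon> < mnorm u \<and> mnorm u \<le> L} f =
    m\<^sup>2 * integral {u. \<epsilon> / \<bar>m\<bar> < mnorm u \<and> mnorm u \<le> L / \<bar>m\<bar>} (\<lambda>u. f (m *\<^sub>R u))"
proof -
  have "{u. m *\<^sub>R u \<in> {u. \<epsilon> < mnorm u \<and> mnorm u \<le> L}} = {u. \<epsilon> / \<bar>m\<bar> < mnorm u \<and> mnorm u \<le> L / \<bar>m\<bar>}"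
    using assms by (auto simp: mnorm_scaleR field_simps)
  then show ?thesis using integral_scale[OF assms bounded_ann, of \<epsilon> L f] by simp
qed

text \<open>The reflection is \<open>ann_scale\<close> with \<open>m = - 1\<close>, so every annular
  integral equals its own negative and the list of powers is empty.\<close>

lemma fp_has_odd:
  assumes "\<And>u. f (- u) = - f u"
  shows "fp_has f L 0"
proof -
  have "integral {u. \<epsilon> < mnorm u \<and> mnorm u \<le> L} f = 0" for \<epsilon>
  proof -
    have "f (- 1 *\<^sub>R u) = - f u" for u using assms[of u] by simp
    then show ?thesis using ann_scale[of "- 1" \<epsilon> L f] by simp
  qed
  then show ?thesis unfolding fp_has_def by (intro exI[of _ "[]"]) auto
qed

text \<open>Replacing \<epsilon> by m \<epsilon> only rescales the coefficients of pure powers and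
  leaves the constant term alone; a logarithm would feed a multiple of log m into it.\<close>

lemma fp_has_scale:
  assumes "fp_has f L c" "m > 0"
  shows "fp_has (\<lambda>u. f (m *\<^sub>R u)) (L / m) (c / m\<^sup>2)"
proof -
  obtain bs where bs: "\<forall>(b, _)\<in>set bs. b > 0"
      "((\<lambda>\<epsilon>. integral {u. \<epsilon> < mnorm u \<and> mnorm u \<le> L} f
               - (\<Sum>(b, d) \<leftarrow> bs. d * \<epsilon> powr (- b))) \<longlongrightarrow> c) (at_right 0)"
    using assms(1) unfolding fp_has_def by blast
  let ?bs = "map (\<lambda>(b, d). (b, d * m powr (- b) / m\<^sup>2)) bs"
  have lim: "filterlim (\<lambda>\<epsilon>. m * \<epsilon>) (at_right 0) (at_right (0 :: real))"
    by (rule filterlim_times_at_right[OF assms(2)])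
  have "((\<lambda>\<epsilon>. (integral {u. m * \<epsilon> < mnorm u \<and> mnorm u \<le> L} f
               - (\<Sum>(b, d) \<leftarrow> bs. d * (m * \<epsilon>) powr (- b))) / m\<^sup>2) \<longlongrightarrow> c / m\<^sup>2) (at_right 0)"
    using filterlim_compose[OF bs(2) lim] assms by (intro tendsto_intros) auto
  moreover have "\<forall>\<^sub>F \<epsilon> in at_right 0. (integral {u. m * \<epsilon> < mnorm u \<and> mnorm u \<le> L} f
               - (\<Sum>(b, d) \<leftarrow> bs. d * (m * \<epsilon>) powr (- b))) / m\<^sup>2 =
       integral {u. \<epsilon> < mnorm u \<and> mnorm u \<le> L / m} (\<lambda>u. f (m *\<^sub>R u)) - (\<Sum>(b, d) \<leftarrow> ?bs. d * \<epsilon> powr (- b))"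
    using eventually_at_right_less[of "0 :: real"]
  proof eventually_elim
    case (elim \<epsilon>)
    have "(\<Sum>(b, d) \<leftarrow> bs. d * (m * \<epsilon>) powr (- b)) / m\<^sup>2 = (\<Sum>(b, d) \<leftarrow> ?bs. d * \<epsilon> powr (- b))"
      using elim assms by (induction bs) (auto simp: powr_mult add_divide_distrib)
    moreover have "integral {u. m * \<epsilon> < mnorm u \<and> mnorm u \<le> L} f =
        m\<^sup>2 * integral {u. \<epsilon> < mnorm u \<and> mnorm u \<le> L / m} (\<lambda>u. f (m *\<^sub>R u))"
      using ann_scale[of m "m * \<epsilon>" L f] assms by simp
    ultimately show ?case using assms by (simp add: diff_divide_distrib)
  qed
  ultimately have "((\<lambda>\<epsilon>. integral {u. \<epsilon> < mnorm u \<and> mnorm u \<le> L / m} (\<lambda>u. f (m *\<^sub>R u))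
      - (\<Sum>(b, d) \<leftarrow> ?bs. d * \<epsilon> powr (- b))) \<longlongrightarrow> c / m\<^sup>2) (at_right 0)"
    by (rule Lim_transform_eventually)
  then show ?thesis unfolding fp_has_def using bs(1) by (intro exI[of _ ?bs]) auto
qed

lemma integrable_ann:
  fixes f :: "real \<times> real \<Rightarrow> real"
  assumes "continuous_on {u. u \<noteq> (0, 0) \<and> mnorm u \<le> L} f" "\<epsilon> > 0"
  shows "f integrable_on {u. \<epsilon> < mnorm u \<and> mnorm u \<le> L}"
proof -
  have comp: "compact {u. \<epsilon> \<le> mnorm u \<and> mnorm u \<le> L}"
  proof -
    have "{u. \<epsilon> \<le> mnorm u \<and> mnorm u \<le> L} = {u. mnorm u \<le> L} \<inter> {u. \<epsilon> \<le> mnorm u}" by auto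
    moreover have "closed {u. \<epsilon> \<le> mnorm u}" by (intro closed_Collect_le continuous_intros)
    ultimately show ?thesis by (simp add: compact_Int_closed)
  qed
  have "continuous_on {u. \<epsilon> \<le> mnorm u \<and> mnorm u \<le> L} f"
    by (rule continuous_on_subset[OF assms(1)]) (use assms(2) in \<open>auto simp: mnorm_def\<close>)
  from borel_integrable_compact[OF comp this]
  have 1: "set_integrable lborel {u. \<epsilon> \<le> mnorm u \<and> mnorm u \<le> L} f"
    by (simp add: set_integrable_def)
  have "open {u. \<epsilon> < mnorm u}" by simp
  then have "{u. \<epsilon> < mnorm u} \<inter> {u. mnorm u \<le> L} \<in> sets borel"
    by (intro sets.Int borel_open borel_closed compact_imp_closed compact_mnorm_le)
  then have "{u. \<epsilon> < mnorm u \<and> mnorm u \<le> L} \<in> sets lborel" by (simp add: Collect_conj_eq)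
  from set_integrable_subset[OF 1 this]
  have "set_integrable lborel {u. \<epsilon> < mnorm u \<and> mnorm u \<le> L} f" by (auto simp: subset_eq)
  then show ?thesis by (rule set_borel_integral_eq_integral)
qed

lemma fp_has_add:
  assumes f: "fp_has f L c" "continuous_on {u. u \<noteq> (0, 0) \<and> mnorm u \<le> L} f"
    and g: "fp_has g L d" "continuous_on {u. u \<noteq> (0, 0) \<and> mnorm u \<le> L} g"
  shows "fp_has (\<lambda>u. f u + g u) L (c + d)"
proof -
  obtain bs where bs: "\<forall>(b, _)\<in>set bs. b > 0"
      "((\<lambda>\<epsilon>. integral {u. \<epsilon> < mnorm u \<and> mnorm u \<le> L} f
               - (\<Sum>(b, d) \<leftarrow> bs. d * \<epsilon> powr (- b))) \<longlongrightarrow> c) (at_right 0)"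
    using f(1) unfolding fp_has_def by blast
  obtain bs' where bs': "\<forall>(b, _)\<in>set bs'. b > 0"
      "((\<lambda>\<epsilon>. integral {u. \<epsilon> < mnorm u \<and> mnorm u \<le> L} g
               - (\<Sum>(b, d) \<leftarrow> bs'. d * \<epsilon> powr (- b))) \<longlongrightarrow> d) (at_right 0)"
    using g(1) unfolding fp_has_def by blast
  have ev: "\<forall>\<^sub>F \<epsilon> in at_right 0. integral {u. \<epsilon> < mnorm u \<and> mnorm u \<le> L} f
               - (\<Sum>(b, d) \<leftarrow> bs. d * \<epsilon> powr (- b)) + (integral {u. \<epsilon> < mnorm u \<and> mnorm u \<le> L} g
               - (\<Sum>(b, d) \<leftarrow> bs'. d * \<epsilon> powr (- b))) =
      integral {u. \<epsilon> < mnorm u \<and> mnorm u \<le> L} (\<lambda>u. f u + g u) - (\<Sum>(b, d) \<leftarrow> bs @ bs'. d * \<epsilon> powr (- b))"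
    using eventually_at_right_less[of "0 :: real"]
  proof eventually_elim
    case (elim \<epsilon>)
    then show ?case
      using integrable_ann[OF f(2) elim] integrable_ann[OF g(2) elim]
      by (simp add: Henstock_Kurzweil_Integration.integral_add)
  qed
  show ?thesis unfolding fp_has_def
    using Lim_transform_eventually[OF tendsto_add[OF bs(2) bs'(2)] ev] bs(1) bs'(1)
    by (intro exI[of _ "bs @ bs'"]) auto
qed

lemma fp_has_sum:
  assumes "finite I" "\<And>i. i \<in> I \<Longrightarrow> fp_has (f i) L (c i)"
    "\<And>i. i \<in> I \<Longrightarrow> continuous_on {u. u \<noteq> (0, 0) \<and> mnorm u \<le> L} (f i)"
  shows "fp_has (\<lambda>u. \<Sum>i\<in>I. f i u) L (\<Sum>i\<in>I. c i)"
  using assms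
proof (induction I rule: finite_induct)
  case empty
  then show ?case using fp_has_odd[of "\<lambda>_. 0" L] by simp
next
  case (insert x F)
  then show ?case by (auto intro!: fp_has_add continuous_on_sum)
qed

lemma integral_ann_split:
  fixes f :: "real \<times> real \<Rightarrow> real"
  assumes "f integrable_on {u. x < mnorm u \<and> mnorm u \<le> y}" "f integrable_on {u. y < mnorm u \<and> mnorm u \<le> z}" "x \<le> y" "y \<le> z"
  shows "integral {u. x < mnorm u \<and> mnorm u \<le> z} f =
    integral {u. x < mnorm u \<and> mnorm u \<le> y} f + integral {u. y < mnorm u \<and> mnorm u \<le> z} f"
proof -
  have eq: "{u. x < mnorm u \<and> mnorm u \<le> z} = {u. x < mnorm u \<and> mnorm u \<le> y} \<union> {u. y < mnorm u \<and> mnorm u \<le> z}"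
    using assms by auto
  show ?thesis unfolding eq
    by (rule integral_unique, rule has_integral_Un[OF integrable_integral integrable_integral])
       (use assms in \<open>auto intro!: negligible_subset[OF negligible_empty]\<close>)
qed

text \<open>A bounded integrand contributes at most B (2\<epsilon>)^2 on the removed square, so the
  finite part is the ordinary integral, with an empty list of powers.\<close>

lemma fp_has_continuous:
  assumes "continuous_on {u. mnorm u \<le> L} f" "L > 0"
  shows "fp_has f L (integral {u. mnorm u \<le> L} f)"
proof -
  have "bounded (f ` {u. mnorm u \<le> L})"
    by (intro compact_imp_bounded compact_continuous_image assms compact_mnorm_le)
  then obtain B where B: "\<And>u. mnorm u \<le> L \<Longrightarrow> \<bar>f u\<bar> \<le> B" unfolding bounded_iff by auto
  have B0: "B \<ge> 0" using B[of "(0, 0)"] assms(2) by (simp add: mnorm_def)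
  have "((\<lambda>\<epsilon>. integral {u. \<epsilon> < mnorm u \<and> mnorm u \<le> L} f) \<longlongrightarrow> integral {u. mnorm u \<le> L} f) (at_right 0)"
  proof (rule LIM_zero_cancel, rule Lim_null_comparison)
    show "\<forall>\<^sub>F \<epsilon> in at_right 0. norm (integral {u. \<epsilon> < mnorm u \<and> mnorm u \<le> L} f - integral {u. mnorm u \<le> L} f) \<le> B * (2 * \<epsilon>)\<^sup>2"
      unfolding eventually_at_right_field
    proof (intro exI[of _ L] conjI allI impI assms(2))
      fix \<epsilon> :: real assume e: "0 < \<epsilon>" "\<epsilon> < L"
      have i1: "f integrable_on {u. \<epsilon> < mnorm u \<and> mnorm u \<le> L}"
        by (rule integrable_ann[OF _ e(1)]) (rule continuous_on_subset[OF assms(1)], auto)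
      have c2: "continuous_on (cbox (- \<epsilon>, - \<epsilon>) (\<epsilon>, \<epsilon>)) f"
        by (rule continuous_on_subset[OF assms(1)]) (use e in \<open>auto simp: mnorm_le_cbox[symmetric]\<close>)
      have i2: "f integrable_on {u. mnorm u \<le> \<epsilon>}"
        unfolding mnorm_le_cbox by (rule integrable_continuous[OF c2])
      have eq: "{u. mnorm u \<le> L} = {u. mnorm u \<le> \<epsilon>} \<union> {u. \<epsilon> < mnorm u \<and> mnorm u \<le> L}"
        using e by auto
      have "integral {u. mnorm u \<le> L} f = integral {u. mnorm u \<le> \<epsilon>} f + integral {u. \<epsilon> < mnorm u \<and> mnorm u \<le> L} f"
        unfolding eq by (rule integral_unique, rule has_integral_Un[OF integrable_integral[OF i2] integrable_integral[OF i1]])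
             (auto intro!: negligible_subset[OF negligible_empty])
      moreover have "norm (integral {u. mnorm u \<le> \<epsilon>} f) \<le> B * measure lborel (cbox (- \<epsilon>, - \<epsilon>) (\<epsilon>, \<epsilon>))"
        unfolding mnorm_le_cbox
      proof (rule has_integral_bound[OF B0 integrable_integral])
        show "f integrable_on cbox (- \<epsilon>, - \<epsilon>) (\<epsilon>, \<epsilon>)" by (rule integrable_continuous[OF c2])
        fix u assume "u \<in> cbox (- \<epsilon>, - \<epsilon>) (\<epsilon>, \<epsilon>)"
        then show "norm (f u) \<le> B" using B[of u] e by (auto simp: mnorm_le_cbox[symmetric])
      qed
      moreover have "measure lborel (cbox (- \<epsilon>, - \<epsilon>) (\<epsilon>, \<epsilon>)) = (2 * \<epsilon>)\<^sup>2"
        using e by (simp add: content_Pair power2_eq_square)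
      ultimately show "norm (integral {u. \<epsilon> < mnorm u \<and> mnorm u \<le> L} f - integral {u. mnorm u \<le> L} f) \<le> B * (2 * \<epsilon>)\<^sup>2"
        by simp
    qed
    show "((\<lambda>\<epsilon>. B * (2 * \<epsilon>)\<^sup>2) \<longlongrightarrow> 0) (at_right 0)" by (auto intro!: tendsto_eq_intros)
  qed
  then show ?thesis unfolding fp_has_def by (intro exI[of _ "[]"]) auto
qed

lemma fp_has_enlarge:
  assumes "fp_has f L c" "\<And>u. L \<le> mnorm u \<Longrightarrow> f u = 0" "L \<le> L'"
  shows "fp_has f L' c"
proof -
  have "integral {u. \<epsilon> < mnorm u \<and> mnorm u \<le> L'} f = integral {u. \<epsilon> < mnorm u \<and> mnorm u \<le> L} f" for \<epsilon>
    by (rule integral_spike_set) (use assms in \<open>auto intro!: negligible_subset[OF negligible_empty]\<close>)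
  then show ?thesis using assms(1) unfolding fp_has_def by simp
qed

text \<open>With \<open>J x\<close> the integral over \<open>x < mnorm u \<le> 1\<close> and \<open>\<delta> = d + 2\<close>, scaling gives
  \<open>J (x y) = J x + x\<^bsup>\<delta>\<^esup> J y\<close>; exchanging \<open>x\<close> and \<open>y\<close> forces \<open>J x = c (1 - x\<^bsup>\<delta>\<^esup>)\<close>.\<close>

lemma fp_has_homogeneous:
  assumes cont: "continuous_on {u. u \<noteq> (0, 0)} f"
    and hom: "\<And>t u. t > 0 \<Longrightarrow> u \<noteq> (0, 0) \<Longrightarrow> f (t *\<^sub>R u) = t powr d * f u"
    and d: "d + 2 \<noteq> 0" and L: "L > 0"
  obtains c where "fp_has f L c"
proof -
  define \<delta> where "\<delta> = d + 2"
  define I where "I x y = integral {u. x < mnorm u \<and> mnorm u \<le> y} f" for x y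
  have int: "f integrable_on {u. x < mnorm u \<and> mnorm u \<le> y}" if "x > 0" for x y
    by (rule integrable_ann[OF _ that]) (rule continuous_on_subset[OF cont], auto)
  have scale: "I (t * x) (t * y) = t powr \<delta> * I x y" if "t > 0" "x > 0" for t x y
  proof -
    have "I (t * x) (t * y) = t\<^sup>2 * integral {u. x < mnorm u \<and> mnorm u \<le> y} (\<lambda>u. f (t *\<^sub>R u))"
      unfolding I_def using ann_scale[of t "t * x" "t * y" f] that by simp
    also have "integral {u. x < mnorm u \<and> mnorm u \<le> y} (\<lambda>u. f (t *\<^sub>R u)) =
        integral {u. x < mnorm u \<and> mnorm u \<le> y} (\<lambda>u. t powr d * f u)"
    proof (rule integral_cong)
      fix u assume "u \<in> {u. x < mnorm u \<and> mnorm u \<le> y}"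
      then have "u \<noteq> (0, 0)" using that by (auto simp: mnorm_def)
      then show "f (t *\<^sub>R u) = t powr d * f u" using hom that by blast
    qed
    finally show ?thesis using that by (simp add: I_def \<delta>_def powr_add)
  qed
  have add: "I x z = I x y + I y z" if "0 < x" "x \<le> y" "y \<le> z" for x y z
    unfolding I_def using that by (intro integral_ann_split int) auto
  define J where "J x = I x 1" for x
  have J: "J (x * y) = J x + x powr \<delta> * J y" if "0 < x" "x \<le> 1" "0 < y" "y \<le> 1" for x y
  proof -
    have "J (x * y) = I (x * y) (x * 1) + I x 1"
      unfolding J_def using that by (simp add: add[of "x * y" x 1] mult_le_cancel_left1)
    then show ?thesis using scale[of x y 1] that by (simp add: J_def)
  qed
  \<comment> \<open>At \<delta> = 0 the functional equation would have logarithms as solutions, and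
    the division defining \<open>c\<close> would fail.\<close>
  have h: "1 - (1 / 2) powr \<delta> \<noteq> 0"
    using d by (simp add: \<delta>_def powr_eq_one_iff_gen)
  define c where "c = J (1 / 2) / (1 - (1 / 2) powr \<delta>)"
  have Jc: "J x = c * (1 - x powr \<delta>)" if "0 < x" "x \<le> 1" for x
  proof -
    have "J x + x powr \<delta> * J (1 / 2) = J (1 / 2) + (1 / 2) powr \<delta> * J x"
      using J[of x "1 / 2"] J[of "1 / 2" x] that by (simp add: mult.commute)
    then have "J x * (1 - (1 / 2) powr \<delta>) = J (1 / 2) * (1 - x powr \<delta>)" by (simp add: algebra_simps)
    then show ?thesis using h by (simp add: c_def field_simps)
  qed
  have I: "I \<epsilon> L = c * L powr \<delta> - c * \<epsilon> powr \<delta>" if "0 < \<epsilon>" "\<epsilon> \<le> L" for \<epsilon>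
  proof -
    have "I \<epsilon> L = L powr \<delta> * J (\<epsilon> / L)" using scale[of L "\<epsilon> / L" 1] that L by (simp add: J_def)
    also have "\<dots> = c * L powr \<delta> - c * \<epsilon> powr \<delta>"
      using Jc[of "\<epsilon> / L"] that L by (simp add: powr_divide right_diff_distrib field_simps)
    finally show ?thesis .
  qed
  have ev: "\<forall>\<^sub>F \<epsilon> in at_right 0. c * L powr \<delta> - c * \<epsilon> powr \<delta> = I \<epsilon> L"
    unfolding eventually_at_right_field using I L by (auto intro!: exI[of _ L])
  \<comment> \<open>The constant term is the same in both cases: for \<delta> > 0 the power of
    \<epsilon> tends to 0, for \<delta> < 0 it is the one divergent term to be subtracted.\<close>
  have "fp_has f L (c * L powr \<delta>)"
  proof (cases "\<delta> > 0")
    case True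
    have "((\<lambda>\<epsilon>. c * L powr \<delta> - c * \<epsilon> powr \<delta>) \<longlongrightarrow> c * L powr \<delta> - c * 0) (at_right 0)"
    proof (intro tendsto_intros)
      have "\<forall>\<^sub>F \<epsilon> in at_right 0. (0 :: real) \<le> \<epsilon>"
        using eventually_at_right_less[of "0 :: real"] by eventually_elim simp
      then show "((\<lambda>\<epsilon>. \<epsilon> powr \<delta>) \<longlongrightarrow> 0) (at_right 0)"
        using True by (auto intro!: tendsto_eq_intros)
    qed
    from Lim_transform_eventually[OF this ev] show ?thesis
      unfolding fp_has_def I_def by (intro exI[of _ "[]"]) simp
  next
    case False
    have "\<forall>\<^sub>F \<epsilon> in at_right 0. c * L powr \<delta> = I \<epsilon> L - (\<Sum>(b, d)\<leftarrow>[(- \<delta>, - c)]. d * \<epsilon> powr (- b))"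
      using ev by eventually_elim simp
    from Lim_transform_eventually[OF tendsto_const this] show ?thesis
      unfolding fp_has_def I_def using False d by (intro exI[of _ "[(- \<delta>, - c)]"]) (auto simp: \<delta>_def)
  qed
  then show ?thesis by (rule that)
qed

subsection \<open>Lattice sums of compactly supported functions\<close>

definition lattice_sum :: "nat \<Rightarrow> real \<Rightarrow> (real \<times> real \<Rightarrow> real) \<Rightarrow> real" where
  "lattice_sum N h f = (\<Sum>(i, j)\<in>{- int N..int N} \<times> {- int N..int N} - {(0, 0)}. f (of_int i * h, of_int j * h))"

lemma int_bound_of_mult:
  assumes "h > 0" "\<bar>of_int i * h\<bar> < B" "B \<le> real N * h"
  shows "- int N < i" "i < int N"
proof -
  have "\<bar>of_int i\<bar> * h < B" using assms by (simp add: abs_mult)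
  then have "\<bar>of_int i\<bar> * h < real N * h" using assms(3) by linarith
  then have "real_of_int \<bar>i\<bar> < real_of_int (int N)" using assms by simp
  then have "\<bar>i\<bar> < int N" unfolding of_int_less_iff .
  then show "- int N < i" "i < int N" by auto
qed

text \<open>Once the box covers the support, the sum depends on \<open>h\<close> only. The index set
  \<open>T\<close> is left free because both the symmetric box of \<open>lattice_sum\<close> and the
  half-open one of the quadrature rule occur.\<close>

lemma sum_lattice_support:
  assumes h: "h > 0" and B: "B \<le> real N * h" and f: "\<And>u. B \<le> mnorm u \<Longrightarrow> f u = 0"
    and T: "finite T" "{- int N<..<int N} \<times> {- int N<..<int N} - {(0, 0)} \<subseteq> T" "(0, 0) \<in> T \<Longrightarrow> f (0, 0) = 0"
  shows "(\<Sum>(i, j)\<in>T. f (of_int i * h, of_int j * h)) =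
    (\<Sum>(i, j)\<in>{(i, j). mnorm (of_int i * h, of_int j * h) < B} - {(0, 0)}. f (of_int i * h, of_int j * h))"
proof (rule sum.mono_neutral_cong_right)
  show "{(i, j). mnorm (of_int i * h, of_int j * h) < B} - {(0, 0)} \<subseteq> T"
  proof (rule subset_trans[OF _ T(2)], rule subsetI)
    fix x assume x: "x \<in> {(i, j). mnorm (real_of_int i * h, real_of_int j * h) < B} - {(0, 0)}"
    then obtain i j where ij: "x = (i, j)" "mnorm (real_of_int i * h, real_of_int j * h) < B" by auto
    then have "\<bar>real_of_int i * h\<bar> < B" "\<bar>real_of_int j * h\<bar> < B" by (auto simp: mnorm_def)
    with int_bound_of_mult[OF h _ B] x ij
    show "x \<in> {- int N<..<int N} \<times> {- int N<..<int N} - {(0, 0)}" by auto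
  qed
  show "\<forall>x\<in>T - ({(i, j). mnorm (of_int i * h, of_int j * h) < B} - {(0, 0)}).
      (case x of (i, j) \<Rightarrow> f (of_int i * h, of_int j * h)) = 0"
    using f T(3) by (auto simp: not_less) (meson not_less)
qed (use T in auto)

lemma lattice_sum_support:
  assumes "h > 0" "B \<le> real N * h" "\<And>u. B \<le> mnorm u \<Longrightarrow> f u = 0"
  shows "lattice_sum N h f = (\<Sum>(i, j)\<in>{(i, j). mnorm (of_int i * h, of_int j * h) < B} - {(0, 0)}. f (of_int i * h, of_int j * h))"
  unfolding lattice_sum_def by (rule sum_lattice_support[OF assms]) auto

lemma lattice_sum_add: "lattice_sum N h (\<lambda>u. f u + g u) = lattice_sum N h f + lattice_sum N h g"
  by (simp add: lattice_sum_def sum.distrib split_beta)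

lemma lattice_sum_cmult: "lattice_sum N h (\<lambda>u. c * f u) = c * lattice_sum N h f"
  by (simp add: lattice_sum_def sum_distrib_left split_beta)

lemma lattice_sum_sum: "lattice_sum N h (\<lambda>u. \<Sum>k\<in>I. f k u) = (\<Sum>k\<in>I. lattice_sum N h (f k))"
  unfolding lattice_sum_def split_beta by (rule sum.swap)

lemma lattice_sum_cong:
  assumes "h > 0" and fg: "\<And>u. u \<noteq> (0, 0) \<Longrightarrow> f u = g u"
  shows "lattice_sum N h f = lattice_sum N h g"
  unfolding lattice_sum_def
proof (intro sum.cong refl)
  fix x assume "x \<in> {- int N..int N} \<times> {- int N..int N} - {(0, 0)}"
  then have "(of_int (fst x) * h, of_int (snd x) * h) \<noteq> (0, 0)" using assms(1) by (cases x) auto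
  from fg[OF this] show "(case x of (i, j) \<Rightarrow> f (of_int i * h, of_int j * h)) =
      (case x of (i, j) \<Rightarrow> g (of_int i * h, of_int j * h))" by (simp add: split_beta)
qed

lemma lattice_sum_scale: "lattice_sum N (t * h) f = lattice_sum N h (\<lambda>u. f (t *\<^sub>R u))"
  unfolding lattice_sum_def by (intro sum.cong) (auto simp: mult_ac)

lemma lattice_sum_odd:
  assumes "\<And>u. f (- u) = - f u"
  shows "lattice_sum N h f = 0"
proof -
  have "lattice_sum N h f = (\<Sum>(i, j)\<in>{- int N..int N} \<times> {- int N..int N} - {(0, 0)}. f (of_int (- i) * h, of_int (- j) * h))"
    unfolding lattice_sum_def
    by (rule sum.reindex_bij_witness[of _ "\<lambda>(i, j). (- i, - j)" "\<lambda>(i, j). (- i, - j)"]) auto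
  also have "\<dots> = - lattice_sum N h f"
    unfolding lattice_sum_def sum_negf[symmetric]
    by (intro sum.cong) (auto simp: assms[of "(_, _)", simplified])
  finally show ?thesis by simp
qed

lemma iter_zero_open:
  fixes f :: "real \<times> real \<Rightarrow> real"
  assumes "open U" "\<And>u. u \<in> U \<Longrightarrow> f u = 0"
  shows "u \<in> U \<Longrightarrow> (pu ^^ j) f u = 0 \<and> (pv ^^ j) f u = 0"
proof (induction j arbitrary: u)
  case (Suc j)
  have "pu ((pu ^^ j) f) u = pu (\<lambda>_. 0) u" "pv ((pv ^^ j) f) u = pv (\<lambda>_. 0) u"
    by (rule pu_cong_open[OF assms(1) Suc.prems], simp add: Suc.IH)
       (rule pv_cong_open[OF assms(1) Suc.prems], simp add: Suc.IH)
  then show ?case by simp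
qed (use assms in auto)

lemma integral_mnorm_support:
  fixes f :: "real \<times> real \<Rightarrow> real"
  assumes "\<And>u. B \<le> mnorm u \<Longrightarrow> f u = 0" "B \<le> A"
  shows "integral {u. mnorm u \<le> A} f = integral {u. mnorm u \<le> B} f"
  by (rule integral_spike_set) (use assms in \<open>auto intro!: negligible_subset[OF negligible_empty]\<close>)

text \<open>\<open>trapezoid_2d\<close> wants a mesh-aligned square of bounded size whose boundary
  avoids the support, whereas \<open>N\<close> is unbounded here; so the rule is applied with an
  auxiliary \<open>M\<close>, and the two sums are compared by support.\<close>

lemma trapezoid_compact:
  assumes K: "0 < K" and f: "kdiff_on UNIV (Suc K) f" and B: "B > 0" and z: "\<And>u. B \<le> mnorm u \<Longrightarrow> f u = 0" "f (0, 0) = 0"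
  obtains C where "\<And>h N. 0 < h \<Longrightarrow> h \<le> 1 \<Longrightarrow> B \<le> real N * h \<Longrightarrow>
    \<bar>h\<^sup>2 * lattice_sum N h f - integral {u. mnorm u \<le> B} f\<bar> \<le> C * h ^ K"
proof -
  let ?A = "2 * B + 1"
  have f': "kdiff_on {u. mnorm u < ?A + 1} (Suc K) f" by (rule kdiff_on_subset[OF f]) simp
  obtain C where C: "\<And>h N. 0 < h \<Longrightarrow> 0 < N \<Longrightarrow> real N * h \<le> ?A \<Longrightarrow> matched K (real N * h) f \<Longrightarrow>
    \<bar>h\<^sup>2 * (\<Sum>(i, j)\<in>{- int N..int N - 1} \<times> {- int N..int N - 1}. f (of_int i * h, of_int j * h))
      - integral {u. mnorm u \<le> real N * h} f\<bar> \<le> C * h ^ K"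
    using trapezoid_2d[OF K f', of ?A] by auto
  show ?thesis
  proof (rule that)
    fix h :: real and N :: nat assume h: "0 < h" "h \<le> 1" and N: "B \<le> real N * h"
    \<comment> \<open>The factor 2 puts the boundary into the open set where
      \<open>B < mnorm u\<close> and all derivatives vanish; h \<le> 1 keeps M h at most 2B +
      1.\<close>
    define M where "M = nat \<lceil>2 * B / h\<rceil>"
    have M1: "real M \<ge> 2 * B / h" unfolding M_def by linarith
    have M2: "real M \<le> 2 * B / h + 1" unfolding M_def using B h by simp
    have Mh: "2 * B \<le> real M * h" using M1 h by (simp add: field_simps)
    have MA: "real M * h \<le> ?A"
    proof -
      have "real M * h \<le> (2 * B / h + 1) * h" using M2 h by (intro mult_right_mono) auto
      also have "\<dots> = 2 * B + h" using h by (simp add: field_simps)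
      finally show ?thesis using h by simp
    qed
    have M0: "M > 0" using Mh B by (cases M) auto
    have out: "(pu ^^ j) f u = 0 \<and> (pv ^^ j) f u = 0" if "B < mnorm u" for j u
      by (rule iter_zero_open[of "{u. B < mnorm u}"]) (use that z in auto)
    have "matched K (real M * h) f"
      unfolding matched_def
    proof (intro allI impI ballI)
      fix j t assume "j < K" "t \<in> {- (real M * h)..real M * h}"
      have "B < real M * h" using Mh B by linarith
      then have "B < mnorm (real M * h, t)" "B < mnorm (- (real M * h), t)"
          "B < mnorm (t, real M * h)" "B < mnorm (t, - (real M * h))"
        by (auto simp: mnorm_def)
      then show "(pu ^^ j) f (real M * h, t) = (pu ^^ j) f (- (real M * h), t) \<and>
          (pv ^^ j) f (t, real M * h) = (pv ^^ j) f (t, - (real M * h))"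
        using out by simp
    qed
    from C[OF h(1) M0 MA this]
    have 1: "\<bar>h\<^sup>2 * (\<Sum>(i, j)\<in>{- int M..int M - 1} \<times> {- int M..int M - 1}. f (of_int i * h, of_int j * h))
      - integral {u. mnorm u \<le> real M * h} f\<bar> \<le> C * h ^ K" .
    have "integral {u. mnorm u \<le> real M * h} f = integral {u. mnorm u \<le> B} f"
      by (rule integral_mnorm_support) (use z Mh B in auto)
    moreover have "(\<Sum>(i, j)\<in>{- int M..int M - 1} \<times> {- int M..int M - 1}. f (of_int i * h, of_int j * h)) = lattice_sum N h f"
      by (rule trans[OF sum_lattice_support[where N = M and B = B] lattice_sum_support[OF h(1) N z(1), symmetric]])
         (use h z Mh B in auto)
    ultimately show "\<bar>h\<^sup>2 * lattice_sum N h f - integral {u. mnorm u \<le> B} f\<bar> \<le> C * h ^ K" using 1 by simp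
  qed
qed

text \<open>Repeated halving gives a Cauchy sequence from each \<open>h\<close>; the steps are of
  order h^(K+1) with a geometric factor, so the limit is approached at that order. That the limit
  does not depend on \<open>h\<close> uses arbitrary ratios \<open>t\<close>, not just 1/2.\<close>

lemma limit_of_dilation_cauchy:
  fixes A :: "real \<Rightarrow> real"
  assumes A: "\<And>t K. 0 < t \<Longrightarrow> t < 1 \<Longrightarrow> \<exists>C. \<forall>h. 0 < h \<longrightarrow> h \<le> 1 \<longrightarrow> \<bar>A (t * h) - A h\<bar> \<le> C * h ^ K"
  shows "\<exists>W. \<forall>K. \<exists>C. \<forall>h. 0 < h \<longrightarrow> h \<le> 1 \<longrightarrow> \<bar>A h - W\<bar> \<le> C * h ^ K"
proof -
  define a where "a h n = A ((1 / 2) ^ n * h)" for h :: real and n :: nat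
  have small: "0 < (1 / 2) ^ n * h" "(1 / 2) ^ n * h \<le> 1" if "0 < h" "h \<le> 1" for h :: real and n
    using that mult_le_one[of "(1 / 2) ^ n" h] by (auto simp: power_le_one)
  have step: "\<exists>C\<ge>0. \<forall>h n. 0 < h \<longrightarrow> h \<le> 1 \<longrightarrow> \<bar>a h (Suc n) - a h n\<bar> \<le> C * h ^ Suc K * (1 / 2) ^ n" for K
  proof -
    obtain C where C: "\<And>h. 0 < h \<Longrightarrow> h \<le> 1 \<Longrightarrow> \<bar>A (1 / 2 * h) - A h\<bar> \<le> C * h ^ Suc K"
      using A[of "1 / 2" "Suc K"] by auto
    have "\<bar>a h (Suc n) - a h n\<bar> \<le> \<bar>C\<bar> * h ^ Suc K * (1 / 2) ^ n" if h: "0 < h" "h \<le> 1" for h n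
    proof -
      have "\<bar>a h (Suc n) - a h n\<bar> \<le> C * ((1 / 2) ^ n * h) ^ Suc K"
        unfolding a_def using C[OF small[OF h, of n]] by (simp add: mult.assoc)
      also have "\<dots> \<le> \<bar>C\<bar> * ((1 / 2) ^ n * h) ^ Suc K"
        using h by (intro mult_right_mono) auto
      also have "((1 / 2) ^ n * h) ^ Suc K = h ^ Suc K * ((1 / 2) ^ n) ^ Suc K"
        by (simp only: power_mult_distrib mult.commute)
      \<comment> \<open>One factor (1/2)^n is kept for the summation over \<open>n\<close>; the
        order \<open>Suc K\<close> guarantees that there is one.\<close>
      also have "\<bar>C\<bar> * (h ^ Suc K * ((1 / 2) ^ n) ^ Suc K) \<le> \<bar>C\<bar> * (h ^ Suc K * ((1 / 2) ^ n) ^ 1)"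
        using h by (intro mult_left_mono power_decreasing) (auto simp: power_le_one)
      finally show ?thesis by (simp add: mult.assoc)
    qed
    then show ?thesis by (intro exI[of _ "\<bar>C\<bar>"]) auto
  qed
  have geo: "(\<Sum>i<n. (1 / 2 :: real) ^ i) \<le> 2" for n
    by (simp add: sum_gp_strict)
  have conv: "convergent (a h)" if h: "0 < h" "h \<le> 1" for h
  proof -
    obtain C where C: "\<And>h n. 0 < h \<Longrightarrow> h \<le> 1 \<Longrightarrow> \<bar>a h (Suc n) - a h n\<bar> \<le> C * h ^ Suc 0 * (1 / 2) ^ n"
      using step[of 0] by blast
    have "summable (\<lambda>n. a h (Suc n) - a h n)"
      by (rule summable_comparison_test'[of "\<lambda>n. C * h ^ Suc 0 * (1 / 2) ^ n" 0])
         (use C[OF h] in \<open>auto intro!: summable_mult summable_geometric\<close>)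
    then have "convergent (\<lambda>n. \<Sum>i<n. a h (Suc i) - a h i)" by (simp add: summable_iff_convergent)
    then have "convergent (\<lambda>n. a h n - a h 0)" by (simp add: sum_lessThan_telescope)
    then show ?thesis using convergent_diff_const_right_iff by blast
  qed
  define W where "W h = lim (a h)" for h
  have W: "a h \<longlonglongrightarrow> W h" if "0 < h" "h \<le> 1" for h
    using conv[OF that] unfolding W_def by (simp add: convergent_LIMSEQ_iff)
  have const: "W h = W 1" if h: "0 < h" "h \<le> 1" for h
  proof (cases "h = 1")
    case False
    \<comment> \<open>The roles are exchanged: \<open>h\<close> is the ratio and (1/2)^n the mesh
      size, so the two dyadic sequences approach each other.\<close>
    obtain C where C: "\<And>g. 0 < g \<Longrightarrow> g \<le> 1 \<Longrightarrow> \<bar>A (h * g) - A g\<bar> \<le> C * g ^ 1"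
      using A[of h 1] h False by auto
    have "(\<lambda>n. a h n - a 1 n) \<longlonglongrightarrow> 0"
    proof (rule Lim_null_comparison)
      show "\<forall>\<^sub>F n in sequentially. norm (a h n - a 1 n) \<le> C * (1 / 2) ^ n"
        using C[OF small[of 1]] by (intro always_eventually) (auto simp: a_def mult.commute)
      show "(\<lambda>n. C * (1 / 2 :: real) ^ n) \<longlonglongrightarrow> 0"
        by (auto intro!: tendsto_eq_intros LIMSEQ_power_zero)
    qed
    moreover have "(\<lambda>n. a h n - a 1 n) \<longlonglongrightarrow> W h - W 1"
      by (intro tendsto_diff W h) auto
    ultimately show ?thesis using LIMSEQ_unique by fastforce
  qed simp
  have main: "\<exists>C. \<forall>h. 0 < h \<longrightarrow> h \<le> 1 \<longrightarrow> \<bar>A h - W 1\<bar> \<le> C * h ^ Suc K" for K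
  proof -
    obtain C where C: "C \<ge> 0" "\<And>h n. 0 < h \<Longrightarrow> h \<le> 1 \<Longrightarrow> \<bar>a h (Suc n) - a h n\<bar> \<le> C * h ^ Suc K * (1 / 2) ^ n"
      using step[of K] by blast
    have "\<bar>A h - W 1\<bar> \<le> (2 * C) * h ^ Suc K" if h: "0 < h" "h \<le> 1" for h
    proof -
      have le: "\<bar>a h n - A h\<bar> \<le> (2 * C) * h ^ Suc K" for n
      proof -
        have "a h n - A h = (\<Sum>i<n. a h (Suc i) - a h i)"
          unfolding sum_lessThan_telescope by (simp add: a_def)
        also have "\<bar>\<dots>\<bar> \<le> (\<Sum>i<n. C * h ^ Suc K * (1 / 2) ^ i)"
          by (intro order_trans[OF sum_abs] sum_mono C h)
        also have "\<dots> = C * h ^ Suc K * (\<Sum>i<n. (1 / 2) ^ i)" by (simp add: sum_distrib_left)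
        also have "\<dots> \<le> C * h ^ Suc K * 2" using h C by (intro mult_left_mono geo) auto
        finally show ?thesis by (simp add: mult_ac)
      qed
      have "(\<lambda>n. \<bar>a h n - A h\<bar>) \<longlonglongrightarrow> \<bar>W h - A h\<bar>" by (intro tendsto_intros W h)
      then have "\<bar>W h - A h\<bar> \<le> (2 * C) * h ^ Suc K"
        by (rule LIMSEQ_le_const2) (use le in auto)
      then show ?thesis using const[OF h] by (simp add: abs_minus_commute)
    qed
    then show ?thesis by blast
  qed
  show ?thesis
  proof (rule exI[of _ "W 1"], rule allI)
    fix K :: nat
    obtain C where C: "\<And>h. 0 < h \<Longrightarrow> h \<le> 1 \<Longrightarrow> \<bar>A h - W 1\<bar> \<le> C * h ^ Suc K" using main[of K] by blast
    have "\<bar>A h - W 1\<bar> \<le> \<bar>C\<bar> * h ^ K" if h: "0 < h" "h \<le> 1" for h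
    proof -
      have "C * h ^ Suc K \<le> \<bar>C\<bar> * h ^ K"
        using h by (intro mult_mono power_decreasing) auto
      with C[OF h] show ?thesis by linarith
    qed
    then show "\<exists>C. \<forall>h. 0 < h \<longrightarrow> h \<le> 1 \<longrightarrow> \<bar>A h - W 1\<bar> \<le> C * h ^ K" by blast
  qed
qed

subsection \<open>Homogeneous singularities\<close>

lemma kdiff_on_extend_zero:
  assumes "kdiff_on (UNIV - {(0, 0)}) K g" "r > 0" "\<And>u. mnorm u < r \<Longrightarrow> g u = 0"
  shows "kdiff_on UNIV K g"
proof -
  interpret grading "{u. mnorm u < r}" "\<lambda>_ _. True" by (rule grading_trivial) simp
  have "kdiff_on {u. mnorm u < r} K g"
    by (rule graded_cong[OF _ graded_zero]) (use assms(3) in auto)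
  then have "kdiff_on ((UNIV - {(0, 0)}) \<union> {u. mnorm u < r}) K g" by (rule kdiff_on_Un[OF assms(1)])
  moreover have "(UNIV - {(0, 0)}) \<union> {u. mnorm u < r} = UNIV" using assms(2) by auto
  ultimately show ?thesis by simp
qed

lemma kdiff_on_continuous: "kdiff_on \<Omega> (Suc K) f \<Longrightarrow> S \<subseteq> \<Omega> \<Longrightarrow> continuous_on S f"
  unfolding kdiff_on_Suc by (intro continuous_at_imp_continuous_on ballI differentiable_imp_continuous_within) auto

lemma mon_scaleR: "mon k (t *\<^sub>R u) = t ^ (fst k + snd k) * mon k u"
  using mon_scale[of k t u] by (simp add: scaleR_prod_def)

lemma smooth_chi_scale: "smooth_on UNIV (\<lambda>u. chi (t *\<^sub>R u))"
  using smooth_scale[OF smooth_chi, of t] by (simp add: scaleR_prod_def)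

lemma mon_mult: "mon k u * mon l u = mon (fst k + fst l, snd k + snd l) u"
  by (cases k; cases l) (simp add: mon_def power_add mult_ac)

text \<open>The explicit lower bound, rather than mere positivity, is what controls negative powers
  of \<open>Q\<close> near the origin.\<close>

locale posquad =
  fixes Q :: "real \<times> real \<Rightarrow> real" and E F G c :: real
  assumes Q_eq: "\<And>u. Q u = E * fst u ^ 2 + 2 * F * fst u * snd u + G * snd u ^ 2"
    and c_pos: "c > 0" and Q_ge: "\<And>u. c * mnorm u ^ 2 \<le> Q u"
begin

lemma Q_smooth: "smooth_on UNIV Q"
  unfolding Q_eq[abs_def] by (intro smooth_intros)

lemma Q_pos: "u \<noteq> (0, 0) \<Longrightarrow> Q u > 0"
  using Q_ge[of u] mnorm_pos[of u] c_pos by (smt (verit) mult_pos_pos zero_less_power)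

lemma Q_scaleR: "Q (t *\<^sub>R u) = t ^ 2 * Q u"
  by (simp add: Q_eq power_mult_distrib algebra_simps power2_eq_square)

lemma Q_minus: "Q (- u) = Q u"
  using Q_scaleR[of "-1" u] by simp

definition hom :: "nat \<Rightarrow> nat \<times> nat \<Rightarrow> real \<times> real \<Rightarrow> real" where
  "hom s k u = mon k u / Q u powr (real s / 2)"

abbreviation dg :: "nat \<Rightarrow> nat \<times> nat \<Rightarrow> real" where
  "dg s k \<equiv> real (fst k + snd k) - real s"

lemma hom_scale:
  assumes "t > 0" "u \<noteq> (0, 0)"
  shows "hom s k (t *\<^sub>R u) = t powr dg s k * hom s k u"
proof -
  have "(t ^ 2 * Q u) powr (real s / 2) = t powr real s * Q u powr (real s / 2)"
  proof -
    have "(t ^ 2) powr (real s / 2) = (t powr 2) powr (real s / 2)" using assms by simp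
    also have "\<dots> = t powr real s" unfolding powr_powr by simp
    finally show ?thesis using assms Q_pos[of u] by (simp add: powr_mult)
  qed
  moreover have "t ^ (fst k + snd k) = t powr real (fst k + snd k)" using assms by (simp only: powr_realpow)
  ultimately show ?thesis
    using assms by (simp add: hom_def mon_scaleR Q_scaleR powr_diff del: of_nat_add)
qed

lemma hom_minus: "hom s k (- u) = (- 1) ^ (fst k + snd k) * hom s k u"
  using mon_scaleR[of k "- 1" u] by (simp add: hom_def Q_minus)

lemma hom_mon: "hom s k u * mon l u = hom s (fst k + fst l, snd k + snd l) u"
  by (simp add: hom_def mon_mult[symmetric])

lemma kdiff_on_Qpowr: "kdiff_on (UNIV - {(0, 0)}) K (\<lambda>u. Q u powr \<beta>)"
proof (rule kdiff_on_powr)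
  show "kdiff_on (UNIV - {(0, 0)}) K Q" for K
    using Q_smooth kdiff_on_subset[of UNIV K Q] by (auto simp: smooth_on_iff_kdiff_on)
qed (use Q_pos in \<open>auto simp: open_Diff\<close>)

lemma grading_off: "grading (UNIV - {(0, 0)}) (\<lambda>_ _. True)"
  by (rule grading_trivial) (simp add: open_Diff)

lemma smooth_kdiff_on_off: "smooth_on UNIV f \<Longrightarrow> kdiff_on (UNIV - {(0, 0)}) K f"
  using kdiff_on_subset[of UNIV K f] by (auto simp: smooth_on_iff_kdiff_on)

lemma kdiff_on_mult_off: "kdiff_on (UNIV - {(0, 0)}) K f \<Longrightarrow> kdiff_on (UNIV - {(0, 0)}) K g \<Longrightarrow> kdiff_on (UNIV - {(0, 0)}) K (\<lambda>u. f u * g u)"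
  using grading.graded_mult[OF grading_off, of K 0 f 0 g] by simp

lemma kdiff_on_hom: "kdiff_on (UNIV - {(0, 0)}) K (hom s k)"
proof -
  have "hom s k = (\<lambda>u. mon k u * Q u powr (- (real s / 2)))"
    by (simp add: fun_eq_iff hom_def powr_minus_divide)
  then show ?thesis using kdiff_on_mult_off[OF smooth_kdiff_on_off[OF smooth_mon] kdiff_on_Qpowr] by simp
qed

lemma continuous_hom: "continuous_on {u. u \<noteq> (0, 0)} (hom s k)"
  by (rule kdiff_on_continuous[OF kdiff_on_hom[of "Suc 0"]]) auto

lemma symbol_class_Q:
  assumes "\<delta> \<le> 1"
  shows "symbol_class \<delta> K 2 Q"
proof -
  interpret grading "punctured \<delta>" "power_bounded \<delta>" by (rule grading_power_bounded[OF assms])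
  have "C K (real 1) fst" "C K (real 1) snd"
    by (rule vanish_symbol_class[OF assms]; simp add: smooth_coords)+
  then have 1: "C K 1 fst" "C K 1 snd" by simp_all
  have "C K (1 + 1) (\<lambda>u. E * (fst u * fst u) + 2 * F * (fst u * snd u) + G * (snd u * snd u))"
    by (intro graded_add graded_cmult graded_mult 1)
  then show ?thesis
    using graded_cong[of "\<lambda>u. E * (fst u * fst u) + 2 * F * (fst u * snd u) + G * (snd u * snd u)" Q K 2]
    by (simp add: Q_eq power2_eq_square algebra_simps)
qed

text \<open>\<open>Q\<close> is comparable to the square of \<open>mnorm\<close>. Nonnegative
  exponents use the upper bound, negative ones the lower bound \<open>Q_ge\<close>; adding the two
  constants covers both cases.\<close>

lemma power_bounded_Qpowr:
  assumes "\<delta> \<le> 1"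
  shows "power_bounded \<delta> (2 * \<beta>) (\<lambda>u. Q u powr \<beta>)"
proof -
  interpret grading "punctured \<delta>" "power_bounded \<delta>" by (rule grading_power_bounded[OF assms])
  obtain M where M: "\<And>u. u \<in> punctured \<delta> \<Longrightarrow> \<bar>Q u\<bar> \<le> M * mnorm u powr 2"
    using graded_B[OF symbol_class_Q[OF assms, of 0]] unfolding power_bounded_def by blast
  have m2: "(mnorm u ^ 2) powr \<beta> = mnorm u powr (2 * \<beta>)" if "u \<in> punctured \<delta>" for u
    using that mnorm_pos[of u] by (simp add: punctured_def powr_powr flip: powr_numeral)
  have "\<bar>Q u powr \<beta>\<bar> \<le> (\<bar>M\<bar> powr \<beta> + c powr \<beta>) * mnorm u powr (2 * \<beta>)" if u: "u \<in> punctured \<delta>" for u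
  proof (cases "\<beta> \<ge> 0")
    case True
    have mp: "mnorm u > 0" using u mnorm_pos[of u] by (simp add: punctured_def)
    have "Q u \<le> \<bar>M\<bar> * mnorm u ^ 2"
      using M[OF u] mp abs_ge_self[of "Q u"] abs_ge_self[of M] mult_right_mono[of M "\<bar>M\<bar>" "mnorm u ^ 2"] by (simp add: powr_numeral)
    moreover have "Q u \<ge> 0" using Q_pos[of u] u by (simp add: punctured_def)
    ultimately have "Q u powr \<beta> \<le> (\<bar>M\<bar> * mnorm u ^ 2) powr \<beta>" by (intro powr_mono2 True) auto
    also have "\<dots> = \<bar>M\<bar> powr \<beta> * mnorm u powr (2 * \<beta>)" using m2[OF u] by (simp add: powr_mult)
    also have "\<dots> \<le> (\<bar>M\<bar> powr \<beta> + c powr \<beta>) * mnorm u powr (2 * \<beta>)" by (intro mult_right_mono) auto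
    finally show ?thesis by simp
  next
    case False
    have mp: "mnorm u > 0" using u mnorm_pos[of u] by (simp add: punctured_def)
    have "Q u powr \<beta> \<le> (c * mnorm u ^ 2) powr \<beta>"
      using False Q_ge[of u] by (intro powr_mono2' mult_pos_pos zero_less_power mp c_pos) auto
    also have "\<dots> = c powr \<beta> * mnorm u powr (2 * \<beta>)" using m2[OF u] c_pos by (simp add: powr_mult)
    also have "\<dots> \<le> (\<bar>M\<bar> powr \<beta> + c powr \<beta>) * mnorm u powr (2 * \<beta>)" by (intro mult_right_mono) auto
    finally show ?thesis by simp
  qed
  then show ?thesis unfolding power_bounded_def by blast
qed

lemma symbol_class_Qpowr:
  assumes "\<delta> \<le> 1"
  shows "symbol_class \<delta> K (2 * \<beta>) (\<lambda>u. Q u powr \<beta>)"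
  by (rule grading.graded_powr[OF grading_power_bounded[OF assms] symbol_class_Q[OF assms] _ power_bounded_Qpowr[OF assms]])
     (use Q_pos in \<open>auto simp: punctured_def\<close>)

lemma symbol_class_hom_mult:
  assumes "\<delta> \<le> 1" "symbol_class \<delta> K D f"
  shows "symbol_class \<delta> K (D - real s) (\<lambda>u. f u / Q u powr (real s / 2))"
  using grading.graded_mult[OF grading_power_bounded[OF assms(1)] assms(2) symbol_class_Qpowr[OF assms(1), of K "- (real s / 2)"]]
  by (simp add: powr_minus_divide)

text \<open>Degree -2 is the case in which the finite part would contain a logarithm. It forces i +
  j = s - 2, hence an odd total degree when \<open>s\<close> is odd.\<close>

lemma dg_ne: "odd s \<Longrightarrow> even (fst k + snd k) \<Longrightarrow> dg s k + 2 \<noteq> 0"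
proof
  assume "odd s" "even (fst k + snd k)" "dg s k + 2 = 0"
  then have "real (fst k + snd k + 2) = real s" by simp
  then have "fst k + snd k + 2 = s" unfolding of_nat_eq_iff .
  with \<open>odd s\<close> \<open>even (fst k + snd k)\<close> show False by auto
qed

text \<open>In even total degree the homogeneous function has a finite part by \<open>dg_ne\<close>,
  and the factor \<open>chi\<close> changes it by the integral of a function vanishing near the
  origin. Odd total degree, which includes the logarithmic case, is settled by reflection.\<close>

lemma fp_hom_chi:
  assumes "odd s"
  obtains x where "fp_has (\<lambda>u. hom s k u * chi u) 1 x" "odd (fst k + snd k) \<Longrightarrow> x = 0"
proof (cases "even (fst k + snd k)")
  case True
  obtain y where y: "fp_has (hom s k) 1 y"
    using fp_has_homogeneous[OF continuous_hom hom_scale dg_ne[OF assms True], of 1] by auto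
  have "kdiff_on UNIV (Suc 0) (\<lambda>u. hom s k u * (chi u - 1))"
    by (rule kdiff_on_extend_zero[of _ _ "1 / 5"])
       (use chi_one kdiff_on_mult_off[OF kdiff_on_hom smooth_kdiff_on_off[OF smooth_diff[OF smooth_chi smooth_const]]] in \<open>auto simp del: graded.simps\<close>)
  from kdiff_on_continuous[OF this] have cont: "continuous_on S (\<lambda>u. hom s k u * (chi u - 1))" for S by simp
  have "fp_has (\<lambda>u. hom s k u + hom s k u * (chi u - 1)) 1
      (y + integral {u. mnorm u \<le> 1} (\<lambda>u. hom s k u * (chi u - 1)))"
    by (intro fp_has_add y fp_has_continuous cont continuous_on_subset[OF continuous_hom]) auto
  then show ?thesis using that True by (simp add: algebra_simps)
next
  case False
  have "fp_has (\<lambda>u. hom s k u * chi u) 1 0"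
    by (rule fp_has_odd) (use False in \<open>simp add: hom_minus chi_minus\<close>)
  then show ?thesis using that by blast
qed

lemma continuous_hom_mult:
  assumes "smooth_on UNIV \<eta>"
  shows "continuous_on {u. u \<noteq> (0, 0) \<and> mnorm u \<le> L} (\<lambda>u. hom s k u * \<eta> u)"
  by (intro continuous_on_mult continuous_on_subset[OF continuous_hom] smooth_continuous[OF assms]) auto

text \<open>Dilating the lattice amounts to dilating the cutoff, and the difference of two cutoffs
  vanishes near the origin, so the trapezoidal rule sees a smooth function.\<close>

lemma hom_dilation_error:
  assumes s: "odd s" and x: "fp_has (\<lambda>u. hom s k u * chi u) 1 x" and t: "0 < t" "t < 1" and K: "0 < K"
  obtains C where "\<And>h N M. 0 < h \<Longrightarrow> h \<le> 1 \<Longrightarrow> 1 \<le> real N * (t * h) \<Longrightarrow> 1 \<le> real M * h \<Longrightarrow>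
    \<bar>t powr (- dg s k - 2) * ((t * h)\<^sup>2 * lattice_sum N (t * h) (\<lambda>u. hom s k u * chi u) - x)
      - (h\<^sup>2 * lattice_sum M h (\<lambda>u. hom s k u * chi u) - x)\<bar> \<le> C * h ^ K"
proof -
  let ?f = "\<lambda>u. hom s k u * chi u"
  let ?d = "dg s k"
  define D where "D u = hom s k u * (chi (t *\<^sub>R u) - chi u)" for u
  have kdiff_on: "kdiff_on UNIV K D" for K
  proof (rule kdiff_on_extend_zero[of _ _ "1 / 5"])
    show "kdiff_on (UNIV - {(0, 0)}) K D"
      unfolding D_def[abs_def]
      by (intro kdiff_on_mult_off kdiff_on_hom smooth_kdiff_on_off smooth_diff smooth_chi smooth_chi_scale)
    fix u assume u: "mnorm u < 1 / 5"
    have "mnorm (t *\<^sub>R u) \<le> 1 * mnorm u"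
      unfolding mnorm_scaleR using t by (intro mult_right_mono) auto
    then show "D u = 0" using u chi_one[of u] chi_one[of "t *\<^sub>R u"] by (simp add: D_def)
  qed simp
  have zf: "?f u = 0" if "1 \<le> mnorm u" for u using chi_zero[of u] that by simp
  have zD: "D u = 0" if "1 / t \<le> mnorm u" for u
  proof -
    have "1 \<le> mnorm (t *\<^sub>R u)" using that t by (simp add: mnorm_scaleR field_simps)
    moreover have "1 \<le> mnorm u" using that t by (smt (verit) le_divide_eq_1)
    ultimately show ?thesis using chi_zero[of u] chi_zero[of "t *\<^sub>R u"] by (simp add: D_def)
  qed
  have D0: "D (0, 0) = 0" by (simp add: D_def zero_prod_def[symmetric])
  obtain C where C: "\<And>h N. 0 < h \<Longrightarrow> h \<le> 1 \<Longrightarrow> 1 / t \<le> real N * h \<Longrightarrow>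
    \<bar>h\<^sup>2 * lattice_sum N h D - integral {u. mnorm u \<le> 1 / t} D\<bar> \<le> C * h ^ K"
    using trapezoid_compact[OF K kdiff_on, of "1 / t"] t zD D0 by (metis zero_less_divide_1_iff)
  have contD: "continuous_on S D" for S using kdiff_on_continuous[OF kdiff_on] by simp
  have ft: "?f (t *\<^sub>R u) = t powr ?d * (?f u + D u)" if "u \<noteq> (0, 0)" for u
    using hom_scale[OF t(1) that, of s k] by (simp add: D_def algebra_simps)
  \<comment> \<open>The finite part of the dilated function is computed once by scaling and once by
    splitting off \<open>D\<close>; uniqueness equates the two and gives the integral of
    \<open>D\<close> exactly.\<close>
  have fpD: "integral {u. mnorm u \<le> 1 / t} D = t powr (- ?d - 2) * x - x"
  proof -
    have "fp_has (\<lambda>u. ?f (t *\<^sub>R u)) (1 / t) (x / t\<^sup>2)" by (rule fp_has_scale[OF x t(1)])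
    from fp_has_cmult[OF this, of "t powr (- ?d)"]
    have "fp_has (\<lambda>u. ?f u + D u) (1 / t) (t powr (- ?d) * (x / t\<^sup>2))"
    proof (rule fp_has_cong)
      fix u :: "real \<times> real" assume "u \<noteq> (0, 0)"
      have "t powr (- ?d) * t powr ?d = 1" using t by (simp flip: powr_add)
      then show "t powr (- ?d) * ?f (t *\<^sub>R u) = ?f u + D u"
        unfolding ft[OF \<open>u \<noteq> (0, 0)\<close>] mult.assoc[symmetric] by (simp only: mult_1)
    qed
    moreover have "fp_has (\<lambda>u. ?f u + D u) (1 / t) (x + integral {u. mnorm u \<le> 1 / t} D)"
      using t by (intro fp_has_add fp_has_enlarge[OF x zf] fp_has_continuous contD continuous_hom_mult smooth_chi) auto
    ultimately have "t powr (- ?d) * (x / t\<^sup>2) = x + integral {u. mnorm u \<le> 1 / t} D"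
      by (rule fp_has_unique)
    moreover have "t powr (- ?d) * (x / t\<^sup>2) = t powr (- ?d - 2) * x"
      using t by (simp add: powr_diff powr_numeral)
    ultimately show ?thesis by simp
  qed
  show ?thesis
  proof (rule that)
    fix h :: real and N M :: nat
    assume h: "0 < h" "h \<le> 1" and N: "1 \<le> real N * (t * h)" and M: "1 \<le> real M * h"
    have Nh: "1 / t \<le> real N * h" using N t by (simp add: field_simps)
    then have N1: "1 \<le> real N * h" using t by (smt (verit) le_divide_eq_1)
    have "lattice_sum N (t * h) ?f = t powr ?d * (lattice_sum N h ?f + lattice_sum N h D)"
    proof -
      have "lattice_sum N h (\<lambda>u. ?f (t *\<^sub>R u)) = lattice_sum N h (\<lambda>u. t powr ?d * (?f u + D u))"
        by (rule lattice_sum_cong[OF h(1) ft])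
      then show ?thesis unfolding lattice_sum_scale by (simp only: lattice_sum_cmult lattice_sum_add)
    qed
    moreover have "lattice_sum N h ?f = lattice_sum M h ?f"
      using lattice_sum_support[OF h(1) N1 zf] lattice_sum_support[OF h(1) M zf] by simp
    moreover have "t powr (- ?d - 2) * (t * h)\<^sup>2 * t powr ?d = h\<^sup>2"
      using t by (simp add: powr_diff powr_minus powr_numeral power_mult_distrib)
    ultimately have "t powr (- ?d - 2) * ((t * h)\<^sup>2 * lattice_sum N (t * h) ?f - x) =
        h\<^sup>2 * (lattice_sum M h ?f + lattice_sum N h D) - t powr (- ?d - 2) * x"
      by (simp add: right_diff_distrib mult.assoc[symmetric])
    then have "t powr (- ?d - 2) * ((t * h)\<^sup>2 * lattice_sum N (t * h) ?f - x) - (h\<^sup>2 * lattice_sum M h ?f - x) =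
        h\<^sup>2 * lattice_sum N h D - integral {u. mnorm u \<le> 1 / t} D"
      by (simp add: fpD algebra_simps)
    then show "\<bar>t powr (- ?d - 2) * ((t * h)\<^sup>2 * lattice_sum N (t * h) ?f - x) - (h\<^sup>2 * lattice_sum M h ?f - x)\<bar> \<le> C * h ^ K"
      using C[OF h Nh] by simp
  qed
qed

text \<open>The error divided by h^\<delta> is, by \<open>hom_dilation_error\<close>, invariant
  under dilations up to arbitrarily high order in \<open>h\<close>; its limit is
  \<open>W\<close>.\<close>

lemma hom_error_unit:
  assumes s: "odd s" and x: "fp_has (\<lambda>u. hom s k u * chi u) 1 x"
  shows "\<exists>W. \<forall>K. \<exists>C. \<forall>h N. 0 < h \<longrightarrow> h \<le> 1 \<longrightarrow> 1 \<le> real N * h \<longrightarrow>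
    \<bar>h\<^sup>2 * lattice_sum N h (\<lambda>u. hom s k u * chi u) - x - h powr (dg s k + 2) * W\<bar> \<le> C * h ^ K"
proof -
  let ?f = "\<lambda>u. hom s k u * chi u"
  define \<delta> where "\<delta> = dg s k + 2"
  \<comment> \<open>Some box covering the support has to be fixed to make \<open>A\<close> a
    function of \<open>h\<close>; every other admissible box gives the same sum.\<close>
  define N where "N h = nat \<lceil>1 / h\<rceil>" for h :: real
  have N: "1 \<le> real (N h) * h" if "h > 0" for h
  proof -
    have "1 / h \<le> real (N h)" unfolding N_def by linarith
    then show ?thesis using that by (simp add: field_simps)
  qed
  have zf: "?f u = 0" if "1 \<le> mnorm u" for u using chi_zero[of u] that by simp
  define A where "A h = h powr (- \<delta>) * (h\<^sup>2 * lattice_sum (N h) h ?f - x)" for h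
  have dil: "\<exists>C. \<forall>h. 0 < h \<longrightarrow> h \<le> 1 \<longrightarrow> \<bar>A (t * h) - A h\<bar> \<le> C * h ^ K" if t: "0 < t" "t < 1" for t K
  proof -
    \<comment> \<open>Extra orders pay for the factor h^(-\<delta>) in \<open>A\<close>. When the
      estimate for \<open>A\<close> is converted back below, negative \<delta> is compensated in the
      same way.\<close>
    define K' where "K' = Suc (K + nat \<lceil>\<delta>\<rceil>)"
    have K': "real K \<le> real K' - \<delta>" unfolding K'_def by linarith
    obtain C where C: "\<And>h N M. 0 < h \<Longrightarrow> h \<le> 1 \<Longrightarrow> 1 \<le> real N * (t * h) \<Longrightarrow> 1 \<le> real M * h \<Longrightarrow>
      \<bar>t powr (- dg s k - 2) * ((t * h)\<^sup>2 * lattice_sum N (t * h) ?f - x) - (h\<^sup>2 * lattice_sum M h ?f - x)\<bar> \<le> C * h ^ K'"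
      using hom_dilation_error[OF s x t, of K'] by (auto simp: K'_def)
    have "\<bar>A (t * h) - A h\<bar> \<le> \<bar>C\<bar> * h ^ K" if h: "0 < h" "h \<le> 1" for h
    proof -
      have "A (t * h) - A h = h powr (- \<delta>) * (t powr (- dg s k - 2) * ((t * h)\<^sup>2 * lattice_sum (N (t * h)) (t * h) ?f - x) -
          (h\<^sup>2 * lattice_sum (N h) h ?f - x))"
      proof -
        have "- dg s k - 2 = - \<delta>" by (simp add: \<delta>_def)
        moreover have p: "(t * h) powr (- \<delta>) = t powr (- \<delta>) * h powr (- \<delta>)"
          using h t by (simp add: powr_mult)
        ultimately show ?thesis
          unfolding A_def p by (simp only: right_diff_distrib mult_ac)
      qed
      also have "\<bar>\<dots>\<bar> \<le> h powr (- \<delta>) * (C * h ^ K')"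
        unfolding abs_mult using C[OF h, of "N (t * h)" "N h"] N[of h] N[of "t * h"] h t
        by (intro mult_mono) auto
      also have "\<dots> \<le> \<bar>C\<bar> * h powr (real K' - \<delta>)"
      proof -
        have "h powr (- \<delta>) * (C * h ^ K') = C * h powr (real K' - \<delta>)"
          using h by (simp add: powr_diff powr_minus powr_realpow field_simps)
        then show ?thesis by (simp only:) (intro mult_right_mono; simp)
      qed
      also have "\<dots> \<le> \<bar>C\<bar> * h powr real K"
        using h K' by (intro mult_left_mono powr_mono') auto
      finally show ?thesis using h by (simp add: powr_realpow)
    qed
    then show ?thesis by blast
  qed
  have "\<exists>W. \<forall>K. \<exists>C. \<forall>h. 0 < h \<longrightarrow> h \<le> 1 \<longrightarrow> \<bar>A h - W\<bar> \<le> C * h ^ K"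
    by (rule limit_of_dilation_cauchy) (rule dil)
  then obtain W where W: "\<forall>K. \<exists>C. \<forall>h. 0 < h \<longrightarrow> h \<le> 1 \<longrightarrow> \<bar>A h - W\<bar> \<le> C * h ^ K"
    by (elim exE)
  have fin: "\<exists>C. \<forall>h N. 0 < h \<longrightarrow> h \<le> 1 \<longrightarrow> 1 \<le> real N * h \<longrightarrow>
    \<bar>h\<^sup>2 * lattice_sum N h ?f - x - h powr \<delta> * W\<bar> \<le> C * h ^ K" for K
  proof -
    define K' where "K' = K + nat \<lceil>- \<delta>\<rceil>"
    have K': "real K \<le> real K' + \<delta>" unfolding K'_def by linarith
    obtain C where C: "\<And>h. 0 < h \<Longrightarrow> h \<le> 1 \<Longrightarrow> \<bar>A h - W\<bar> \<le> C * h ^ K'" using W[rule_format, of K'] by blast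
    have "\<bar>h\<^sup>2 * lattice_sum n h ?f - x - h powr \<delta> * W\<bar> \<le> \<bar>C\<bar> * h ^ K"
      if h: "0 < h" "h \<le> 1" and n: "1 \<le> real n * h" for h n
    proof -
      have "lattice_sum n h ?f = lattice_sum (N h) h ?f"
        using lattice_sum_support[OF h(1) n zf] lattice_sum_support[OF h(1) N[OF h(1)] zf] by simp
      then have "h\<^sup>2 * lattice_sum n h ?f - x - h powr \<delta> * W = h powr \<delta> * (A h - W)"
        using h by (simp add: A_def right_diff_distrib mult.assoc[symmetric] powr_add[symmetric])
      also have "\<bar>\<dots>\<bar> \<le> h powr \<delta> * (C * h ^ K')"
        unfolding abs_mult using C[OF h] by (intro mult_mono) auto
      also have "\<dots> \<le> \<bar>C\<bar> * h powr (real K' + \<delta>)"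
      proof -
        have "h powr \<delta> * (C * h ^ K') = C * h powr (real K' + \<delta>)"
          using h by (simp add: powr_add powr_realpow mult_ac)
        then show ?thesis by (simp only:) (intro mult_right_mono; simp)
      qed
      also have "\<dots> \<le> \<bar>C\<bar> * h powr real K"
        using h K' by (intro mult_left_mono powr_mono') auto
      finally show ?thesis using h by (simp add: powr_realpow)
    qed
    then show ?thesis by blast
  qed
  show ?thesis unfolding \<delta>_def[symmetric] by (rule exI[of _ W], rule allI, rule fin)
qed

text \<open>In even total degree the constant is whatever the Cauchy argument yields. In odd total
  degree the value 0 is fixed outright, as sum and finite part both vanish by reflection.\<close>

definition lattice_const :: "nat \<Rightarrow> nat \<times> nat \<Rightarrow> real" where
  "lattice_const s k = (if odd (fst k + snd k) then 0 else
    (SOME W. \<forall>K. \<exists>C. \<forall>h N. 0 < h \<longrightarrow> h \<le> 1 \<longrightarrow> 1 \<le> real N * h \<longrightarrow>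
    \<bar>h\<^sup>2 * lattice_sum N h (\<lambda>u. hom s k u * chi u) - fp_integral (\<lambda>u. hom s k u * chi u) 1
      - h powr (dg s k + 2) * W\<bar> \<le> C * h ^ K))"

lemma lattice_const_unit:
  assumes s: "odd s" and x: "fp_has (\<lambda>u. hom s k u * chi u) 1 x"
  shows "\<exists>C. \<forall>h N. 0 < h \<longrightarrow> h \<le> 1 \<longrightarrow> 1 \<le> real N * h \<longrightarrow>
    \<bar>h\<^sup>2 * lattice_sum N h (\<lambda>u. hom s k u * chi u) - x - h powr (dg s k + 2) * lattice_const s k\<bar> \<le> C * h ^ K"
proof (cases "odd (fst k + snd k)")
  case True
  have odd: "hom s k (- u) * chi (- u) = - (hom s k u * chi u)" for u
    using True by (simp add: hom_minus chi_minus)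
  have "x = 0" using fp_has_unique[OF x fp_has_odd] odd by blast
  moreover have "lattice_sum N h (\<lambda>u. hom s k u * chi u) = 0" for N h by (rule lattice_sum_odd) (rule odd)
  ultimately show ?thesis using True by (auto simp: lattice_const_def intro!: exI[of _ 0])
next
  case False
  have "\<forall>K. \<exists>C. \<forall>h N. 0 < h \<longrightarrow> h \<le> 1 \<longrightarrow> 1 \<le> real N * h \<longrightarrow>
    \<bar>h\<^sup>2 * lattice_sum N h (\<lambda>u. hom s k u * chi u) - fp_integral (\<lambda>u. hom s k u * chi u) 1
      - h powr (dg s k + 2) * lattice_const s k\<bar> \<le> C * h ^ K"
    unfolding lattice_const_def using False someI_ex[OF hom_error_unit[OF s x]]
    by (simp only: fp_integral_eq[OF x] if_False simp_thms)
  then show ?thesis by (simp add: fp_integral_eq[OF x])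
qed

lemma lattice_const_odd: "odd (fst k + snd k) \<Longrightarrow> lattice_const s k = 0"
  by (simp add: lattice_const_def)

text \<open>With \<delta> = \<open>dg s k + 2\<close>, passing to the cutoff of size
  \<open>B\<close> multiplies the error by B^\<delta> and replaces h by h/B, so h^\<delta> and its
  constant stay the same.\<close>

lemma lattice_const_error:
  assumes s: "odd s" and B: "B > 0"
  shows "\<exists>x. fp_has (\<lambda>u. hom s k u * chi ((1 / B) *\<^sub>R u)) B x \<and>
    (\<forall>K. \<exists>C. \<forall>h N. 0 < h \<longrightarrow> h \<le> B \<longrightarrow> B \<le> real N * h \<longrightarrow>
      \<bar>h\<^sup>2 * lattice_sum N h (\<lambda>u. hom s k u * chi ((1 / B) *\<^sub>R u)) - x - h powr (dg s k + 2) * lattice_const s k\<bar> \<le> C * h ^ K)"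
proof -
  let ?f = "\<lambda>u. hom s k u * chi u" and ?fB = "\<lambda>u. hom s k u * chi ((1 / B) *\<^sub>R u)"
  let ?d = "dg s k"
  obtain x where x: "fp_has ?f 1 x" using fp_hom_chi[OF s, of k] by blast
  have fB: "B powr ?d * ?f ((1 / B) *\<^sub>R u) = ?fB u" if "u \<noteq> (0, 0)" for u
    using hom_scale[of "1 / B" u s k] that B by (simp add: powr_divide)
  have "fp_has (\<lambda>u. ?f ((1 / B) *\<^sub>R u)) (1 / (1 / B)) (x / (1 / B)\<^sup>2)"
    by (rule fp_has_scale[OF x]) (use B in simp)
  from fp_has_cong[OF fp_has_cmult[OF this, of "B powr ?d"] fB]
  have "fp_has ?fB (1 / (1 / B)) (B powr ?d * (x / (1 / B)\<^sup>2))" .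
  moreover have "B powr ?d * (x / (1 / B)\<^sup>2) = B powr (?d + 2) * x"
    unfolding powr_add using B by (simp add: powr_numeral power_divide)
  ultimately have 1: "fp_has ?fB B (B powr (?d + 2) * x)" by simp
  show ?thesis
  proof (rule exI, rule conjI[OF 1], rule allI)
    fix K
    obtain C where C: "\<And>h N. 0 < h \<Longrightarrow> h \<le> 1 \<Longrightarrow> 1 \<le> real N * h \<Longrightarrow>
      \<bar>h\<^sup>2 * lattice_sum N h ?f - x - h powr (?d + 2) * lattice_const s k\<bar> \<le> C * h ^ K"
      using lattice_const_unit[OF s x] by blast
    have "\<bar>h\<^sup>2 * lattice_sum N h ?fB - B powr (?d + 2) * x - h powr (?d + 2) * lattice_const s k\<bar> \<le>
       (B powr (?d + 2) * C / B ^ K) * h ^ K" if h: "0 < h" "h \<le> B" "B \<le> real N * h" for h N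
    proof -
      have L: "lattice_sum N h ?fB = B powr ?d * lattice_sum N (h / B) ?f"
      proof -
        have "lattice_sum N h ?fB = lattice_sum N h (\<lambda>u. B powr ?d * ?f ((1 / B) *\<^sub>R u))"
          by (rule lattice_sum_cong[OF h(1)]) (rule fB[symmetric])
        then show ?thesis using lattice_sum_scale[of N "1 / B" h ?f] by (simp add: lattice_sum_cmult)
      qed
      have e: "B powr (?d + 2) * (h / B)\<^sup>2 = B powr ?d * h\<^sup>2" "B powr (?d + 2) * (h / B) powr (?d + 2) = h powr (?d + 2)"
        using B h by (simp_all add: powr_add powr_numeral power_divide powr_divide)
      have "h\<^sup>2 * lattice_sum N h ?fB - B powr (?d + 2) * x - h powr (?d + 2) * lattice_const s k =
         B powr (?d + 2) * ((h / B)\<^sup>2 * lattice_sum N (h / B) ?f - x - (h / B) powr (?d + 2) * lattice_const s k)"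
        unfolding L right_diff_distrib mult.assoc[symmetric] e by (simp add: mult_ac)
      also have "\<bar>\<dots>\<bar> \<le> B powr (?d + 2) * (C * (h / B) ^ K)"
        unfolding abs_mult using C[of "h / B" N] h B by (intro mult_mono) (auto simp: field_simps)
      finally show ?thesis by (simp add: power_divide)
    qed
    then show "\<exists>C. \<forall>h N. 0 < h \<longrightarrow> h \<le> B \<longrightarrow> B \<le> real N * h \<longrightarrow>
      \<bar>h\<^sup>2 * lattice_sum N h ?fB - B powr (?d + 2) * x - h powr (?d + 2) * lattice_const s k\<bar> \<le> C * h ^ K" by blast
  qed
qed

end

section \<open>The constants of the homogeneous terms as Wigner limits\<close>

lemma filterlim_abs_at_right: "filterlim (\<lambda>x. \<bar>x\<bar>) (at_right 0) (at (0 :: real))"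
proof -
  have "((\<lambda>x. \<bar>x\<bar>) \<longlongrightarrow> 0) (at (0 :: real))" by (auto intro!: tendsto_eq_intros)
  moreover have "\<forall>\<^sub>F x in at (0 :: real). \<bar>x\<bar> \<in> {0<..} \<and> \<bar>x\<bar> \<noteq> 0"
    by (auto simp: eventually_at_filter)
  ultimately show ?thesis unfolding filterlim_at by blast
qed

lemma bounded_mnorm:
  assumes "bounded S"
  obtains B where "B > 0" "\<And>u. u \<in> S \<Longrightarrow> mnorm u < B"
proof -
  obtain B where B: "B > 0" "\<And>u. u \<in> S \<Longrightarrow> norm u \<le> B" using assms by (auto simp: bounded_pos)
  show ?thesis
  proof (rule that[of "B + 1"])
    fix u assume u: "u \<in> S"
    have "mnorm u \<le> norm u"
      unfolding mnorm_def using norm_fst_le[of "fst u" "snd u"] norm_snd_le[of "snd u" "fst u"] by auto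
    then show "mnorm u < B + 1" using B(2)[OF u] by linarith
  qed (use B in simp)
qed

lemma symbol_class_mon:
  assumes "\<delta> \<le> 1"
  shows "symbol_class \<delta> K (real (fst k + snd k)) (mon k)"
proof -
  interpret grading "punctured \<delta>" "power_bounded \<delta>" by (rule grading_power_bounded[OF assms])
  have "C K (real 1) fst" "C K (real 1) snd"
    by (rule vanish_symbol_class[OF assms]; simp add: smooth_coords)+
  then have "C K (real (fst k) * 1 + real (snd k) * 1) (\<lambda>u. fst u ^ fst k * snd u ^ snd k)"
    by (intro graded_mult graded_power) simp_all
  then show ?thesis by (simp add: mon_def split_beta)
qed

context posquad
begin

text \<open>A Taylor term of \<open>\<eta>\<close> of degree \<open>n\<close> enters with an additional factor \<open>h\<^bsup>n\<^esup>\<close>, so only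
  \<open>\<eta> (0, 0) = 1\<close> survives in the limit.\<close>

lemma hom_eta_limit:
  assumes s: "odd s" and \<eta>: "smooth_on UNIV \<eta>" "\<eta> (0, 0) = 1" and B: "B \<ge> 1"
    and z: "\<And>u. B \<le> mnorm u \<Longrightarrow> \<eta> u = 0"
  obtains x where "fp_has (\<lambda>u. hom s k u * \<eta> u) B x"
    "((\<lambda>h. h powr (- (dg s k + 2)) * (h\<^sup>2 * lattice_sum (nat \<lceil>B / h\<rceil>) h (\<lambda>u. hom s k u * \<eta> u) - x))
        \<longlongrightarrow> lattice_const s k) (at_right 0)"
proof -
  define \<delta> where "\<delta> = dg s k + 2"
  \<comment> \<open>Orders are chosen backwards: h^(K1 - \<delta>) must be at most h, and the Taylor
    remainder of \<eta> times \<open>hom s k\<close>, of degree n + \<open>dg s k\<close>, must be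
    K1 + 1 times differentiable at the origin.\<close>
  define K1 where "K1 = Suc (nat \<lceil>\<delta>\<rceil>)"
  have K1: "K1 > 0" "real K1 \<ge> \<delta> + 1" unfolding K1_def by (simp, linarith)
  define n where "n = Suc (nat \<lceil>real (Suc K1) - dg s k\<rceil>)"
  have n: "n > 0" "real n + dg s k > real (Suc K1)" unfolding n_def by (simp, linarith)
  obtain M0 where M0: "\<And>u. mnorm u \<le> 1 \<Longrightarrow> \<bar>\<eta> u\<bar> \<le> M0 * mnorm u ^ 0"
    using vanish_bound[OF \<eta>(1), of 0 1] by auto
  obtain R\<eta> where R\<eta>: "smooth_on UNIV R\<eta>" "vanish n R\<eta>"
      "\<And>u. \<eta> u = (\<Sum>l\<in>low_degrees n - low_degrees 0. tcoeff \<eta> l * mon l u) + R\<eta> u"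
  proof (rule taylor_expansion[OF \<eta>(1), of 1 M0 0 n])
    show "\<bar>\<eta> u\<bar> \<le> M0 * mnorm u ^ 0" if "mnorm u < 1" for u using M0[of u] that by simp
  qed auto
  have idx0: "low_degrees n - low_degrees 0 = low_degrees n" by (simp add: low_degrees_def)
  define ad where "ad l = (fst k + fst l, snd k + snd l)" for l :: "nat \<times> nat"
  define tm where "tm l u = hom s (ad l) u * chi ((1 / B) *\<^sub>R u)" for l u
  define R where "R u = hom s k u * \<eta> u - (\<Sum>l\<in>low_degrees n. tcoeff \<eta> l * tm l u)" for u
  define R0 where "R0 = R((0, 0) := 0)"
  interpret off: grading "UNIV - {(0, 0)}" "\<lambda>_ _. True" by (rule grading_off)
  have R_off: "kdiff_on (UNIV - {(0, 0)}) (Suc K1) R"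
    unfolding R_def[abs_def] tm_def
    by (intro off.graded_diff off.graded_sum off.graded_cmult kdiff_on_mult_off kdiff_on_hom smooth_kdiff_on_off \<eta> smooth_chi_scale) simp
  have 1: "kdiff_on (UNIV - {(0, 0)}) (Suc K1) R0"
    by (rule off.graded_cong[OF _ R_off]) (simp add: R0_def)
  \<comment> \<open>On this square the cutoff of size \<open>B\<close> is 1, so the cut-off terms
    agree with the bare homogeneous ones.\<close>
  define d0 where "d0 = min 1 (B / 5)"
  have d0: "d0 > 0" "d0 \<le> 1" using B by (auto simp: d0_def)
  interpret gb: grading "punctured d0" "power_bounded d0" by (rule grading_power_bounded[OF d0(2)])
  have "symbol_class d0 (Suc K1) (real (fst k + snd k) + real n) (\<lambda>u. mon k u * R\<eta> u)"
    by (intro gb.graded_mult symbol_class_mon vanish_symbol_class d0 R\<eta>)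
  from symbol_class_hom_mult[OF d0(2) this, of s]
  have "symbol_class d0 (Suc K1) (real (fst k + snd k) + real n - real s) R"
  proof (rule gb.graded_cong[rotated])
    fix u assume u: "u \<in> punctured d0"
    have "mnorm ((1 / B) *\<^sub>R u) \<le> 1 / 5"
      using u B by (simp add: mnorm_scaleR punctured_def d0_def field_simps)
    then have "tm l u = hom s k u * mon l u" for l
      using chi_one by (simp add: tm_def ad_def hom_mon)
    then have "R u = hom s k u * (\<eta> u - (\<Sum>l\<in>low_degrees n. tcoeff \<eta> l * mon l u))"
      by (simp add: R_def right_diff_distrib sum_distrib_left mult_ac)
    also have "\<dots> = hom s k u * R\<eta> u" using R\<eta>(3)[of u] by (simp add: idx0)
    finally show "mon k u * R\<eta> u / Q u powr (real s / 2) = R u" by (simp add: hom_def)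
  qed
  from symbol_class_extend[OF d0(1) this] n(2) have "kdiff_on {u. mnorm u < d0} (Suc K1) R0"
    unfolding R0_def by (simp del: graded.simps fun_upd_apply)
  from kdiff_on_Un[OF 1 this] have "kdiff_on ((UNIV - {(0, 0)}) \<union> {u. mnorm u < d0}) (Suc K1) R0" .
  moreover have "(UNIV - {(0, 0)}) \<union> {u. mnorm u < d0} = UNIV" using d0 by auto
  ultimately have DkR: "kdiff_on UNIV (Suc K1) R0" by simp
  have Bpos: "B > 0" using B by simp
  have chiz: "chi ((1 / B) *\<^sub>R u) = 0" if "B \<le> mnorm u" for u
    using that Bpos by (intro chi_zero) (simp add: mnorm_scaleR field_simps)
  have R0z: "R0 u = 0" if "B \<le> mnorm u" for u
    using z[OF that] chiz[OF that] by (simp add: R0_def R_def tm_def)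
  obtain C where C: "\<And>h N. 0 < h \<Longrightarrow> h \<le> 1 \<Longrightarrow> B \<le> real N * h \<Longrightarrow>
      \<bar>h\<^sup>2 * lattice_sum N h R0 - integral {u. mnorm u \<le> B} R0\<bar> \<le> C * h ^ K1"
  proof (rule trapezoid_compact[OF K1(1) DkR Bpos R0z])
    show "R0 (0, 0) = 0" by (simp add: R0_def)
    fix C assume "\<And>h N. 0 < h \<Longrightarrow> h \<le> 1 \<Longrightarrow> B \<le> real N * h \<Longrightarrow>
      \<bar>h\<^sup>2 * lattice_sum N h R0 - integral {u. mnorm u \<le> B} R0\<bar> \<le> C * h ^ K1"
    then show thesis by (rule that)
  qed
  have "\<forall>l. \<exists>x. fp_has (tm l) B x \<and> (\<exists>C. \<forall>h N. 0 < h \<longrightarrow> h \<le> B \<longrightarrow> B \<le> real N * h \<longrightarrow>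
      \<bar>h\<^sup>2 * lattice_sum N h (tm l) - x - h powr (dg s (ad l) + 2) * lattice_const s (ad l)\<bar> \<le> C * h ^ K1)"
  proof
    fix l
    have "\<exists>x. fp_has (tm l) B x \<and> (\<forall>K. \<exists>C. \<forall>h N. 0 < h \<longrightarrow> h \<le> B \<longrightarrow> B \<le> real N * h \<longrightarrow>
      \<bar>h\<^sup>2 * lattice_sum N h (tm l) - x - h powr (dg s (ad l) + 2) * lattice_const s (ad l)\<bar> \<le> C * h ^ K)"
      using lattice_const_error[OF s Bpos, of "ad l"] unfolding tm_def .
    then obtain x where x: "fp_has (tm l) B x" "\<forall>K. \<exists>C. \<forall>h N. 0 < h \<longrightarrow> h \<le> B \<longrightarrow> B \<le> real N * h \<longrightarrow>
      \<bar>h\<^sup>2 * lattice_sum N h (tm l) - x - h powr (dg s (ad l) + 2) * lattice_const s (ad l)\<bar> \<le> C * h ^ K"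
      by (elim exE conjE)
    show "\<exists>x. fp_has (tm l) B x \<and> (\<exists>C. \<forall>h N. 0 < h \<longrightarrow> h \<le> B \<longrightarrow> B \<le> real N * h \<longrightarrow>
      \<bar>h\<^sup>2 * lattice_sum N h (tm l) - x - h powr (dg s (ad l) + 2) * lattice_const s (ad l)\<bar> \<le> C * h ^ K1)"
      by (rule exI[of _ x], rule conjI[OF x(1)], rule spec[OF x(2)])
  qed
  from choice[OF this] obtain X where X: "\<forall>l. fp_has (tm l) B (X l) \<and> (\<exists>C. \<forall>h N. 0 < h \<longrightarrow> h \<le> B \<longrightarrow> B \<le> real N * h \<longrightarrow>
      \<bar>h\<^sup>2 * lattice_sum N h (tm l) - X l - h powr (dg s (ad l) + 2) * lattice_const s (ad l)\<bar> \<le> C * h ^ K1)"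
    by (elim exE)
  then have "\<forall>l. \<exists>C. \<forall>h N. 0 < h \<longrightarrow> h \<le> B \<longrightarrow> B \<le> real N * h \<longrightarrow>
      \<bar>h\<^sup>2 * lattice_sum N h (tm l) - X l - h powr (dg s (ad l) + 2) * lattice_const s (ad l)\<bar> \<le> C * h ^ K1"
    by (intro allI, elim allE conjE)
  from choice[OF this] obtain CC where CC: "\<forall>l h N. 0 < h \<longrightarrow> h \<le> B \<longrightarrow> B \<le> real N * h \<longrightarrow>
      \<bar>h\<^sup>2 * lattice_sum N h (tm l) - X l - h powr (dg s (ad l) + 2) * lattice_const s (ad l)\<bar> \<le> CC l * h ^ K1"
    by (elim exE)
  note X = X[rule_format, THEN conjunct1] and CC = CC[rule_format]
  define x where "x = (\<Sum>l\<in>low_degrees n. tcoeff \<eta> l * X l) + integral {u. mnorm u \<le> B} R0"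
  have eq: "hom s k u * \<eta> u = (\<Sum>l\<in>low_degrees n. tcoeff \<eta> l * tm l u) + R0 u" if "u \<noteq> (0, 0)" for u
    using that by (simp add: R0_def R_def)
  have contm: "continuous_on {u. u \<noteq> (0, 0) \<and> mnorm u \<le> B} (tm l)" for l
    unfolding tm_def by (rule continuous_hom_mult[OF smooth_chi_scale])
  have contR: "continuous_on S R0" for S using kdiff_on_continuous[OF DkR] by simp
  have fp: "fp_has (\<lambda>u. hom s k u * \<eta> u) B x"
  proof (rule fp_has_cong)
    show "fp_has (\<lambda>u. (\<Sum>l\<in>low_degrees n. tcoeff \<eta> l * tm l u) + R0 u) B x"
      unfolding x_def
      by (intro fp_has_add fp_has_sum fp_has_cmult X fp_has_continuous contR Bpos continuous_intros contm) auto
  qed (use eq in auto)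
  define N where "N h = nat \<lceil>B / h\<rceil>" for h :: real
  have N: "B \<le> real (N h) * h" if "h > 0" for h
  proof -
    have "B / h \<le> real (N h)" unfolding N_def by linarith
    then show ?thesis using that by (simp add: field_simps)
  qed
  have small: "h powr (- \<delta>) * h ^ K1 \<le> h" if "0 < h" "h \<le> 1" for h
  proof -
    have "h powr (- \<delta>) * h ^ K1 = h powr (real K1 - \<delta>)"
      using that by (simp add: powr_diff powr_minus powr_realpow field_simps)
    also have "\<dots> \<le> h powr 1" using that K1 by (intro powr_mono') auto
    finally show ?thesis using that by simp
  qed
  have tend: "(f \<longlongrightarrow> 0) (at_right 0)" if "\<And>h. 0 < h \<Longrightarrow> h \<le> 1 \<Longrightarrow> \<bar>f h\<bar> \<le> h powr (- \<delta>) * (C' * h ^ K1)"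
    for f :: "real \<Rightarrow> real" and C'
  proof (rule Lim_null_comparison)
    show "((\<lambda>h. \<bar>C'\<bar> * h) \<longlongrightarrow> 0) (at_right (0 :: real))" by (auto intro!: tendsto_eq_intros)
    show "\<forall>\<^sub>F h in at_right 0. norm (f h) \<le> \<bar>C'\<bar> * h"
      unfolding eventually_at_right_field
    proof (intro exI[of _ 1] conjI allI impI)
      fix h :: real assume h: "0 < h" "h < 1"
      have "\<bar>f h\<bar> \<le> C' * (h powr (- \<delta>) * h ^ K1)" using that[of h] h by (simp add: mult_ac)
      also have "\<dots> \<le> \<bar>C'\<bar> * h" using small[of h] h by (intro mult_mono) auto
      finally show "norm (f h) \<le> \<bar>C'\<bar> * h" by simp
    qed simp
  qed
  define e where "e h = h powr (- \<delta>) * (h\<^sup>2 * lattice_sum (N h) h R0 - integral {u. mnorm u \<le> B} R0)" for h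
  define el where "el l h = h powr (- \<delta>) * (h\<^sup>2 * lattice_sum (N h) h (tm l) - X l - h powr (dg s (ad l) + 2) * lattice_const s (ad l))" for l h
  have e: "(e \<longlongrightarrow> 0) (at_right 0)"
  proof (rule tend)
    fix h :: real assume h: "0 < h" "h \<le> 1"
    show "\<bar>e h\<bar> \<le> h powr (- \<delta>) * (C * h ^ K1)"
      unfolding e_def abs_mult using C[OF h N[OF h(1)]] by (intro mult_mono) auto
  qed
  have el: "(el l \<longlongrightarrow> 0) (at_right 0)" for l
  proof (rule tend)
    fix h :: real assume h: "0 < h" "h \<le> 1"
    then have "h \<le> B" using B by simp
    then show "\<bar>el l h\<bar> \<le> h powr (- \<delta>) * (CC l * h ^ K1)"
      unfolding el_def abs_mult using CC[OF h(1) _ N[OF h(1)], of l] by (intro mult_mono) auto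
  qed
  have "((\<lambda>h. (\<Sum>l\<in>low_degrees n. tcoeff \<eta> l * (h ^ (fst l + snd l) * lattice_const s (ad l) + el l h)) + e h)
      \<longlongrightarrow> (\<Sum>l\<in>low_degrees n. tcoeff \<eta> l * (0 ^ (fst l + snd l) * lattice_const s (ad l) + 0)) + 0) (at_right 0)"
    by (intro tendsto_intros e el)
  \<comment> \<open>Since 0^0 = 1, the powers of \<open>h\<close> evaluated at 0 single out the
    index (0, 0).\<close>
  moreover have "(\<Sum>l\<in>low_degrees n. tcoeff \<eta> l * (0 ^ (fst l + snd l) * lattice_const s (ad l) + 0)) = lattice_const s k"
  proof -
    have "(\<Sum>l\<in>low_degrees n. tcoeff \<eta> l * (0 ^ (fst l + snd l) * lattice_const s (ad l) + 0)) =
       (\<Sum>l\<in>{(0, 0)}. tcoeff \<eta> l * (0 ^ (fst l + snd l) * lattice_const s (ad l) + 0))"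
      by (rule sum.mono_neutral_right) (use n in \<open>auto simp: low_degrees_def\<close>)
    then show ?thesis using \<eta>(2) by (simp add: tcoeff_def ad_def)
  qed
  moreover have "\<forall>\<^sub>F h in at_right 0.
      (\<Sum>l\<in>low_degrees n. tcoeff \<eta> l * (h ^ (fst l + snd l) * lattice_const s (ad l) + el l h)) + e h =
      h powr (- \<delta>) * (h\<^sup>2 * lattice_sum (N h) h (\<lambda>u. hom s k u * \<eta> u) - x)"
    using eventually_at_right_less[of "0 :: real"]
  proof eventually_elim
    case (elim h)
    have pw: "h powr (- \<delta>) * h powr (dg s (ad l) + 2) = h ^ (fst l + snd l)" for l
    proof -
      have "h powr (- \<delta>) * h powr (dg s (ad l) + 2) = h powr real (fst l + snd l)"
        by (simp add: \<delta>_def ad_def flip: powr_add)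
      then show ?thesis using elim by (simp only: powr_realpow)
    qed
    have "el l h = h powr (- \<delta>) * (h\<^sup>2 * lattice_sum (N h) h (tm l) - X l) - h ^ (fst l + snd l) * lattice_const s (ad l)" for l
      unfolding el_def right_diff_distrib[of _ "_ - _" "_ * _"] mult.assoc[symmetric] pw ..
    then have el': "h ^ (fst l + snd l) * lattice_const s (ad l) + el l h = h powr (- \<delta>) * (h\<^sup>2 * lattice_sum (N h) h (tm l) - X l)" for l
      by simp
    have "lattice_sum (N h) h (\<lambda>u. hom s k u * \<eta> u) = lattice_sum (N h) h (\<lambda>u. (\<Sum>l\<in>low_degrees n. tcoeff \<eta> l * tm l u) + R0 u)"
      by (rule lattice_sum_cong[OF elim]) (rule eq)
    also have "\<dots> = (\<Sum>l\<in>low_degrees n. tcoeff \<eta> l * lattice_sum (N h) h (tm l)) + lattice_sum (N h) h R0"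
      by (simp only: lattice_sum_add lattice_sum_sum lattice_sum_cmult)
    finally show ?case
      unfolding el' x_def e_def
      by (simp add: right_diff_distrib distrib_left sum_distrib_left sum_subtractf mult_ac)
  qed
  ultimately have "((\<lambda>h. h powr (- \<delta>) * (h\<^sup>2 * lattice_sum (N h) h (\<lambda>u. hom s k u * \<eta> u) - x)) \<longlongrightarrow> lattice_const s k) (at_right 0)"
    using Lim_transform_eventually by fastforce
  then show ?thesis using that[OF fp] unfolding \<delta>_def N_def by blast
qed

text \<open>The unit lattice with \<eta> dilated by \<open>h\<close> is, up to a power of |h|, the
  lattice of mesh |h| with \<eta> itself, and the inner limit is that of an eventually constant
  sequence. Negative \<open>h\<close> is reduced to positive by evenness of \<eta>.\<close>

lemma wigner_limit:
  assumes s: "odd s" and adm: "admissible_cutoff \<eta>"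
  obtains g where "\<And>h. h \<noteq> 0 \<Longrightarrow> (\<lambda>N::nat.
               (\<Sum>(i, j) \<in> ({- int N..int N} \<times> {- int N..int N}) - {(0, 0)}.
                  mon k (of_int i, of_int j) / Q (of_int i, of_int j) powr (real s / 2)
                  * \<eta> (h * of_int i, h * of_int j))
               - fp_integral (\<lambda>u. mon k u / Q u powr (real s / 2) * \<eta> (h * fst u, h * snd u))
                   (real N + 1 / 2)) \<longlonglongrightarrow> g h"
    "(g \<longlongrightarrow> lattice_const s k) (at 0)"
proof -
  have \<eta>: "smooth_on UNIV \<eta>" "\<eta> (0, 0) = 1" "\<And>u. \<eta> (- u) = \<eta> u" "bounded {u. \<eta> u \<noteq> 0}"
    using adm by (auto simp: admissible_cutoff_def)
  obtain B' where B': "B' > 0" "\<And>u. u \<in> {u. \<eta> u \<noteq> 0} \<Longrightarrow> mnorm u < B'"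
    using bounded_mnorm[OF \<eta>(4)] by blast
  define B where "B = max 1 B'"
  have B: "B \<ge> 1" "B > 0" by (auto simp: B_def)
  have z: "\<eta> u = 0" if "B \<le> mnorm u" for u
    using B'(2)[of u] that by (force simp: B_def)
  obtain x where x: "fp_has (\<lambda>u. hom s k u * \<eta> u) B x"
    "((\<lambda>h. h powr (- (dg s k + 2)) * (h\<^sup>2 * lattice_sum (nat \<lceil>B / h\<rceil>) h (\<lambda>u. hom s k u * \<eta> u) - x))
        \<longlongrightarrow> lattice_const s k) (at_right 0)"
    by (rule hom_eta_limit[OF s \<eta>(1,2) B(1) z])
  define g where "g h = h powr (- (dg s k + 2)) * (h\<^sup>2 * lattice_sum (nat \<lceil>B / h\<rceil>) h (\<lambda>u. hom s k u * \<eta> u) - x)" for h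
  have "((\<lambda>h. g \<bar>h\<bar>) \<longlongrightarrow> lattice_const s k) (at 0)"
    using filterlim_compose[OF x(2) filterlim_abs_at_right] by (simp add: g_def)
  moreover have "(\<lambda>N::nat.
               (\<Sum>(i, j) \<in> ({- int N..int N} \<times> {- int N..int N}) - {(0, 0)}.
                  mon k (of_int i, of_int j) / Q (of_int i, of_int j) powr (real s / 2)
                  * \<eta> (h * of_int i, h * of_int j))
               - fp_integral (\<lambda>u. mon k u / Q u powr (real s / 2) * \<eta> (h * fst u, h * snd u))
                   (real N + 1 / 2)) \<longlonglongrightarrow> g \<bar>h\<bar>" if h: "h \<noteq> 0" for h
  proof (rule tendsto_eventually, rule eventually_sequentiallyI[of "nat \<lceil>B / \<bar>h\<bar>\<rceil>"])
    fix N :: nat assume N: "nat \<lceil>B / \<bar>h\<bar>\<rceil> \<le> N"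
    define t where "t = \<bar>h\<bar>"
    have t: "t > 0" using h by (simp add: t_def)
    have "B / t \<le> real (nat \<lceil>B / t\<rceil>)" by linarith
    then have Nt0: "B \<le> real (nat \<lceil>B / t\<rceil>) * t" using t by (simp add: field_simps)
    have Nt: "B \<le> real N * t"
    proof -
      have "real (nat \<lceil>B / t\<rceil>) * t \<le> real N * t" using N t by (intro mult_right_mono) (auto simp: t_def)
      with Nt0 show ?thesis by linarith
    qed
    let ?f = "\<lambda>u. hom s k u * \<eta> u"
    have \<eta>h: "\<eta> (h * fst u, h * snd u) = \<eta> (t *\<^sub>R u)" for u
    proof (cases "h > 0")
      case False
      then have "(h * fst u, h * snd u) = - (t *\<^sub>R u)" by (simp add: t_def prod_eq_iff)
      then show ?thesis using \<eta>(3) by simp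
    qed (simp add: t_def scaleR_prod_def)
    have ft: "t powr (- dg s k) * ?f (t *\<^sub>R u) = mon k u / Q u powr (real s / 2) * \<eta> (h * fst u, h * snd u)"
      if "u \<noteq> (0, 0)" for u
    proof -
      have "t powr (- dg s k) * t powr dg s k = 1" using t by (simp flip: powr_add)
      then show ?thesis
        unfolding \<eta>h hom_scale[OF t that] mult.assoc[symmetric] by (simp add: hom_def)
    qed
    have "(\<Sum>(i, j) \<in> ({- int N..int N} \<times> {- int N..int N}) - {(0, 0)}.
        mon k (of_int i, of_int j) / Q (of_int i, of_int j) powr (real s / 2) * \<eta> (h * of_int i, h * of_int j)) =
        lattice_sum N 1 (\<lambda>u. mon k u / Q u powr (real s / 2) * \<eta> (h * fst u, h * snd u))"
      by (simp add: lattice_sum_def)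
    also have "\<dots> = lattice_sum N 1 (\<lambda>u. t powr (- dg s k) * ?f (t *\<^sub>R u))"
      by (rule lattice_sum_cong) (use ft in auto)
    also have "\<dots> = t powr (- dg s k) * lattice_sum N t ?f"
      using lattice_sum_scale[of N t 1 ?f] by (simp add: lattice_sum_cmult)
    also have "lattice_sum N t ?f = lattice_sum (nat \<lceil>B / t\<rceil>) t ?f"
      using lattice_sum_support[OF t Nt, of ?f] lattice_sum_support[OF t Nt0, of ?f] z by simp
    finally have 1: "(\<Sum>(i, j) \<in> ({- int N..int N} \<times> {- int N..int N}) - {(0, 0)}.
        mon k (of_int i, of_int j) / Q (of_int i, of_int j) powr (real s / 2) * \<eta> (h * of_int i, h * of_int j)) =
        t powr (- dg s k) * lattice_sum (nat \<lceil>B / t\<rceil>) t ?f" .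
    \<comment> \<open>The extra half cell is harmless: beyond \<open>B\<close> the integrand is
      0.\<close>
    have "fp_has ?f ((real N + 1 / 2) * t) x"
      by (rule fp_has_enlarge[OF x(1)]) (use z Nt t in \<open>auto simp: algebra_simps\<close>)
    from fp_has_scale[OF this t]
    have "fp_has (\<lambda>u. ?f (t *\<^sub>R u)) (real N + 1 / 2) (x / t\<^sup>2)" using t by simp
    from fp_has_cong[OF fp_has_cmult[OF this, of "t powr (- dg s k)"] ft]
    have 2: "fp_integral (\<lambda>u. mon k u / Q u powr (real s / 2) * \<eta> (h * fst u, h * snd u)) (real N + 1 / 2) =
        t powr (- dg s k) * (x / t\<^sup>2)"
      by (rule fp_integral_eq)
    have p: "t powr (- (dg s k + 2)) * t\<^sup>2 = t powr (- dg s k)" "t powr (- (dg s k + 2)) = t powr (- dg s k) / t\<^sup>2"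
      using t by (simp_all add: powr_diff powr_numeral powr_minus powr_add field_simps)
    show "(\<Sum>(i, j) \<in> ({- int N..int N} \<times> {- int N..int N}) - {(0, 0)}.
        mon k (of_int i, of_int j) / Q (of_int i, of_int j) powr (real s / 2) * \<eta> (h * of_int i, h * of_int j)) -
        fp_integral (\<lambda>u. mon k u / Q u powr (real s / 2) * \<eta> (h * fst u, h * snd u)) (real N + 1 / 2) = g \<bar>h\<bar>"
      unfolding 1 2 g_def t_def[symmetric] right_diff_distrib mult.assoc[symmetric] p(1) unfolding p(2) by simp
  qed
  ultimately show ?thesis using that[of "\<lambda>h. g \<bar>h\<bar>"] by blast
qed

text \<open>Without an admissible cutoff every number would satisfy the condition in
  \<open>wigner\<close>; \<open>chi\<close> is the witness behind uniqueness in the next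
  lemma.\<close>

lemma admissible_chi: "admissible_cutoff chi"
proof -
  have "bounded {u. chi u \<noteq> 0}"
    by (rule bounded_subset[OF compact_imp_bounded[OF compact_mnorm_le[of "1 / 2"]]])
       (use chi_zero in \<open>auto simp: not_less[symmetric] intro: less_imp_le\<close>)
  then show ?thesis
    using smooth_chi chi_minus chi_one[of "(0, 0)"] by (auto simp: admissible_cutoff_def)
qed

text \<open>\<open>wigner_limit\<close> gives existence with one value common to all cutoffs; a
  competing value is excluded by comparing the inner limits for \<open>chi\<close> alone.\<close>

lemma wigner_lattice_const:
  assumes s: "odd s"
  shows "wigner Q (real s) (mon k) = lattice_const s k"
proof -
  let ?P = "\<lambda>\<eta> h g. (\<lambda>N::nat.
               (\<Sum>(i, j) \<in> ({- int N..int N} \<times> {- int N..int N}) - {(0, 0)}.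
                  mon k (of_int i, of_int j) / Q (of_int i, of_int j) powr (real s / 2)
                  * \<eta> (h * of_int i, h * of_int j))
               - fp_integral (\<lambda>u. mon k u / Q u powr (real s / 2) * \<eta> (h * fst u, h * snd u))
                   (real N + 1 / 2)) \<longlonglongrightarrow> g"
  have ex: "\<exists>g. (\<forall>\<^sub>F h in at 0. ?P \<eta> h (g h)) \<and> (g \<longlongrightarrow> lattice_const s k) (at 0)" if adm: "admissible_cutoff \<eta>" for \<eta>
  proof -
    obtain g where g: "\<And>h. h \<noteq> 0 \<Longrightarrow> ?P \<eta> h (g h)" "(g \<longlongrightarrow> lattice_const s k) (at 0)"
      using wigner_limit[OF s adm, of k] by blast
    have "\<forall>\<^sub>F h in at 0. ?P \<eta> h (g h)"
      unfolding eventually_at_filter by (rule always_eventually) (use g(1) in blast)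
    with g(2) show ?thesis by blast
  qed
  show ?thesis
    unfolding wigner_def
  proof (rule the_equality)
    show "\<forall>\<eta>. admissible_cutoff \<eta> \<longrightarrow> (\<exists>g. (\<forall>\<^sub>F h in at 0. ?P \<eta> h (g h)) \<and> (g \<longlongrightarrow> lattice_const s k) (at 0))"
      using ex by blast
    fix w assume "\<forall>\<eta>. admissible_cutoff \<eta> \<longrightarrow> (\<exists>g. (\<forall>\<^sub>F h in at 0. ?P \<eta> h (g h)) \<and> (g \<longlongrightarrow> w) (at 0))"
    then obtain g where g: "\<forall>\<^sub>F h in at 0. ?P chi h (g h)" "(g \<longlongrightarrow> w) (at 0)"
      using admissible_chi by blast
    obtain g' where g': "\<forall>\<^sub>F h in at 0. ?P chi h (g' h)" "(g' \<longlongrightarrow> lattice_const s k) (at 0)"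
      using ex[OF admissible_chi] by blast
    have "\<forall>\<^sub>F h in at 0. g h = g' h"
      using g(1) g'(1) by eventually_elim (rule LIMSEQ_unique)
    from Lim_transform_eventually[OF g(2) this] g'(2) show "w = lattice_const s k"
      using tendsto_unique[of "at (0 :: real)"] by simp
  qed
qed

end

subsection \<open>Expansion of the quadrature error\<close>

lemma iter_cong_open:
  fixes f g :: "real \<times> real \<Rightarrow> real"
  assumes "open U" "\<And>u. u \<in> U \<Longrightarrow> f u = g u"
  shows "u \<in> U \<Longrightarrow> (pu ^^ j) f u = (pu ^^ j) g u \<and> (pv ^^ j) f u = (pv ^^ j) g u"
proof (induction j arbitrary: u)
  case (Suc j)
  have "pu ((pu ^^ j) f) u = pu ((pu ^^ j) g) u" "pv ((pv ^^ j) f) u = pv ((pv ^^ j) g) u"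
    by (rule pu_cong_open[OF assms(1) Suc.prems], simp add: Suc.IH)
       (rule pv_cong_open[OF assms(1) Suc.prems], simp add: Suc.IH)
  then show ?case by simp
qed (use assms in auto)

text \<open>A bound on a smooth function alone controls its derivatives, because all Taylor terms
  below degree \<open>n\<close> must vanish. The index set of the expansion is empty, so
  \<open>f\<close> is its own remainder.\<close>

lemma symbol_class_of_bound:
  assumes f: "smooth_on UNIV f" and r: "r > 0" and C: "\<And>u. u \<in> punctured r \<Longrightarrow> \<bar>f u\<bar> \<le> C * mnorm u ^ n"
    and \<delta>: "\<delta> \<le> 1"
  shows "symbol_class \<delta> K (real n) f"
proof -
  obtain R where R: "smooth_on UNIV R" "vanish n R" "\<And>u. f u = (\<Sum>k\<in>low_degrees n - low_degrees n. tcoeff f k * mon k u) + R u"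
    using taylor_expansion[OF f r, of C n n] C by (auto simp: punctured_def)
  have "f = R" by (rule ext) (use R(3) in simp)
  then show ?thesis using vanish_symbol_class[OF \<delta> R(1,2)] by simp
qed

context posquad
begin

text \<open>The homogeneous terms are multiplied by the cutoff of size \<open>a\<close> before
  subtraction. Near the origin this changes nothing, and the boundary data of \<open>g\<close> stay
  intact, so \<open>R0\<close> meets both the regularity and the matching demanded by
  \<open>trapezoid_2d\<close>.\<close>

lemma expansion_error:
  fixes g :: "real \<times> real \<Rightarrow> real" and \<alpha> :: "'i \<Rightarrow> real"
  assumes a: "a > 0" "a < b" and P: "P > 0" and I: "finite I" and s: "\<And>i. i \<in> I \<Longrightarrow> odd (s i)"
    and g1: "kdiff_on {u. u \<noteq> (0, 0) \<and> mnorm u < b} (Suc P) g" and g2: "matched P a g"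
    and d0: "0 < d0" "d0 \<le> 1" "d0 \<le> a / 5"
    and g3: "symbol_class d0 (Suc P) D (\<lambda>u. g u - (\<Sum>i\<in>I. \<alpha> i * hom (s i) (k i) u))" and D: "D > real (Suc P)"
  shows "\<exists>x C. fp_has g a x \<and> (\<forall>N>0. \<bar>x - (a / real N)\<^sup>2 * (\<Sum>(i, j)\<in>{- int N..int N - 1} \<times> {- int N..int N - 1} - {(0, 0)}.
        g (of_int i * (a / real N), of_int j * (a / real N)))
      + (\<Sum>i\<in>I. \<alpha> i * ((a / real N) powr (dg (s i) (k i) + 2) * lattice_const (s i) (k i)))\<bar> \<le> C * (a / real N) ^ P)"
proof -
  define tm where "tm i u = hom (s i) (k i) u * chi ((1 / a) *\<^sub>R u)" for i u
  define R where "R u = g u - (\<Sum>i\<in>I. \<alpha> i * tm i u)" for u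
  define R0 where "R0 = R((0, 0) := 0)"
  let ?O = "{u. u \<noteq> (0, 0) \<and> mnorm u < b}"
  have "open ?O"
  proof -
    have "?O = {u. mnorm u < b} - {(0, 0)}" by auto
    then show ?thesis by (metis open_Diff open_mnorm_less closed_singleton)
  qed
  then interpret off: grading ?O "\<lambda>_ _. True" by (rule grading_trivial)
  have Dtm: "kdiff_on ?O (Suc P) (tm i)" for i
  proof -
    have "kdiff_on (UNIV - {(0, 0)}) (Suc P) (tm i)"
      unfolding tm_def[abs_def] by (rule kdiff_on_mult_off[OF kdiff_on_hom smooth_kdiff_on_off[OF smooth_chi_scale]])
    then show ?thesis by (rule kdiff_on_subset) auto
  qed
  have R_off: "kdiff_on ?O (Suc P) R"
    unfolding R_def[abs_def] by (intro off.graded_diff off.graded_sum off.graded_cmult g1 Dtm I)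
  have 1: "kdiff_on ?O (Suc P) R0"
    by (rule off.graded_cong[OF _ R_off]) (simp add: R0_def)
  interpret gb: grading "punctured d0" "power_bounded d0" by (rule grading_power_bounded[OF d0(2)])
  have "symbol_class d0 (Suc P) D R"
  proof (rule gb.graded_cong[OF _ g3])
    fix u assume u: "u \<in> punctured d0"
    have "mnorm ((1 / a) *\<^sub>R u) \<le> 1 / 5"
      using u d0 a by (simp add: mnorm_scaleR punctured_def field_simps)
    then show "g u - (\<Sum>i\<in>I. \<alpha> i * hom (s i) (k i) u) = R u"
      using chi_one by (simp add: tm_def R_def)
  qed
  from symbol_class_extend[OF d0(1) this D] have "kdiff_on {u. mnorm u < d0} (Suc P) R0"
    unfolding R0_def by (simp del: graded.simps fun_upd_apply)
  from kdiff_on_Un[OF 1 this] have "kdiff_on (?O \<union> {u. mnorm u < d0}) (Suc P) R0" .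
  then have DkR: "kdiff_on {u. mnorm u < b} (Suc P) R0"
    by (rule kdiff_on_subset) (use d0 in auto)
  \<comment> \<open>The cutoff dies at half the size, so \<open>R0\<close> and \<open>g\<close>
    coincide on an open neighbourhood of the boundary and share all derivatives there.\<close>
  have chiz: "chi ((1 / a) *\<^sub>R u) = 0" if "a / 2 \<le> mnorm u" for u
    using that a by (intro chi_zero) (simp add: mnorm_scaleR field_simps)
  have tmz: "tm i u = 0" if "a \<le> mnorm u" for i u
    using chiz[of u] that a by (simp add: tm_def)
  have R0g: "R0 u = g u" if "u \<in> {u. a / 2 < mnorm u}" for u
    using chiz[of u] that a by (auto simp: R0_def R_def tm_def)
  have mR: "matched P a R0"
    unfolding matched_def
  proof (intro allI impI ballI)
    fix j t assume j: "j < P" "t \<in> {-a..a}"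
    have *: "(a, t) \<in> {u. a / 2 < mnorm u}" "(-a, t) \<in> {u. a / 2 < mnorm u}"
        "(t, a) \<in> {u. a / 2 < mnorm u}" "(t, -a) \<in> {u. a / 2 < mnorm u}"
      using a by (auto simp: mnorm_def)
    have it: "(pu ^^ j) R0 v = (pu ^^ j) g v \<and> (pv ^^ j) R0 v = (pv ^^ j) g v" if "v \<in> {u. a / 2 < mnorm u}" for v
      by (rule iter_cong_open[OF open_mnorm_greater R0g that])
    show "(pu ^^ j) R0 (a, t) = (pu ^^ j) R0 (-a, t) \<and> (pv ^^ j) R0 (t, a) = (pv ^^ j) R0 (t, -a)"
      using g2 j it[OF *(1)] it[OF *(2)] it[OF *(3)] it[OF *(4)] unfolding matched_def by metis
  qed
  obtain C where C: "\<And>h N. 0 < h \<Longrightarrow> 0 < N \<Longrightarrow> real N * h \<le> a \<Longrightarrow> matched P (real N * h) R0 \<Longrightarrow>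
    \<bar>h\<^sup>2 * (\<Sum>(i, j)\<in>{- int N..int N - 1} \<times> {- int N..int N - 1}. R0 (of_int i * h, of_int j * h))
      - integral {u. mnorm u \<le> real N * h} R0\<bar> \<le> C * h ^ P"
  proof (rule trapezoid_2d[OF P DkR a(2)])
    fix C assume "\<And>h N. 0 < h \<Longrightarrow> 0 < N \<Longrightarrow> real N * h \<le> a \<Longrightarrow> matched P (real N * h) R0 \<Longrightarrow>
    \<bar>h\<^sup>2 * (\<Sum>(i, j)\<in>{- int N..int N - 1} \<times> {- int N..int N - 1}. R0 (of_int i * h, of_int j * h))
      - integral {u. mnorm u \<le> real N * h} R0\<bar> \<le> C * h ^ P"
    then show thesis by (rule that)
  qed
  have "\<forall>i. \<exists>x. i \<in> I \<longrightarrow> fp_has (tm i) a x \<and> (\<exists>C. \<forall>h N. 0 < h \<longrightarrow> h \<le> a \<longrightarrow> a \<le> real N * h \<longrightarrow>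
      \<bar>h\<^sup>2 * lattice_sum N h (tm i) - x - h powr (dg (s i) (k i) + 2) * lattice_const (s i) (k i)\<bar> \<le> C * h ^ P)"
  proof
    fix i
    show "\<exists>x. i \<in> I \<longrightarrow> fp_has (tm i) a x \<and> (\<exists>C. \<forall>h N. 0 < h \<longrightarrow> h \<le> a \<longrightarrow> a \<le> real N * h \<longrightarrow>
      \<bar>h\<^sup>2 * lattice_sum N h (tm i) - x - h powr (dg (s i) (k i) + 2) * lattice_const (s i) (k i)\<bar> \<le> C * h ^ P)"
    proof (cases "i \<in> I")
      case True
      have "\<exists>x. fp_has (tm i) a x \<and> (\<forall>K. \<exists>C. \<forall>h N. 0 < h \<longrightarrow> h \<le> a \<longrightarrow> a \<le> real N * h \<longrightarrow>
        \<bar>h\<^sup>2 * lattice_sum N h (tm i) - x - h powr (dg (s i) (k i) + 2) * lattice_const (s i) (k i)\<bar> \<le> C * h ^ K)"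
        using lattice_const_error[OF s[OF True] a(1), of "k i"] unfolding tm_def .
      then obtain x where x: "fp_has (tm i) a x" "\<forall>K. \<exists>C. \<forall>h N. 0 < h \<longrightarrow> h \<le> a \<longrightarrow> a \<le> real N * h \<longrightarrow>
        \<bar>h\<^sup>2 * lattice_sum N h (tm i) - x - h powr (dg (s i) (k i) + 2) * lattice_const (s i) (k i)\<bar> \<le> C * h ^ K"
        by (elim exE conjE)
      show ?thesis
        by (rule exI[of _ x], rule impI, rule conjI[OF x(1)], rule spec[OF x(2)])
    qed simp
  qed
  from choice[OF this] obtain X where X: "\<forall>i. i \<in> I \<longrightarrow> fp_has (tm i) a (X i) \<and> (\<exists>C. \<forall>h N. 0 < h \<longrightarrow> h \<le> a \<longrightarrow> a \<le> real N * h \<longrightarrow>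
      \<bar>h\<^sup>2 * lattice_sum N h (tm i) - X i - h powr (dg (s i) (k i) + 2) * lattice_const (s i) (k i)\<bar> \<le> C * h ^ P)"
    by (elim exE)
  then have "\<forall>i. \<exists>C. i \<in> I \<longrightarrow> (\<forall>h N. 0 < h \<longrightarrow> h \<le> a \<longrightarrow> a \<le> real N * h \<longrightarrow>
      \<bar>h\<^sup>2 * lattice_sum N h (tm i) - X i - h powr (dg (s i) (k i) + 2) * lattice_const (s i) (k i)\<bar> \<le> C * h ^ P)"
    unfolding ex_simps(6) by (intro allI impI, elim allE impE conjE)
  from choice[OF this] obtain CC where CC: "\<forall>i. i \<in> I \<longrightarrow> (\<forall>h N. 0 < h \<longrightarrow> h \<le> a \<longrightarrow> a \<le> real N * h \<longrightarrow>
      \<bar>h\<^sup>2 * lattice_sum N h (tm i) - X i - h powr (dg (s i) (k i) + 2) * lattice_const (s i) (k i)\<bar> \<le> CC i * h ^ P)"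
    by (elim exE)
  note X = X[rule_format, THEN conjunct1] and CC = CC[rule_format]
  define x where "x = (\<Sum>i\<in>I. \<alpha> i * X i) + integral {u. mnorm u \<le> a} R0"
  have eq: "g u = (\<Sum>i\<in>I. \<alpha> i * tm i u) + R0 u" if "u \<noteq> (0, 0)" for u
    using that by (simp add: R0_def R_def)
  have contm: "continuous_on {u. u \<noteq> (0, 0) \<and> mnorm u \<le> a} (tm i)" for i
    unfolding tm_def by (rule continuous_hom_mult[OF smooth_chi_scale])
  have contR: "continuous_on {u. mnorm u \<le> a} R0" by (rule kdiff_on_continuous[OF DkR]) (use a in auto)
  have fp: "fp_has g a x"
  proof (rule fp_has_cong)
    show "fp_has (\<lambda>u. (\<Sum>i\<in>I. \<alpha> i * tm i u) + R0 u) a x"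
      unfolding x_def
      by (intro fp_has_add fp_has_sum fp_has_cmult X fp_has_continuous contR a continuous_intros contm
          continuous_on_subset[OF contR] I) auto
  qed (use eq in auto)
  define E where "E = C + (\<Sum>i\<in>I. \<bar>\<alpha> i\<bar> * CC i)"
  show ?thesis
  proof (intro exI conjI allI impI)
    show "fp_has g a x" by (rule fp)
    fix N :: nat assume N: "N > 0"
    define h where "h = a / real N"
    have h: "0 < h" "h \<le> a" "real N * h = a" using N a by (auto simp: h_def field_simps)
    let ?S = "{- int N..int N - 1} \<times> {- int N..int N - 1}"
    define S0 where "S0 = (\<Sum>(i, j)\<in>?S. R0 (of_int i * h, of_int j * h))"
    \<comment> \<open>The half-open index square of the rule may replace the symmetric one because
      the cut-off terms vanish on the boundary.\<close>
    have tmS: "(\<Sum>(m, j)\<in>?S - {(0, 0)}. tm i (of_int m * h, of_int j * h)) = lattice_sum N h (tm i)" for i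
      by (rule trans[OF sum_lattice_support[where N = N and B = a] lattice_sum_support[where B = a, symmetric]])
         (use h tmz in auto)
    have S0': "(\<Sum>(m, j)\<in>?S - {(0, 0)}. R0 (of_int m * h, of_int j * h)) = S0"
      unfolding S0_def by (rule sum.mono_neutral_left) (auto simp: R0_def)
    have "(\<Sum>(m, j)\<in>?S - {(0, 0)}. g (of_int m * h, of_int j * h)) =
        (\<Sum>(m, j)\<in>?S - {(0, 0)}. (\<Sum>i\<in>I. \<alpha> i * tm i (of_int m * h, of_int j * h)) + R0 (of_int m * h, of_int j * h))"
    proof (intro sum.cong refl)
      fix y assume "y \<in> ?S - {(0, 0)}"
      then have "(of_int (fst y) * h, of_int (snd y) * h) \<noteq> (0, 0)" using h by (cases y) auto
      from eq[OF this] show "(case y of (m, j) \<Rightarrow> g (of_int m * h, of_int j * h)) = (case y of (m, j) \<Rightarrow>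
          (\<Sum>i\<in>I. \<alpha> i * tm i (of_int m * h, of_int j * h)) + R0 (of_int m * h, of_int j * h))"
        by (simp add: split_beta)
    qed
    also have "\<dots> = (\<Sum>i\<in>I. \<alpha> i * lattice_sum N h (tm i)) + S0"
      unfolding tmS[symmetric] S0'[symmetric] sum_distrib_left split_beta sum.distrib
      by (subst sum.swap) simp
    finally have gs: "(\<Sum>(m, j)\<in>?S - {(0, 0)}. g (of_int m * h, of_int j * h)) = (\<Sum>i\<in>I. \<alpha> i * lattice_sum N h (tm i)) + S0" .
    define err where "err = (\<Sum>i\<in>I. \<alpha> i * (h\<^sup>2 * lattice_sum N h (tm i) - X i - h powr (dg (s i) (k i) + 2) * lattice_const (s i) (k i)))"
    have eqn: "x - h\<^sup>2 * (\<Sum>(m, j)\<in>?S - {(0, 0)}. g (of_int m * h, of_int j * h))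
       + (\<Sum>i\<in>I. \<alpha> i * (h powr (dg (s i) (k i) + 2) * lattice_const (s i) (k i))) =
      - (h\<^sup>2 * S0 - integral {u. mnorm u \<le> a} R0) - err"
      unfolding gs x_def err_def
      by (simp add: sum_subtractf right_diff_distrib distrib_left sum_distrib_left mult.left_commute)
    have "matched P (real N * h) R0" "real N * h \<le> a" using mR h(3) by simp_all
    from C[OF h(1) N this(2,1)] have e1: "\<bar>h\<^sup>2 * S0 - integral {u. mnorm u \<le> a} R0\<bar> \<le> C * h ^ P"
      unfolding S0_def h(3) .
    have "\<bar>err\<bar> \<le> (\<Sum>i\<in>I. \<bar>\<alpha> i\<bar> * (CC i * h ^ P))"
      unfolding err_def
    proof (rule order_trans[OF sum_abs], rule sum_mono)
      fix i assume i: "i \<in> I"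
      have "a \<le> real N * h" using h(3) by simp
      from mult_left_mono[OF CC[OF i h(1,2) this] abs_ge_zero[of "\<alpha> i"]]
      show "\<bar>\<alpha> i * (h\<^sup>2 * lattice_sum N h (tm i) - X i - h powr (dg (s i) (k i) + 2) * lattice_const (s i) (k i))\<bar>
          \<le> \<bar>\<alpha> i\<bar> * (CC i * h ^ P)"
        by (simp only: abs_mult)
    qed
    with e1 have "\<bar>- (h\<^sup>2 * S0 - integral {u. mnorm u \<le> a} R0) - err\<bar> \<le> C * h ^ P + (\<Sum>i\<in>I. \<bar>\<alpha> i\<bar> * (CC i * h ^ P))"
      by linarith
    then show "\<bar>x - (a / real N)\<^sup>2 * (\<Sum>(i, j)\<in>?S - {(0, 0)}. g (of_int i * (a / real N), of_int j * (a / real N)))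
      + (\<Sum>i\<in>I. \<alpha> i * ((a / real N) powr (dg (s i) (k i) + 2) * lattice_const (s i) (k i)))\<bar> \<le> E * (a / real N) ^ P"
      unfolding h_def[symmetric] eqn E_def by (simp only: distrib_right sum_distrib_right mult.assoc)
  qed
qed

text \<open>Writing r2 = Q (1 + X), the quotient X = (r2 - Q)/Q has degree 3 - 2 = 1, so each
  further binomial term gains one degree. Stopping the series after \<open>M\<close> terms leaves
  degree 2q - p + M, stopping Taylor at \<open>n\<close> leaves n - p - 2m; the conditions on
  \<open>D\<close> ensure that both suffice.\<close>

lemma local_expansion:
  fixes r2 \<phi> :: "real \<times> real \<Rightarrow> real" and p q M n :: nat
  assumes r2: "smooth_on UNIV r2" and \<phi>: "smooth_on UNIV \<phi>"
    and r2Q: "\<And>u. mnorm u < 1 \<Longrightarrow> \<bar>r2 u - Q u\<bar> \<le> C3 * mnorm u ^ 3"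
    and \<phi>q: "r > 0" "\<And>u. u \<in> punctured r \<Longrightarrow> \<bar>\<phi> u\<bar> \<le> Cq * mnorm u ^ (2 * q)"
    and n: "2 * q + 3 * M \<le> n" and e: "e > 0"
    and D: "D \<le> real (2 * q) - real p + real M" "D \<le> real n - real p - 2 * real M"
  shows "\<exists>R d0. 0 < d0 \<and> d0 \<le> e \<and> d0 \<le> 1 \<and>
    symbol_class d0 K D (\<lambda>u. \<phi> u / r2 u powr (real p / 2) - (\<Sum>(m, l)\<in>Sigma {..<M} (\<lambda>m. low_degrees n - low_degrees (2 * q + 3 * m)).
      ((- real p / 2) gchoose m) * tcoeff (\<lambda>u. (r2 u - Q u) ^ m * \<phi> u) l * hom (p + 2 * m) l u)) \<and>
    (\<forall>m<M. smooth_on UNIV (R m) \<and> vanish n (R m) \<and> (\<forall>u. (r2 u - Q u) ^ m * \<phi> u =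
      (\<Sum>l\<in>low_degrees n - low_degrees (2 * q + 3 * m). tcoeff (\<lambda>u. (r2 u - Q u) ^ m * \<phi> u) l * mon l u) + R m u))"
proof -
  define ft where "ft m u = (r2 u - Q u) ^ m * \<phi> u" for m u
  define I where "I m = low_degrees n - low_degrees (2 * q + 3 * m)" for m
  define \<beta> where "\<beta> = - real p / 2"
  have sm: "smooth_on UNIV (ft m)" for m
    unfolding ft_def[abs_def] by (intro smooth_intros r2 Q_smooth \<phi>)
  have "\<forall>m. \<exists>R. m < M \<longrightarrow> smooth_on UNIV R \<and> vanish n R \<and> (\<forall>u. ft m u = (\<Sum>l\<in>I m. tcoeff (ft m) l * mon l u) + R u)"
  proof
    fix m
    show "\<exists>R. m < M \<longrightarrow> smooth_on UNIV R \<and> vanish n R \<and> (\<forall>u. ft m u = (\<Sum>l\<in>I m. tcoeff (ft m) l * mon l u) + R u)"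
    proof (cases "m < M")
      case True
      obtain R where "smooth_on UNIV R" "vanish n R" "\<And>u. ft m u = (\<Sum>l\<in>low_degrees n - low_degrees (2 * q + 3 * m). tcoeff (ft m) l * mon l u) + R u"
      proof (rule taylor_expansion[OF sm, of "min r 1" m "\<bar>C3\<bar> ^ m * Cq" "2 * q + 3 * m" n])
        fix u assume u: "mnorm u < min r 1" "u \<noteq> (0, 0)"
        have "\<bar>r2 u - Q u\<bar> \<le> \<bar>C3\<bar> * mnorm u ^ 3"
          using r2Q[of u] u mult_right_mono[OF abs_ge_self[of C3], of "mnorm u ^ 3"] by simp
        then have "\<bar>r2 u - Q u\<bar> ^ m \<le> (\<bar>C3\<bar> * mnorm u ^ 3) ^ m" by (intro power_mono) auto
        moreover have "\<bar>\<phi> u\<bar> \<le> Cq * mnorm u ^ (2 * q)" using \<phi>q(2)[of u] u by (simp add: punctured_def)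
        ultimately have "\<bar>r2 u - Q u\<bar> ^ m * \<bar>\<phi> u\<bar> \<le> (\<bar>C3\<bar> * mnorm u ^ 3) ^ m * (Cq * mnorm u ^ (2 * q))"
          by (intro mult_mono) auto
        then show "\<bar>ft m u\<bar> \<le> \<bar>C3\<bar> ^ m * Cq * mnorm u ^ (2 * q + 3 * m)"
          by (simp add: ft_def abs_mult power_abs power_mult_distrib power_add power_mult[symmetric] mult_ac)
      qed (use \<phi>q n True that in auto)
      then show ?thesis unfolding I_def by blast
    qed simp
  qed
  from choice[OF this] obtain R where R: "\<forall>m. m < M \<longrightarrow> smooth_on UNIV (R m) \<and> vanish n (R m) \<and>
      (\<forall>u. ft m u = (\<Sum>l\<in>I m. tcoeff (ft m) l * mon l u) + R m u)" by (elim exE)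
  \<comment> \<open>The exponent is 1, written as \<open>real 2 / 2\<close> so that
    \<open>symbol_class_hom_mult\<close> applies with \<open>s = 2\<close>.\<close>
  define X where "X u = (r2 u - Q u) / Q u powr (real 2 / 2)" for u
  have S3: "symbol_class \<delta> K (real 3) (\<lambda>u. r2 u - Q u)" if "\<delta> \<le> 1" for \<delta> K
    by (rule symbol_class_of_bound[of _ 1 C3, OF _ _ _ that]) (use r2Q in \<open>auto simp: punctured_def intro!: smooth_intros r2 Q_smooth\<close>)
  have SX: "symbol_class \<delta> K 1 X" if "\<delta> \<le> 1" for \<delta> K
    using symbol_class_hom_mult[OF that S3[OF that], of K 2] unfolding X_def by simp
  obtain CX where CX: "\<And>u. u \<in> punctured 1 \<Longrightarrow> \<bar>X u\<bar> \<le> CX * mnorm u powr 1"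
    using SX[of 1 0] unfolding power_bounded_def by auto
  \<comment> \<open>Small enough for |X| \<le> 1/2, the range of the bound on
    \<open>binom_rem\<close>; the added 1 keeps the denominator positive.\<close>
  define d0 where "d0 = min (min e 1) (1 / (2 * (\<bar>CX\<bar> + 1)))"
  have d0: "0 < d0" "d0 \<le> e" "d0 \<le> 1" "d0 \<le> 1 / (2 * (\<bar>CX\<bar> + 1))"
    using e by (auto simp: d0_def)
  have X2: "\<bar>X u\<bar> \<le> 1 / 2" if u: "u \<in> punctured d0" for u
  proof -
    have "\<bar>X u\<bar> \<le> CX * mnorm u" using CX[of u] u d0 by (auto simp: punctured_def)
    also have "\<dots> \<le> (\<bar>CX\<bar> + 1) * (1 / (2 * (\<bar>CX\<bar> + 1)))"
      using u d0 by (intro mult_mono) (auto simp: punctured_def)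
    also have "\<dots> = 1 / 2" by (simp add: field_simps)
    finally show ?thesis .
  qed
  interpret gb: grading "punctured d0" "power_bounded d0" by (rule grading_power_bounded[OF d0(3)])
  have S\<phi>: "symbol_class d0 K (real (2 * q)) \<phi>"
    by (rule symbol_class_of_bound[OF \<phi> \<phi>q d0(3)])
  have "symbol_class d0 K (real (2 * q) - real p + real M) (\<lambda>u. \<phi> u / Q u powr (real p / 2) * binom_rem \<beta> M (X u))"
    by (rule symbol_class_binom_rem[OF d0(3) SX[OF d0(3)] X2 symbol_class_hom_mult[OF d0(3) S\<phi>]])
  then have 1: "symbol_class d0 K D (\<lambda>u. \<phi> u / Q u powr (real p / 2) * binom_rem \<beta> M (X u))"
    by (rule gb.graded_mono) (use D in simp)
  have 2: "symbol_class d0 K D (\<lambda>u. \<Sum>m<M. (\<beta> gchoose m) * (R m u / Q u powr (real (p + 2 * m) / 2)))"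
  proof (intro gb.graded_sum gb.graded_cmult)
    fix m assume m: "m \<in> {..<M}"
    have "symbol_class d0 K (real n - real (p + 2 * m)) (\<lambda>u. R m u / Q u powr (real (p + 2 * m) / 2))"
      using R m by (intro symbol_class_hom_mult d0 vanish_symbol_class) auto
    then show "symbol_class d0 K D (\<lambda>u. R m u / Q u powr (real (p + 2 * m) / 2))"
      by (rule gb.graded_mono) (use D m in auto)
  qed simp
  have "symbol_class d0 K D (\<lambda>u. \<phi> u / r2 u powr (real p / 2) - (\<Sum>(m, l)\<in>Sigma {..<M} I.
      (\<beta> gchoose m) * tcoeff (ft m) l * hom (p + 2 * m) l u))"
  proof (rule gb.graded_cong[OF _ gb.graded_add[OF 1 2]])
    fix u assume u: "u \<in> punctured d0"
    have Qp: "Q u > 0" using Q_pos[of u] u by (simp add: punctured_def)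
    have Xu: "X u = (r2 u - Q u) / Q u" using Qp by (simp add: X_def)
    have r2: "r2 u = Q u * (1 + X u)" using Qp by (simp add: Xu field_simps)
    have X1: "1 + X u > 0" using X2[OF u] by (simp add: abs_le_iff)
    have Qm: "Q u powr (real (p + 2 * m) / 2) = Q u powr (real p / 2) * Q u ^ m" for m
    proof -
      have "real (p + 2 * m) / 2 = real p / 2 + real m" by (simp add: field_simps)
      then show ?thesis using Qp by (simp only: powr_add powr_realpow)
    qed
    have hm: "ft m u / Q u powr (real (p + 2 * m) / 2) = \<phi> u / Q u powr (real p / 2) * X u ^ m" for m
      unfolding Qm ft_def Xu by (simp add: power_divide field_simps)
    have "\<phi> u / r2 u powr (real p / 2) = \<phi> u / Q u powr (real p / 2) * (1 + X u) powr \<beta>"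
    proof -
      have "r2 u powr (real p / 2) = Q u powr (real p / 2) * (1 + X u) powr (real p / 2)"
        unfolding r2 by (rule powr_mult)
      moreover have "(1 + X u) powr \<beta> = 1 / (1 + X u) powr (real p / 2)"
        unfolding \<beta>_def powr_minus_divide[symmetric] by simp
      ultimately show ?thesis by simp
    qed
    also have "(1 + X u) powr \<beta> = binom_rem \<beta> M (X u) + (\<Sum>m<M. (\<beta> gchoose m) * X u ^ m)"
      by (simp add: binom_rem_def)
    also have "\<phi> u / Q u powr (real p / 2) * (binom_rem \<beta> M (X u) + (\<Sum>m<M. (\<beta> gchoose m) * X u ^ m)) =
       \<phi> u / Q u powr (real p / 2) * binom_rem \<beta> M (X u) + (\<Sum>m<M. (\<beta> gchoose m) * (ft m u / Q u powr (real (p + 2 * m) / 2)))"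
      unfolding hm by (simp add: distrib_left sum_distrib_left sum_divide_distrib mult_ac)
    also have "(\<Sum>m<M. (\<beta> gchoose m) * (ft m u / Q u powr (real (p + 2 * m) / 2))) =
        (\<Sum>m<M. (\<Sum>l\<in>I m. (\<beta> gchoose m) * tcoeff (ft m) l * hom (p + 2 * m) l u) +
          (\<beta> gchoose m) * (R m u / Q u powr (real (p + 2 * m) / 2)))"
    proof (intro sum.cong refl)
      fix m assume m: "m \<in> {..<M}"
      have "ft m u = (\<Sum>l\<in>I m. tcoeff (ft m) l * mon l u) + R m u"
        by (rule R[rule_format, THEN conjunct2, THEN conjunct2, THEN spec]) (use m in simp)
      then show "(\<beta> gchoose m) * (ft m u / Q u powr (real (p + 2 * m) / 2)) =
        (\<Sum>l\<in>I m. (\<beta> gchoose m) * tcoeff (ft m) l * hom (p + 2 * m) l u) +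
          (\<beta> gchoose m) * (R m u / Q u powr (real (p + 2 * m) / 2))"
        by (simp only: add_divide_distrib distrib_left sum_divide_distrib sum_distrib_left hom_def times_divide_eq_right mult.assoc)
    qed
    finally show "\<phi> u / Q u powr (real p / 2) * binom_rem \<beta> M (X u) +
         (\<Sum>m<M. (\<beta> gchoose m) * (R m u / Q u powr (real (p + 2 * m) / 2))) =
         \<phi> u / r2 u powr (real p / 2) - (\<Sum>(m, l)\<in>Sigma {..<M} I. (\<beta> gchoose m) * tcoeff (ft m) l * hom (p + 2 * m) l u)"
      by (simp add: sum.Sigma[symmetric] I_def sum.distrib)
  qed
  then show ?thesis
    using d0 R unfolding ft_def[abs_def] I_def \<beta>_def by (intro exI[of _ R] exI[of _ d0] conjI) auto
qed

end

subsection \<open>The stencil correction\<close>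

lemma powr_bigo:
  assumes "a > 0" "real P \<le> e"
  shows "(\<lambda>N. (a / real N) powr e) \<in> O[sequentially](\<lambda>N. (a / real N) ^ P)"
proof (rule bigoI[of _ "a powr (e - real P)"])
  show "\<forall>\<^sub>F N in sequentially. norm ((a / real N) powr e) \<le> a powr (e - real P) * norm ((a / real N) ^ P)"
    using eventually_gt_at_top[of 0]
  proof eventually_elim
    case (elim N)
    define h where "h = a / real N"
    have h: "h > 0" "h \<le> a" using elim assms by (auto simp: h_def field_simps)
    have "h powr e = h powr (e - real P) * h ^ P"
      using h by (simp add: powr_diff powr_realpow)
    also have "\<dots> \<le> a powr (e - real P) * h ^ P"
      using h assms by (intro mult_right_mono powr_mono2) auto
    finally show ?case using h unfolding h_def[symmetric] by simp
  qed
qed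

lemma bigo_cmult: "f \<in> O[F](g) \<Longrightarrow> (\<lambda>x. c * f x :: real) \<in> O[F](g)"
  by (cases "c = 0") simp_all

text \<open>Central symmetry of the weights handles the odd total degrees, about which the moment
  conditions say nothing; the corresponding lattice constants are 0 as well.\<close>

lemma stencil_odd_moment:
  assumes "\<And>\<mu> \<nu>. (\<mu>, \<nu>) \<in> stencil K1 K2 \<Longrightarrow> \<tau> (\<mu>, \<nu>) = \<tau> (- \<mu>, - \<nu>)" "odd (fst l + snd l)"
  shows "(\<Sum>(\<mu>, \<nu>)\<in>stencil K1 K2. mon l (of_int \<mu>, of_int \<nu>) * \<tau> (\<mu>, \<nu>)) = 0"
proof -
  have "(\<Sum>(\<mu>, \<nu>)\<in>stencil K1 K2. mon l (of_int \<mu>, of_int \<nu>) * \<tau> (\<mu>, \<nu>)) =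
      (\<Sum>(\<mu>, \<nu>)\<in>stencil K1 K2. mon l (of_int (- \<mu>), of_int (- \<nu>)) * \<tau> (- \<mu>, - \<nu>))"
    by (rule sum.reindex_bij_witness[of _ "\<lambda>(i, j). (- i, - j)" "\<lambda>(i, j). (- i, - j)"]) (auto simp: stencil_def)
  also have "\<dots> = (\<Sum>(\<mu>, \<nu>)\<in>stencil K1 K2. - (mon l (of_int \<mu>, of_int \<nu>) * \<tau> (\<mu>, \<nu>)))"
  proof (intro sum.cong refl)
    fix y assume y: "y \<in> stencil K1 K2"
    obtain \<mu> \<nu> where y': "y = (\<mu>, \<nu>)" by (cases y)
    have "mon l (of_int (- \<mu>), of_int (- \<nu>)) = - mon l (of_int \<mu>, of_int \<nu>)"
      using mon_scale[of l "- 1" "(of_int \<mu>, of_int \<nu>)"] assms(2) by simp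
    then show "(case y of (\<mu>, \<nu>) \<Rightarrow> mon l (of_int (- \<mu>), of_int (- \<nu>)) * \<tau> (- \<mu>, - \<nu>)) =
        (case y of (\<mu>, \<nu>) \<Rightarrow> - (mon l (of_int \<mu>, of_int \<nu>) * \<tau> (\<mu>, \<nu>)))"
      using assms(1)[of \<mu> \<nu>] y unfolding y' by simp
  qed
  also have "\<dots> = - (\<Sum>(\<mu>, \<nu>)\<in>stencil K1 K2. mon l (of_int \<mu>, of_int \<nu>) * \<tau> (\<mu>, \<nu>))"
    by (simp add: split_beta sum_negf)
  finally show ?thesis by simp
qed

context posquad
begin

lemma stencil_moment:
  assumes ws: "weight_sys Q (real s) K1 K2 \<tau>" and s: "odd s"
    and l: "even (fst l + snd l)" "2 * K1 \<le> int (fst l + snd l)" "int (fst l + snd l) \<le> 2 * K2"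
  shows "(\<Sum>(\<mu>, \<nu>)\<in>stencil K1 K2. mon l (of_int \<mu>, of_int \<nu>) * \<tau> (\<mu>, \<nu>)) = - lattice_const s l"
proof -
  obtain k0 where k0: "fst l + snd l = 2 * k0" using l(1) by blast
  let ?k = "int k0" and ?l = "int (snd l)"
  have nt: "nat (2 * ?k - ?l) = fst l" "nat ?l = snd l" using k0 by auto
  have "K1 \<le> ?k \<and> ?k \<le> K2 \<and> 0 \<le> ?l \<and> ?l \<le> 2 * ?k" using k0 l(2,3) by auto
  then have "(\<Sum>(\<mu>, \<nu>) \<in> stencil K1 K2. of_int \<mu> ^ nat (2 * ?k - ?l) * of_int \<nu> ^ nat ?l * \<tau> (\<mu>, \<nu>))
        = - wigner Q (real s) (\<lambda>u. fst u ^ nat (2 * ?k - ?l) * snd u ^ nat ?l)"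
    using ws unfolding weight_sys_def by blast
  moreover have "(\<lambda>u. fst u ^ fst l * snd u ^ snd l) = mon l" by (simp add: mon_def split_beta)
  ultimately have "(\<Sum>(\<mu>, \<nu>) \<in> stencil K1 K2. of_int \<mu> ^ fst l * of_int \<nu> ^ snd l * \<tau> (\<mu>, \<nu>)) = - lattice_const s l"
    unfolding nt using wigner_lattice_const[OF s, of l] by simp
  then show ?thesis by (simp add: mon_def split_beta)
qed

text \<open>A monomial evaluated on the scaled stencil produces the same power of \<open>h\<close>
  as its quadrature error, so a stencil moment is compared with a lattice constant. By
  \<open>I1\<close> and \<open>I2\<close>, even degrees outside the moment conditions either do not
  occur or already carry h^P.\<close>

lemma stencil_correction:
  fixes ft R :: "real \<times> real \<Rightarrow> real" and tc :: "nat \<times> nat \<Rightarrow> real"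
  assumes a: "a > 0" and ws: "weight_sys Q (real s) K1 K2 \<tau>" and s: "odd s" and I: "finite I"
    and R: "smooth_on UNIV R" "vanish n R" "\<And>u. ft u = (\<Sum>l\<in>I. tc l * mon l u) + R u"
    and I1: "\<And>l. l \<in> I \<Longrightarrow> even (fst l + snd l) \<Longrightarrow> 2 * K1 \<le> int (fst l + snd l)"
    and I2: "\<And>l. l \<in> I \<Longrightarrow> even (fst l + snd l) \<Longrightarrow> 2 * K2 < int (fst l + snd l) \<Longrightarrow> real P \<le> dg s l + 2"
    and n: "real P \<le> real n - real s + 2"
  shows "(\<lambda>N. (\<Sum>(\<mu>, \<nu>)\<in>stencil K1 K2. ft (of_int \<mu> * (a / real N), of_int \<nu> * (a / real N)) * \<tau> (\<mu>, \<nu>))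
      * (a / real N) powr (2 - real s) + (\<Sum>l\<in>I. tc l * ((a / real N) powr (dg s l + 2) * lattice_const s l)))
    \<in> O[sequentially](\<lambda>N. (a / real N) ^ P)"
proof -
  define S where "S l = (\<Sum>(\<mu>, \<nu>)\<in>stencil K1 K2. mon l (of_int \<mu>, of_int \<nu>) * \<tau> (\<mu>, \<nu>))" for l
  have 1: "(\<lambda>N. tc l * ((a / real N) powr (dg s l + 2) * (S l + lattice_const s l))) \<in> O[sequentially](\<lambda>N. (a / real N) ^ P)"
    if l: "l \<in> I" for l
  proof -
    \<comment> \<open>In odd degree both moment and constant vanish; in even degree up to 2 K2 they
      cancel; above that nothing cancels, but the order is P.\<close>
    consider "odd (fst l + snd l)" | "even (fst l + snd l)" "int (fst l + snd l) \<le> 2 * K2" |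
      "even (fst l + snd l)" "2 * K2 < int (fst l + snd l)" by linarith
    then show ?thesis
    proof cases
      case 1
      have "S l = 0" unfolding S_def
        by (rule stencil_odd_moment[OF _ 1]) (use ws in \<open>auto simp: weight_sys_def\<close>)
      then show ?thesis using lattice_const_odd[OF 1] by simp
    next
      case 2
      have "S l = - lattice_const s l" unfolding S_def
        by (rule stencil_moment[OF ws s 2(1) I1[OF l 2(1)] 2(2)])
      then show ?thesis by simp
    next
      case 3
      have "(\<lambda>N. (tc l * (S l + lattice_const s l)) * (a / real N) powr (dg s l + 2)) \<in> O[sequentially](\<lambda>N. (a / real N) ^ P)"
        by (rule bigo_cmult[OF powr_bigo[OF a I2[OF l 3]]])
      then show ?thesis by (simp only: mult_ac)
    qed
  qed
  \<comment> \<open>Stencil points shrink with the mesh, so the Taylor remainder is of order h^n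
    there; h \<le> a keeps them in one fixed square.\<close>
  have 2: "(\<lambda>N. R (of_int \<mu> * (a / real N), of_int \<nu> * (a / real N)) * \<tau> (\<mu>, \<nu>) * (a / real N) powr (2 - real s))
      \<in> O[sequentially](\<lambda>N. (a / real N) ^ P)" for \<mu> \<nu>
  proof -
    define v :: "real \<times> real" where "v = (of_int \<mu>, of_int \<nu>)"
    obtain C where C: "\<And>u. mnorm u \<le> a * mnorm v \<Longrightarrow> \<bar>R u\<bar> \<le> C * mnorm u ^ n"
      using vanish_bound[OF R(1,2)] by blast
    have "(\<lambda>N. R (of_int \<mu> * (a / real N), of_int \<nu> * (a / real N)) * \<tau> (\<mu>, \<nu>) * (a / real N) powr (2 - real s))
        \<in> O[sequentially](\<lambda>N. (a / real N) powr (real n - real s + 2))"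
    proof (rule bigoI[of _ "\<bar>\<tau> (\<mu>, \<nu>)\<bar> * (C * mnorm v ^ n)"])
      show "\<forall>\<^sub>F N in sequentially. norm (R (of_int \<mu> * (a / real N), of_int \<nu> * (a / real N)) * \<tau> (\<mu>, \<nu>) * (a / real N) powr (2 - real s))
          \<le> \<bar>\<tau> (\<mu>, \<nu>)\<bar> * (C * mnorm v ^ n) * norm ((a / real N) powr (real n - real s + 2))"
        using eventually_gt_at_top[of 0]
      proof eventually_elim
        case (elim N)
        define h where "h = a / real N"
        have h: "h > 0" "h \<le> a" using elim a by (auto simp: h_def field_simps)
        have m: "mnorm (of_int \<mu> * h, of_int \<nu> * h) = h * mnorm v"
          using mnorm_scale[of h v] h by (simp add: v_def mult.commute)
        have "h * mnorm v \<le> a * mnorm v" using h by (intro mult_right_mono) auto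
        then have "\<bar>R (of_int \<mu> * h, of_int \<nu> * h)\<bar> \<le> C * (h * mnorm v) ^ n"
          using C[of "(of_int \<mu> * h, of_int \<nu> * h)"] m by simp
        then have "\<bar>R (of_int \<mu> * h, of_int \<nu> * h)\<bar> * (\<bar>\<tau> (\<mu>, \<nu>)\<bar> * h powr (2 - real s))
            \<le> C * (h * mnorm v) ^ n * (\<bar>\<tau> (\<mu>, \<nu>)\<bar> * h powr (2 - real s))"
          by (intro mult_right_mono) auto
        moreover have "h powr (real n - real s + 2) = h ^ n * h powr (2 - real s)"
        proof -
          have "real n - real s + 2 = real n + (2 - real s)" by simp
          then show ?thesis using h by (simp only: powr_add powr_realpow)
        qed
        ultimately show ?case
          using h unfolding h_def[symmetric] by (simp add: abs_mult power_mult_distrib mult_ac)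
      qed
    qed
    also have "(\<lambda>N. (a / real N) powr (real n - real s + 2)) \<in> O[sequentially](\<lambda>N. (a / real N) ^ P)"
      by (rule powr_bigo[OF a n])
    finally show ?thesis .
  qed
  have "(\<lambda>N. (\<Sum>l\<in>I. tc l * ((a / real N) powr (dg s l + 2) * (S l + lattice_const s l))) +
     (\<Sum>y\<in>stencil K1 K2. R (of_int (fst y) * (a / real N), of_int (snd y) * (a / real N)) * \<tau> (fst y, snd y) * (a / real N) powr (2 - real s)))
     \<in> O[sequentially](\<lambda>N. (a / real N) ^ P)"
    by (intro sum_in_bigo big_sum_in_bigo 1 2)
  also have "?this \<longleftrightarrow> ?thesis"
  proof (rule landau_o.big.in_cong)
    show "\<forall>\<^sub>F N in sequentially. (\<Sum>l\<in>I. tc l * ((a / real N) powr (dg s l + 2) * (S l + lattice_const s l))) +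
     (\<Sum>y\<in>stencil K1 K2. R (of_int (fst y) * (a / real N), of_int (snd y) * (a / real N)) * \<tau> (fst y, snd y) * (a / real N) powr (2 - real s)) =
     (\<Sum>(\<mu>, \<nu>)\<in>stencil K1 K2. ft (of_int \<mu> * (a / real N), of_int \<nu> * (a / real N)) * \<tau> (\<mu>, \<nu>))
      * (a / real N) powr (2 - real s) + (\<Sum>l\<in>I. tc l * ((a / real N) powr (dg s l + 2) * lattice_const s l))"
      using eventually_gt_at_top[of 0]
    proof eventually_elim
      case (elim N)
      define h where "h = a / real N"
      have h: "h > 0" using elim a by (auto simp: h_def)
      have pw: "h ^ (fst l + snd l) * h powr (2 - real s) = h powr (dg s l + 2)" for l
      proof -
        have "dg s l + 2 = real (fst l + snd l) + (2 - real s)" by simp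
        then show ?thesis using h by (simp only: powr_add powr_realpow)
      qed
      have ml: "mon l (of_int \<mu> * h, of_int \<nu> * h) = h ^ (fst l + snd l) * mon l (of_int \<mu>, of_int \<nu>)" for l \<mu> \<nu>
        using mon_scale[of l h "(of_int \<mu>, of_int \<nu>)"] by (simp add: mult.commute)
      have "(\<Sum>(\<mu>, \<nu>)\<in>stencil K1 K2. ft (of_int \<mu> * h, of_int \<nu> * h) * \<tau> (\<mu>, \<nu>)) * h powr (2 - real s) =
        (\<Sum>y\<in>stencil K1 K2. (\<Sum>l\<in>I. tc l * h powr (dg s l + 2) * (mon l (of_int (fst y), of_int (snd y)) * \<tau> (fst y, snd y)))
          + R (of_int (fst y) * h, of_int (snd y) * h) * \<tau> (fst y, snd y) * h powr (2 - real s))"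
        unfolding sum_distrib_right
      proof (intro sum.cong refl)
        fix y
        show "(case y of (\<mu>, \<nu>) \<Rightarrow> ft (of_int \<mu> * h, of_int \<nu> * h) * \<tau> (\<mu>, \<nu>)) * h powr (2 - real s) =
          (\<Sum>l\<in>I. tc l * h powr (dg s l + 2) * (mon l (of_int (fst y), of_int (snd y)) * \<tau> (fst y, snd y)))
          + R (of_int (fst y) * h, of_int (snd y) * h) * \<tau> (fst y, snd y) * h powr (2 - real s)"
          unfolding split_beta R(3) ml pw[symmetric]
          by (simp add: distrib_right distrib_left sum_distrib_right sum_distrib_left mult_ac)
      qed
      also have "\<dots> = (\<Sum>l\<in>I. tc l * (h powr (dg s l + 2) * S l)) +
          (\<Sum>y\<in>stencil K1 K2. R (of_int (fst y) * h, of_int (snd y) * h) * \<tau> (fst y, snd y) * h powr (2 - real s))"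
        unfolding sum.distrib S_def split_beta by (subst sum.swap) (simp add: sum_distrib_left mult_ac)
      finally show ?case
        unfolding h_def[symmetric] by (simp add: distrib_left sum.distrib)
    qed
  qed
  finally show ?thesis .
qed

end

subsection \<open>The geometry at the origin\<close>

lemma pu_component:
  fixes \<rho> :: "real \<times> real \<Rightarrow> real ^ 'n"
  assumes "\<And>u. \<rho> differentiable (at u)"
  shows "pu (\<lambda>u. \<rho> u $ i) = (\<lambda>u. pu \<rho> u $ i)" "pv (\<lambda>u. \<rho> u $ i) = (\<lambda>u. pv \<rho> u $ i)"
proof -
  have bl: "bounded_linear (\<lambda>x :: real ^ 'n. x $ i)" by (rule bounded_linear_vec_nth)
  show "pu (\<lambda>u. \<rho> u $ i) = (\<lambda>u. pu \<rho> u $ i)" "pv (\<lambda>u. \<rho> u $ i) = (\<lambda>u. pv \<rho> u $ i)"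
    using bounded_linear.has_vector_derivative[OF bl has_partial_vector(1)[OF assms]]
      bounded_linear.has_vector_derivative[OF bl has_partial_vector(2)[OF assms]]
    by (auto intro!: pu_eqI pv_eqI simp: has_real_derivative_iff_has_vector_derivative)
qed

lemma smooth_component:
  fixes \<rho> :: "real \<times> real \<Rightarrow> real ^ 'n"
  assumes "smooth_on UNIV \<rho>"
  shows "smooth_on UNIV (\<lambda>u. \<rho> u $ i)"
proof -
  have "kdiff_on UNIV K (\<lambda>u. \<rho> u $ i)" if "smooth_on UNIV \<rho>" for K and \<rho> :: "real \<times> real \<Rightarrow> real ^ 'n"
    using that
  proof (induction K arbitrary: \<rho>)
    case (Suc K)
    have d: "\<rho> differentiable (at u)" for u using smooth_differentiable[OF Suc.prems] by simp
    have "(\<lambda>u. \<rho> u $ i) differentiable (at u)" for u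
    proof -
      obtain D where "(\<rho> has_derivative D) (at u)" using d[of u] unfolding differentiable_def by blast
      from bounded_linear.has_derivative[OF bounded_linear_vec_nth this] show ?thesis
        by (rule differentiableI)
    qed
    then show ?case
      unfolding kdiff_on_Suc pu_component[OF d]
      using Suc.IH[OF smooth_on_pu[OF Suc.prems]] Suc.IH[OF smooth_on_pv[OF Suc.prems]] by auto
  qed simp
  then show ?thesis using assms by (simp add: smooth_on_iff_kdiff_on)
qed

text \<open>The squared length of the linear part of \<rho>, written by components for comparison
  with \<open>rdist_sum\<close>.\<close>

lemma fff_sum: "fff \<rho> u = (\<Sum>i\<in>UNIV. (rho_u \<rho> $ i * fst u + rho_v \<rho> $ i * snd u) ^ 2)"
  unfolding fff_def inner_vec_def
  by (simp add: sum_distrib_left sum_distrib_right sum.distrib power2_eq_square algebra_simps)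

lemma rdist_sum: "rdist \<rho> u ^ 2 = (\<Sum>i\<in>UNIV. (\<rho> u $ i - \<rho> (0, 0) $ i) ^ 2)"
proof -
  have "rdist \<rho> u ^ 2 = (\<rho> u - \<rho> (0, 0)) \<bullet> (\<rho> u - \<rho> (0, 0))"
    unfolding rdist_def by (rule power2_norm_eq_inner)
  then show ?thesis by (simp add: inner_vec_def power2_eq_square)
qed

lemma smooth_rdist_sq:
  assumes "smooth_on UNIV \<rho>"
  shows "smooth_on UNIV (\<lambda>u. rdist \<rho> u ^ 2)"
  unfolding rdist_sum by (intro smooth_intros smooth_component assms) auto

text \<open>By components, f^2 - L^2 = (f - L)(f - L + 2L) with f - L of order 2 and L of order 1.
  The resulting exponent 3 is the source of 3m/2 in \<open>K1m\<close>.\<close>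

lemma rdist_fff_bound:
  assumes \<rho>: "smooth_on UNIV \<rho>"
  shows "\<exists>C. \<forall>u. mnorm u < 1 \<longrightarrow> \<bar>rdist \<rho> u ^ 2 - fff \<rho> u\<bar> \<le> C * mnorm u ^ 3"
proof -
  define L where "L i u = rho_u \<rho> $ i * fst u + rho_v \<rho> $ i * snd u" for i u
  define f where "f i u = \<rho> u $ i - \<rho> (0, 0) $ i" for i u
  have d: "\<rho> differentiable (at u)" for u using smooth_differentiable[OF \<rho>] by simp
  have sf: "smooth_on UNIV (f i)" for i
    unfolding f_def[abs_def] by (intro smooth_intros smooth_component \<rho>)
  have sL: "smooth_on UNIV (L i)" for i unfolding L_def[abs_def] by (intro smooth_intros)
  have "pu (f i) (0, 0) = rho_u \<rho> $ i" "pv (f i) (0, 0) = rho_v \<rho> $ i" for i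
  proof -
    have "(\<lambda>u. \<rho> u $ i) differentiable (at u)" for u
      using smooth_differentiable[OF smooth_component[OF \<rho>]] by simp
    then show "pu (f i) (0, 0) = rho_u \<rho> $ i" "pv (f i) (0, 0) = rho_v \<rho> $ i"
      unfolding f_def[abs_def] by (simp_all add: pu_diff pv_diff pu_component[OF d] rho_u_def rho_v_def)
  qed
  moreover have "low_degrees 2 = {(0, 0), (1, 0), (0, 1)}" by (auto simp: low_degrees_def)
  ultimately have tay: "taylor 2 (f i) u = L i u" for i u
    unfolding taylor_def by (simp add: tcoeff_def mon_def L_def f_def)
  have "\<exists>C. \<forall>u. mnorm u \<le> 1 \<longrightarrow> \<bar>f i u - L i u\<bar> \<le> C * mnorm u ^ 2" for i
    using vanish_bound[where r = 1, OF smooth_diff[OF sf[of i] smooth_taylor] vanish_taylor[OF sf[of i], of 2]]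
    by (simp add: tay)
  then obtain C where C: "\<And>i u. mnorm u \<le> 1 \<Longrightarrow> \<bar>f i u - L i u\<bar> \<le> C i * mnorm u ^ 2" by metis
  define B where "B i = \<bar>rho_u \<rho> $ i\<bar> + \<bar>rho_v \<rho> $ i\<bar>" for i
  have LB: "\<bar>L i u\<bar> \<le> B i * mnorm u" for i u
  proof -
    have "\<bar>L i u\<bar> \<le> \<bar>rho_u \<rho> $ i\<bar> * \<bar>fst u\<bar> + \<bar>rho_v \<rho> $ i\<bar> * \<bar>snd u\<bar>"
      unfolding L_def abs_mult[symmetric] by (rule abs_triangle_ineq)
    also have "\<dots> \<le> \<bar>rho_u \<rho> $ i\<bar> * mnorm u + \<bar>rho_v \<rho> $ i\<bar> * mnorm u"
      by (intro add_mono mult_left_mono fst_le_mnorm snd_le_mnorm) auto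
    finally show ?thesis by (simp add: B_def distrib_right)
  qed
  have "\<bar>rdist \<rho> u ^ 2 - fff \<rho> u\<bar> \<le> (\<Sum>i\<in>UNIV. \<bar>C i\<bar> * (\<bar>C i\<bar> + 2 * B i)) * mnorm u ^ 3" if u: "mnorm u < 1" for u
  proof -
    have "rdist \<rho> u ^ 2 - fff \<rho> u = (\<Sum>i\<in>UNIV. (f i u - L i u) * ((f i u - L i u) + 2 * L i u))"
      unfolding rdist_sum fff_sum sum_subtractf[symmetric] f_def L_def
      by (intro sum.cong refl) (simp add: power2_eq_square algebra_simps)
    also have "\<bar>\<dots>\<bar> \<le> (\<Sum>i\<in>UNIV. \<bar>C i\<bar> * mnorm u ^ 2 * ((\<bar>C i\<bar> + 2 * B i) * mnorm u))"
    proof (rule order_trans[OF sum_abs], rule sum_mono, unfold abs_mult, rule mult_mono)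
      fix i
      have w: "\<bar>f i u - L i u\<bar> \<le> C i * mnorm u ^ 2" using C u by simp
      also have "\<dots> \<le> \<bar>C i\<bar> * mnorm u ^ 2" by (intro mult_right_mono) auto
      finally show w: "\<bar>f i u - L i u\<bar> \<le> \<bar>C i\<bar> * mnorm u ^ 2" .
      have "mnorm u ^ 2 \<le> mnorm u" using u mult_left_le[of "mnorm u" "mnorm u"] by (simp add: power2_eq_square)
      then have "\<bar>C i\<bar> * mnorm u ^ 2 \<le> \<bar>C i\<bar> * mnorm u" by (intro mult_left_mono) auto
      then show "\<bar>f i u - L i u + 2 * L i u\<bar> \<le> (\<bar>C i\<bar> + 2 * B i) * mnorm u"
        using w LB[of i u] by (simp add: distrib_right)
    qed auto
    also have "\<dots> = (\<Sum>i\<in>UNIV. \<bar>C i\<bar> * (\<bar>C i\<bar> + 2 * B i)) * mnorm u ^ 3"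
      by (simp add: sum_distrib_right sum_distrib_left power2_eq_square power3_eq_cube mult_ac)
    finally show ?thesis .
  qed
  then show ?thesis by blast
qed

text \<open>Off the origin the form is the squared norm of a nontrivial combination of independent
  vectors. Compactness of the unit sphere of \<open>mnorm\<close> and homogeneity turn positivity
  into the uniform bound demanded by \<open>posquad\<close>.\<close>

lemma posquad_fff:
  assumes ind: "\<forall>c1 c2. c1 *\<^sub>R rho_u \<rho> + c2 *\<^sub>R rho_v \<rho> = 0 \<longrightarrow> c1 = 0 \<and> c2 = 0"
  obtains c where "posquad (fff \<rho>) (rho_u \<rho> \<bullet> rho_u \<rho>) (rho_u \<rho> \<bullet> rho_v \<rho>) (rho_v \<rho> \<bullet> rho_v \<rho>) c"
proof -
  have pos: "fff \<rho> u > 0" if "u \<noteq> (0, 0)" for u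
  proof -
    let ?w = "fst u *\<^sub>R rho_u \<rho> + snd u *\<^sub>R rho_v \<rho>"
    have "?w \<noteq> 0" using ind that by (metis prod.collapse)
    then have "?w \<bullet> ?w > 0" by simp
    moreover have "?w \<bullet> ?w = fff \<rho> u"
      by (simp add: fff_def inner_add_left inner_add_right inner_commute power2_eq_square algebra_simps)
    ultimately show ?thesis by simp
  qed
  have comp: "compact {u. mnorm u = 1}"
  proof -
    have "{u. mnorm u = 1} = {u. mnorm u \<le> 1} \<inter> {u. 1 \<le> mnorm u}" by auto
    moreover have "closed {u. 1 \<le> mnorm u}" by (intro closed_Collect_le continuous_intros)
    ultimately show ?thesis by (simp add: compact_Int_closed)
  qed
  have ne: "{u. mnorm u = 1} \<noteq> {}"
  proof -
    have "mnorm (1, 0) = 1" by (simp add: mnorm_def)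
    then show ?thesis by blast
  qed
  have "continuous_on {u. mnorm u = 1} (fff \<rho>)"
    unfolding fff_def[abs_def] by (intro continuous_intros)
  from continuous_attains_inf[OF comp ne this] obtain w
    where w: "mnorm w = 1" "\<And>u. mnorm u = 1 \<Longrightarrow> fff \<rho> w \<le> fff \<rho> u" by auto
  have "w \<noteq> (0, 0)" using w(1) by auto
  then have c: "fff \<rho> w > 0" by (rule pos)
  have "fff \<rho> w * mnorm u ^ 2 \<le> fff \<rho> u" for u
  proof (cases "u = (0, 0)")
    case True
    then show ?thesis by (simp add: fff_def)
  next
    case False
    define m where "m = mnorm u"
    have m: "m > 0" using mnorm_pos[OF False] by (simp add: m_def)
    have "mnorm ((1 / m) * fst u, (1 / m) * snd u) = 1"
      using mnorm_scale[of "1 / m" u] m False by (simp add: m_def)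
    moreover have "fff \<rho> ((1 / m) * fst u, (1 / m) * snd u) = fff \<rho> u / m ^ 2"
      unfolding fff_def by (simp add: power2_eq_square add_divide_distrib)
    ultimately have "fff \<rho> w \<le> fff \<rho> u / m ^ 2" using w(2) by metis
    then show ?thesis using m unfolding m_def[symmetric] by (simp add: pos_le_divide_eq)
  qed
  then have "posquad (fff \<rho>) (rho_u \<rho> \<bullet> rho_u \<rho>) (rho_u \<rho> \<bullet> rho_v \<rho>) (rho_v \<rho> \<bullet> rho_v \<rho>) (fff \<rho> w)"
    using c by unfold_locales (auto simp: fff_def)
  then show ?thesis by (rule that)
qed

subsection \<open>The corrected trapezoidal rule\<close>

text \<open>\<open>vector_derivative\<close> is a choice operator, so equivalence of the defining
  predicates at both points suffices, even where no derivative exists.\<close>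

lemma vector_derivative_periodic:
  fixes f :: "real \<Rightarrow> real"
  assumes "\<And>t. f (t + c) = f t"
  shows "vector_derivative f (at (x + c)) = vector_derivative f (at x)"
proof -
  have "(f has_vector_derivative d) (at (x + c)) \<longleftrightarrow> (f has_vector_derivative d) (at x)" for d
    using DERIV_shift[of f d x c] assms by (simp add: has_real_derivative_iff_has_vector_derivative)
  then show ?thesis unfolding vector_derivative_def by simp
qed

lemma iter_periodic:
  fixes G :: "real \<times> real \<Rightarrow> real"
  assumes "\<And>x y. G (x + c, y) = G (x, y)" "\<And>x y. G (x, y + c) = G (x, y)"
  shows "(pu ^^ j) G (x + c, y) = (pu ^^ j) G (x, y)" "(pv ^^ j) G (x, y + c) = (pv ^^ j) G (x, y)"
proof (induction j arbitrary: x y)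
  case (Suc j)
  { case 1 show ?case using vector_derivative_periodic[of "\<lambda>t. (pu ^^ j) G (t, y)" c x, OF Suc.IH(1)] by (simp add: pu_def[of "(pu ^^ j) G"]) }
  { case 2 show ?case using vector_derivative_periodic[of "\<lambda>t. (pv ^^ j) G (x, t)" c y, OF Suc.IH(2)] by (simp add: pv_def[of "(pv ^^ j) G"]) }
qed (use assms in auto)

text \<open>At \<open>rdist \<rho> u = 0\<close> both sides vanish, since \<open>0 powr x = 0\<close>.\<close>

lemma rdist_power_eq: "odd p \<Longrightarrow> rdist \<rho> u ^ p = (rdist \<rho> u ^ 2) powr (real p / 2)"
proof -
  assume "odd p"
  then have p: "p > 0" by (cases p) auto
  have r: "rdist \<rho> u \<ge> 0" by (simp add: rdist_def)
  show ?thesis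
  proof (cases "rdist \<rho> u = 0")
    case True
    then show ?thesis using p by (simp add: power_0_left)
  next
    case False
    then have "rdist \<rho> u > 0" using r by simp
    then have "(rdist \<rho> u ^ 2) powr (real p / 2) = (rdist \<rho> u powr 2) powr (real p / 2)" by simp
    also have "\<dots> = rdist \<rho> u powr real p" unfolding powr_powr by simp
    finally show ?thesis using \<open>rdist \<rho> u > 0\<close> by (simp add: powr_realpow)
  qed
qed

text \<open>Provides one function for both alternatives on \<phi>, regular beyond the boundary of
  the square. The size 2a is dictated by the periodic alternative, where the nearest other possible
  singularities of \<open>G\<close> have \<open>mnorm\<close> 2a.\<close>

lemma integrand_model:
  assumes a: "a > 0" and \<rho>: "smooth_on UNIV \<rho>" and \<phi>: "smooth_on UNIV \<phi>" and p: "odd p"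
    and inj: "\<forall>u. mnorm u \<le> a \<and> u \<noteq> (0, 0) \<longrightarrow> \<rho> u \<noteq> \<rho> (0, 0)"
    and cases: "closure {u. \<phi> u \<noteq> 0} \<subseteq> {-a<..<a} \<times> {-a<..<a}
         \<or> (\<exists>G :: real \<times> real \<Rightarrow> real.
              (\<forall>x y. G (x + 2 * a, y) = G (x, y) \<and> G (x, y + 2 * a) = G (x, y))
            \<and> smooth_on (UNIV - {u. \<exists>i j :: int. u = (2 * a * of_int i, 2 * a * of_int j)}) G
            \<and> (\<forall>u. mnorm u \<le> a \<and> u \<noteq> (0, 0) \<longrightarrow> G u = \<phi> u / rdist \<rho> u ^ p))"
  shows "\<exists>g. (\<forall>K. kdiff_on {u. u \<noteq> (0, 0) \<and> mnorm u < 2 * a} K g) \<and> (\<forall>K. matched K a g) \<and>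
    (\<forall>u. mnorm u \<le> a \<and> u \<noteq> (0, 0) \<longrightarrow> g u = \<phi> u / rdist \<rho> u ^ p)"
  using cases
proof
  assume supp: "closure {u. \<phi> u \<noteq> 0} \<subseteq> {-a<..<a} \<times> {-a<..<a}"
  define g where "g u = \<phi> u / rdist \<rho> u ^ p" for u
  define r2 where "r2 u = rdist \<rho> u ^ 2" for u
  have r2s: "smooth_on UNIV r2" unfolding r2_def[abs_def] by (rule smooth_rdist_sq[OF \<rho>])
  let ?U1 = "{u. 0 < r2 u}" and ?U2 = "- closure {u. \<phi> u \<noteq> 0}"
  have o1: "open ?U1" by (intro open_Collect_less continuous_on_const smooth_continuous[OF r2s])
  have o2: "open ?U2" by auto
  interpret u1: grading ?U1 "\<lambda>_ _. True" by (rule grading_trivial[OF o1])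
  interpret u2: grading ?U2 "\<lambda>_ _. True" by (rule grading_trivial[OF o2])
  have ph: "kdiff_on ?U1 K \<phi>" "kdiff_on ?U1 K r2" for K
    using \<phi> r2s kdiff_on_subset[of UNIV] by (auto simp: smooth_on_iff_kdiff_on)
  have "kdiff_on ?U1 K (\<lambda>u. r2 u powr (- (real p / 2)))" for K
    by (rule kdiff_on_powr[OF o1 ph(2)]) simp
  from u1.graded_mult[OF ph(1) this] have "kdiff_on ?U1 K (\<lambda>u. \<phi> u * r2 u powr (- (real p / 2)))" for K by simp
  then have 1: "kdiff_on ?U1 K g" for K
    by (rule u1.graded_cong[rotated]) (simp add: g_def r2_def rdist_power_eq[OF p] powr_minus_divide)
  have g0: "g u = 0" if "u \<in> ?U2" for u
  proof -
    have "u \<notin> {u. \<phi> u \<noteq> 0}" using that closure_subset[of "{u. \<phi> u \<noteq> 0}"] by auto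
    then show ?thesis by (simp add: g_def)
  qed
  have 2: "kdiff_on ?U2 K g" for K
    by (rule u2.graded_cong[OF _ u2.graded_zero]) (use g0 in auto)
  \<comment> \<open>Outside [-a, a]^2 the surface may return to its base point, so r may vanish
    there; but such points lie off the closed support of \<phi>.\<close>
  have sub: "{u. u \<noteq> (0, 0) \<and> mnorm u < 2 * a} \<subseteq> ?U1 \<union> ?U2"
  proof
    fix u assume u: "u \<in> {u. u \<noteq> (0, 0) \<and> mnorm u < 2 * a}"
    show "u \<in> ?U1 \<union> ?U2"
    proof (cases "u \<in> ?U2")
      case False
      then have "u \<in> {-a<..<a} \<times> {-a<..<a}" using supp by blast
      then have "mnorm u \<le> a" by (auto simp: mnorm_def)
      then have "\<rho> u \<noteq> \<rho> (0, 0)" using inj u by blast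
      then show ?thesis by (simp add: r2_def rdist_def)
    qed simp
  qed
  have "kdiff_on {u. u \<noteq> (0, 0) \<and> mnorm u < 2 * a} K g" for K
    by (rule kdiff_on_subset[OF kdiff_on_Un[OF 1 2] sub])
  moreover have "matched K a g" for K
    unfolding matched_def
  proof (intro allI impI ballI)
    fix j t assume "t \<in> {-a..a}"
    have "(a, t) \<in> ?U2" "(-a, t) \<in> ?U2" "(t, a) \<in> ?U2" "(t, -a) \<in> ?U2" using supp by auto
    note * = this
    have it: "(pu ^^ j) g v = 0 \<and> (pv ^^ j) g v = 0" if "v \<in> ?U2" for v
      by (rule iter_zero_open[OF o2 g0 that])
    show "(pu ^^ j) g (a, t) = (pu ^^ j) g (-a, t) \<and> (pv ^^ j) g (t, a) = (pv ^^ j) g (t, -a)"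
      using it[OF *(1)] it[OF *(2)] it[OF *(3)] it[OF *(4)] by simp
  qed
  ultimately show ?thesis by (intro exI[of _ g]) (auto simp: g_def simp del: graded.simps)
next
  assume "\<exists>G :: real \<times> real \<Rightarrow> real.
              (\<forall>x y. G (x + 2 * a, y) = G (x, y) \<and> G (x, y + 2 * a) = G (x, y))
            \<and> smooth_on (UNIV - {u. \<exists>i j :: int. u = (2 * a * of_int i, 2 * a * of_int j)}) G
            \<and> (\<forall>u. mnorm u \<le> a \<and> u \<noteq> (0, 0) \<longrightarrow> G u = \<phi> u / rdist \<rho> u ^ p)"
  then obtain G :: "real \<times> real \<Rightarrow> real" where per: "\<And>x y. G (x + 2 * a, y) = G (x, y)" "\<And>x y. G (x, y + 2 * a) = G (x, y)"
    and sm: "smooth_on (UNIV - {u. \<exists>i j :: int. u = (2 * a * of_int i, 2 * a * of_int j)}) G"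
    and G: "\<forall>u. mnorm u \<le> a \<and> u \<noteq> (0, 0) \<longrightarrow> G u = \<phi> u / rdist \<rho> u ^ p" by blast
  have sub: "{u. u \<noteq> (0, 0) \<and> mnorm u < 2 * a} \<subseteq> UNIV - {u. \<exists>i j :: int. u = (2 * a * of_int i, 2 * a * of_int j)}"
  proof (intro subsetI DiffI UNIV_I notI)
    fix u assume u: "u \<in> {u. u \<noteq> (0, 0) \<and> mnorm u < 2 * a}" "u \<in> {u. \<exists>i j :: int. u = (2 * a * of_int i, 2 * a * of_int j)}"
    then obtain i j :: int where ij: "u = (2 * a * of_int i, 2 * a * of_int j)" by blast
    have small: "n = 0" if "\<bar>2 * a * of_int n\<bar> < 2 * a" for n :: int
    proof -
      have "2 * a * real_of_int \<bar>n\<bar> < 2 * a * 1" using that a by (simp add: abs_mult)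
      then have "real_of_int \<bar>n\<bar> < 1" using a by (simp only: mult_less_cancel_left_pos)
      then show ?thesis by linarith
    qed
    have "\<bar>2 * a * of_int i\<bar> < 2 * a" "\<bar>2 * a * of_int j\<bar> < 2 * a" using u(1) unfolding ij mnorm_def by auto
    then have "i = 0" "j = 0" using small by blast+
    then show False using u(1) ij by simp
  qed
  have "kdiff_on {u. u \<noteq> (0, 0) \<and> mnorm u < 2 * a} K G" for K
    using sm kdiff_on_subset[OF _ sub] by (auto simp: smooth_on_iff_kdiff_on)
  moreover have "matched K a G" for K
    unfolding matched_def
  proof (intro allI impI ballI)
    fix j t
    show "(pu ^^ j) G (a, t) = (pu ^^ j) G (-a, t) \<and> (pv ^^ j) G (t, a) = (pv ^^ j) G (t, -a)"
      using iter_periodic(1)[of G "2 * a" j "-a" t, OF per] iter_periodic(2)[of G "2 * a" j t "-a", OF per] by simp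
  qed
  ultimately show ?thesis using G by (intro exI[of _ G]) (auto simp del: graded.simps)
qed

lemma bigo_origin_bound:
  assumes "\<phi> \<in> O[at (0, 0)](\<lambda>u. mnorm u ^ n)"
  shows "\<exists>r C. r > 0 \<and> (\<forall>u\<in>punctured r. \<bar>\<phi> u\<bar> \<le> C * mnorm u ^ n)"
proof -
  obtain C where "eventually (\<lambda>u. norm (\<phi> u) \<le> C * norm (mnorm u ^ n)) (at (0, 0))"
    using assms by (elim landau_o.bigE)
  then obtain d where d: "d > 0" "\<And>u. u \<noteq> (0, 0) \<Longrightarrow> dist u (0, 0) < d \<Longrightarrow> norm (\<phi> u) \<le> C * norm (mnorm u ^ n)"
    unfolding eventually_at by auto
  have "\<bar>\<phi> u\<bar> \<le> C * mnorm u ^ n" if u: "u \<in> punctured (d / 2)" for u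
  proof -
    have "dist u (0, 0) \<le> \<bar>fst u\<bar> + \<bar>snd u\<bar>"
      using norm_Pair_le[of "fst u" "snd u"] by (simp add: dist_norm zero_prod_def[symmetric])
    also have "\<dots> \<le> mnorm u + mnorm u" by (intro add_mono fst_le_mnorm snd_le_mnorm)
    also have "\<dots> < d" using u by (simp add: punctured_def)
    finally show ?thesis using d(2)[of u] u by (simp add: punctured_def)
  qed
  then show ?thesis using d(1) by (intro exI[of _ "d / 2"] exI[of _ C]) auto
qed

text \<open>With c the ceiling of (P + p)/2 and s = p + 2m, order h^P is reached once d \<ge> 2c +
  2m - 2, which is twice \<open>K2m\<close> plus 2: the first even degree beyond the moment
  conditions. \<open>Mbig\<close> is the last m for which the range from \<open>K1m\<close> to
  \<open>K2m\<close> is nonempty.\<close>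

lemma order_bounds:
  fixes p q P m d :: nat
  assumes "2 * q + 3 * m \<le> d" "even d"
  shows "2 * K1m q (int m) \<le> int d"
    "2 * K2m p P (int m) < int d \<Longrightarrow> real P \<le> real d - real (p + 2 * m) + 2"
    "Mbig p P q < int m \<Longrightarrow> real P \<le> real d - real (p + 2 * m) + 2"
proof -
  define c where "c = \<lceil>(real P + real p) / 2\<rceil>"
  have c: "real P + real p \<le> 2 * real_of_int c"
  proof -
    have "(real P + real p) / 2 \<le> real_of_int c" unfolding c_def by (rule le_of_int_ceiling)
    then show ?thesis by simp
  qed
  obtain k where k: "d = 2 * k" using assms(2) by blast
  have "\<lceil>3 * real_of_int (int m) / 2\<rceil> \<le> int k - int q"
    unfolding ceiling_le_iff using assms(1) by (simp add: k)
  then show "2 * K1m q (int m) \<le> int d" unfolding K1m_def k by simp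
  have fin: "real P \<le> real d - real (p + 2 * m) + 2" if "2 * c + 2 * int m - 2 \<le> int d"
  proof -
    have "real_of_int (2 * c + 2 * int m - 2) \<le> real_of_int (int d)" using that by (simp only: of_int_le_iff)
    then show ?thesis using c by simp
  qed
  show "real P \<le> real d - real (p + 2 * m) + 2" if "2 * K2m p P (int m) < int d"
    by (rule fin, insert that, simp add: K2m_def c_def[symmetric] k, presburger)
  show "real P \<le> real d - real (p + 2 * m) + 2" if "Mbig p P q < int m"
  proof (rule fin)
    \<comment> \<open>Parity gains the missing unit: the inequalities alone give d \<ge> 2c + 2m -
      3, and \<open>d\<close> is even.\<close>
    have "2 * c - 2 * int q - 4 < int m" using that by (simp add: Mbig_def c_def)
    then show "2 * c + 2 * int m - 2 \<le> int d" using assms(1) unfolding k by presburger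
  qed
qed

text \<open>The integral is a finite part because \<phi> / r^p need not be integrable at the origin
  when 2q + 2 < p.\<close>

theorem theorem4:
  fixes a :: real and \<rho> :: "real \<times> real \<Rightarrow> real^3" and \<phi> :: "real \<times> real \<Rightarrow> real"
    and p q P :: nat
  assumes "a > 0"
    and "smooth_on UNIV \<rho>"
    and "\<forall>c1 c2. c1 *\<^sub>R rho_u \<rho> + c2 *\<^sub>R rho_v \<rho> = 0 \<longrightarrow> c1 = 0 \<and> c2 = 0"
    and "\<forall>u. mnorm u \<le> a \<and> u \<noteq> (0, 0) \<longrightarrow> \<rho> u \<noteq> \<rho> (0, 0)"
    and "odd p" and "P > 0"
    and "smooth_on UNIV \<phi>"
    and "closure {u. \<phi> u \<noteq> 0} \<subseteq> {-a<..<a} \<times> {-a<..<a}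
         \<or> (\<exists>G :: real \<times> real \<Rightarrow> real.
              (\<forall>x y. G (x + 2 * a, y) = G (x, y) \<and> G (x, y + 2 * a) = G (x, y))
            \<and> smooth_on (UNIV - {u. \<exists>i j :: int. u = (2 * a * of_int i, 2 * a * of_int j)}) G
            \<and> (\<forall>u. mnorm u \<le> a \<and> u \<noteq> (0, 0) \<longrightarrow> G u = \<phi> u / rdist \<rho> u ^ p))"
    and "\<phi> \<in> O[at (0, 0)](\<lambda>u. mnorm u ^ (2 * q))"
    and "\<forall>m \<in> {0..Mbig p P q}.
           \<exists>!\<tau>. weight_sys (fff \<rho>) (real_of_int (2 * m + int p)) (K1m q m) (K2m p P m) \<tau>"
  shows "(\<lambda>N::nat. fp_integral (\<lambda>u. \<phi> u / rdist \<rho> u ^ p) a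
            - (\<Sum>(i, j) \<in> ({- int N..int N - 1} \<times> {- int N..int N - 1}) - {(0, 0)}.
                 \<phi> (of_int i * (a / real N), of_int j * (a / real N))
                 / rdist \<rho> (of_int i * (a / real N), of_int j * (a / real N)) ^ p
                 * (a / real N) ^ 2)
            - corr \<rho> \<phi> p P q (a / real N))
         \<in> O[sequentially](\<lambda>N. (a / real N) ^ P)"
proof -
  note a = assms(1) and \<rho> = assms(2) and ind = assms(3) and inj = assms(4) and p = assms(5)
    and P = assms(6) and \<phi> = assms(7) and cases = assms(8) and q = assms(9) and uniq = assms(10)
  obtain c where "posquad (fff \<rho>) (rho_u \<rho> \<bullet> rho_u \<rho>) (rho_u \<rho> \<bullet> rho_v \<rho>) (rho_v \<rho> \<bullet> rho_v \<rho>) c"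
    by (rule posquad_fff[OF ind])
  then interpret posquad "fff \<rho>" "rho_u \<rho> \<bullet> rho_u \<rho>" "rho_u \<rho> \<bullet> rho_v \<rho>" "rho_v \<rho> \<bullet> rho_v \<rho>" c .
  \<comment> \<open>The target degree P + 2 exceeds the P + 1 demanded by
    \<open>symbol_class_extend\<close>; \<open>M\<close> lets the binomial remainder reach it. In
    \<open>n\<close>, the part 5M splits into 3M for the starting degrees 2q + 3m and 2M for the
    powers of the quadratic form in the denominators.\<close>
  define M where "M = P + p + 2"
  define n where "n = P + 2 + p + 5 * M + 2 * q"
  define \<beta> where "\<beta> = - real p / 2"
  define ft where "ft m u = (rdist \<rho> u ^ 2 - fff \<rho> u) ^ m * \<phi> u" for m :: nat and u
  define I where "I m = low_degrees n - low_degrees (2 * q + 3 * m)" for m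
  obtain C3 where C3: "\<And>u. mnorm u < 1 \<Longrightarrow> \<bar>rdist \<rho> u ^ 2 - fff \<rho> u\<bar> \<le> C3 * mnorm u ^ 3"
    using rdist_fff_bound[OF \<rho>] by blast
  obtain r Cq where r: "r > 0" "\<And>u. u \<in> punctured r \<Longrightarrow> \<bar>\<phi> u\<bar> \<le> Cq * mnorm u ^ (2 * q)"
    using bigo_origin_bound[OF q] by blast
  have "\<exists>R d0. 0 < d0 \<and> d0 \<le> a / 5 \<and> d0 \<le> 1 \<and>
    symbol_class d0 (Suc P) (real (P + 2)) (\<lambda>u. \<phi> u / (rdist \<rho> u ^ 2) powr (real p / 2) - (\<Sum>(m, l)\<in>Sigma {..<M} I.
      (\<beta> gchoose m) * tcoeff (ft m) l * hom (p + 2 * m) l u)) \<and>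
    (\<forall>m<M. smooth_on UNIV (R m) \<and> vanish n (R m) \<and> (\<forall>u. ft m u =
      (\<Sum>l\<in>I m. tcoeff (ft m) l * mon l u) + R m u))"
    unfolding ft_def[abs_def] I_def[abs_def] \<beta>_def
    by (rule local_expansion[OF smooth_rdist_sq[OF \<rho>] \<phi> C3 r]) (use a in \<open>auto simp: n_def M_def\<close>)
  then obtain R d0 where d0: "0 < d0" "d0 \<le> a / 5" "d0 \<le> 1" and
    loc: "symbol_class d0 (Suc P) (real (P + 2)) (\<lambda>u. \<phi> u / (rdist \<rho> u ^ 2) powr (real p / 2) - (\<Sum>(m, l)\<in>Sigma {..<M} I.
      (\<beta> gchoose m) * tcoeff (ft m) l * hom (p + 2 * m) l u))" and
    R: "\<forall>m<M. smooth_on UNIV (R m) \<and> vanish n (R m) \<and> (\<forall>u. ft m u =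
      (\<Sum>l\<in>I m. tcoeff (ft m) l * mon l u) + R m u)" by (elim exE conjE)
  obtain g where g1: "\<forall>K. kdiff_on {u. u \<noteq> (0, 0) \<and> mnorm u < 2 * a} K g" and g2: "\<forall>K. matched K a g" and
    g: "\<forall>u. mnorm u \<le> a \<and> u \<noteq> (0, 0) \<longrightarrow> g u = \<phi> u / rdist \<rho> u ^ p"
    using integrand_model[OF a \<rho> \<phi> p inj cases] by (elim exE conjE)
  have finI: "finite (I m)" for m by (simp add: I_def)
  interpret gb: grading "punctured d0" "power_bounded d0" by (rule grading_power_bounded[OF d0(3)])
  have g3: "symbol_class d0 (Suc P) (real (P + 2)) (\<lambda>u. g u - (\<Sum>i\<in>Sigma {..<M} I.
      ((\<beta> gchoose fst i) * tcoeff (ft (fst i)) (snd i)) * hom (p + 2 * fst i) (snd i) u))"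
  proof (rule gb.graded_cong[OF _ loc])
    fix u assume u: "u \<in> punctured d0"
    then have "mnorm u \<le> a" "u \<noteq> (0, 0)" using d0 a by (auto simp: punctured_def)
    then have "g u = \<phi> u / rdist \<rho> u ^ p" using g by blast
    then show "\<phi> u / (rdist \<rho> u ^ 2) powr (real p / 2) - (\<Sum>(m, l)\<in>Sigma {..<M} I.
      (\<beta> gchoose m) * tcoeff (ft m) l * hom (p + 2 * m) l u) = g u - (\<Sum>i\<in>Sigma {..<M} I.
      ((\<beta> gchoose fst i) * tcoeff (ft (fst i)) (snd i)) * hom (p + 2 * fst i) (snd i) u)"
      by (simp add: rdist_power_eq[OF p] split_beta)
  qed
  have "\<exists>x C. fp_has g a x \<and> (\<forall>N>0. \<bar>x - (a / real N)\<^sup>2 * (\<Sum>(i, j)\<in>{- int N..int N - 1} \<times> {- int N..int N - 1} - {(0, 0)}.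
        g (of_int i * (a / real N), of_int j * (a / real N)))
      + (\<Sum>i\<in>Sigma {..<M} I. ((\<beta> gchoose fst i) * tcoeff (ft (fst i)) (snd i)) *
          ((a / real N) powr (dg (p + 2 * fst i) (snd i) + 2) * lattice_const (p + 2 * fst i) (snd i)))\<bar> \<le> C * (a / real N) ^ P)"
    by (rule expansion_error[OF a _ P _ _ spec[OF g1] spec[OF g2] d0(1,3,2) g3])
       (use a p finI in auto)
  then obtain x C where x: "fp_has g a x" and C: "\<forall>N>0. \<bar>x - (a / real N)\<^sup>2 * (\<Sum>(i, j)\<in>{- int N..int N - 1} \<times> {- int N..int N - 1} - {(0, 0)}.
        g (of_int i * (a / real N), of_int j * (a / real N)))
      + (\<Sum>i\<in>Sigma {..<M} I. ((\<beta> gchoose fst i) * tcoeff (ft (fst i)) (snd i)) *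
          ((a / real N) powr (dg (p + 2 * fst i) (snd i) + 2) * lattice_const (p + 2 * fst i) (snd i)))\<bar> \<le> C * (a / real N) ^ P"
    by (elim exE conjE)
  define Z where "Z N = (\<Sum>i\<in>Sigma {..<M} I. ((\<beta> gchoose fst i) * tcoeff (ft (fst i)) (snd i)) *
          ((a / real N) powr (dg (p + 2 * fst i) (snd i) + 2) * lattice_const (p + 2 * fst i) (snd i)))" for N :: nat
  define T where "T N = (\<Sum>(i, j)\<in>{- int N..int N - 1} \<times> {- int N..int N - 1} - {(0, 0)}.
        g (of_int i * (a / real N), of_int j * (a / real N)))" for N :: nat
  have fpx: "fp_integral (\<lambda>u. \<phi> u / rdist \<rho> u ^ p) a = x"
    by (rule fp_integral_eq, rule fp_has_cong[OF x]) (use g in auto)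
  have sums: "(\<Sum>(i, j) \<in> ({- int N..int N - 1} \<times> {- int N..int N - 1}) - {(0, 0)}.
                 \<phi> (of_int i * (a / real N), of_int j * (a / real N))
                 / rdist \<rho> (of_int i * (a / real N), of_int j * (a / real N)) ^ p
                 * (a / real N) ^ 2) = (a / real N)\<^sup>2 * T N" if N: "N > 0" for N
    unfolding T_def sum_distrib_left
  proof (intro sum.cong refl)
    fix y assume y: "y \<in> ({- int N..int N - 1} \<times> {- int N..int N - 1}) - {(0, 0)}"
    obtain i j where ij: "y = (i, j)" by (cases y)
    have h: "a / real N > 0" using N a by simp
    have b: "\<bar>of_int k * (a / real N)\<bar> \<le> a" if "k \<in> {- int N..int N - 1}" for k
    proof -
      have "\<bar>k\<bar> \<le> int N" using that by auto
      then have "real_of_int \<bar>k\<bar> \<le> real_of_int (int N)" by (simp only: of_int_le_iff)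
      then have "\<bar>real_of_int k\<bar> * (a / real N) \<le> real N * (a / real N)" using h by (intro mult_right_mono) auto
      then show ?thesis using a N by (simp add: abs_mult)
    qed
    have "mnorm (of_int i * (a / real N), of_int j * (a / real N)) \<le> a"
      using b[of i] b[of j] y unfolding ij mnorm_def by simp
    moreover have "(of_int i * (a / real N), of_int j * (a / real N)) \<noteq> (0, 0)" using y h N unfolding ij by auto
    ultimately have "g (of_int i * (a / real N), of_int j * (a / real N)) =
        \<phi> (of_int i * (a / real N), of_int j * (a / real N)) / rdist \<rho> (of_int i * (a / real N), of_int j * (a / real N)) ^ p"
      using g by blast
    then show "(case y of (i, j) \<Rightarrow> \<phi> (of_int i * (a / real N), of_int j * (a / real N))
                 / rdist \<rho> (of_int i * (a / real N), of_int j * (a / real N)) ^ p * (a / real N) ^ 2) =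
        (a / real N)\<^sup>2 * (case y of (i, j) \<Rightarrow> g (of_int i * (a / real N), of_int j * (a / real N)))"
      unfolding ij by (simp add: mult.commute)
  qed
  have 1: "(\<lambda>N. x - (a / real N)\<^sup>2 * T N + Z N) \<in> O[sequentially](\<lambda>N. (a / real N) ^ P)"
  proof (rule bigoI[of _ C])
    show "\<forall>\<^sub>F N in sequentially. norm (x - (a / real N)\<^sup>2 * T N + Z N) \<le> C * norm ((a / real N) ^ P)"
      using eventually_gt_at_top[of 0]
    proof eventually_elim
      case (elim N)
      have "\<bar>x - (a / real N)\<^sup>2 * T N + Z N\<bar> \<le> C * (a / real N) ^ P"
        using C elim unfolding T_def Z_def by blast
      then show ?case using a by simp
    qed
  qed
  define w where "w m = weights (fff \<rho>) (real_of_int (2 * int m + int p)) (K1m q (int m)) (K2m p P (int m))" for m :: nat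
  \<comment> \<open>Stencil layer m together with the error predicted for the same m; above
    \<open>Mbig\<close> there is no stencil.\<close>
  define Y where "Y m N = (if int m \<le> Mbig p P q then (\<Sum>(\<mu>, \<nu>)\<in>stencil (K1m q (int m)) (K2m p P (int m)).
      ft m (of_int \<mu> * (a / real N), of_int \<nu> * (a / real N)) * w m (\<mu>, \<nu>)) * (a / real N) powr (2 - real (p + 2 * m)) else 0)
    + (\<Sum>l\<in>I m. tcoeff (ft m) l * ((a / real N) powr (dg (p + 2 * m) l + 2) * lattice_const (p + 2 * m) l))" for m N
  have Ib: "2 * q + 3 * m \<le> fst l + snd l" if "l \<in> I m" for l m
    using that by (cases l) (auto simp: I_def low_degrees_def)
  have 2: "Y m \<in> O[sequentially](\<lambda>N. (a / real N) ^ P)" if m: "m < M" for m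
  proof (cases "int m \<le> Mbig p P q")
    case True
    have ws: "weight_sys (fff \<rho>) (real (p + 2 * m)) (K1m q (int m)) (K2m p P (int m)) (w m)"
    proof -
      have e: "real (p + 2 * m) = real_of_int (2 * int m + int p)" by simp
      have "\<exists>!\<tau>. weight_sys (fff \<rho>) (real_of_int (2 * int m + int p)) (K1m q (int m)) (K2m p P (int m)) \<tau>"
        using bspec[OF uniq, of "int m"] True by simp
      from theI'[OF this] show ?thesis unfolding w_def weights_def e .
    qed
    have "odd (p + 2 * m)" using p by simp
    moreover have "smooth_on UNIV (R m)" "vanish n (R m)" "\<And>u. ft m u = (\<Sum>l\<in>I m. tcoeff (ft m) l * mon l u) + R m u"
      using R[rule_format, OF m] by blast+
    moreover have "2 * K1m q (int m) \<le> int (fst l + snd l)" if "l \<in> I m" "even (fst l + snd l)" for l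
      by (rule order_bounds(1)[OF Ib[OF that(1)] that(2)])
    moreover have "real P \<le> dg (p + 2 * m) l + 2"
      if "l \<in> I m" "even (fst l + snd l)" "2 * K2m p P (int m) < int (fst l + snd l)" for l
      by (rule order_bounds(2)[OF Ib[OF that(1)] that(2,3)])
    moreover have "real P \<le> real n - real (p + 2 * m) + 2" using m by (simp add: n_def M_def)
    ultimately have "(\<lambda>N. (\<Sum>(\<mu>, \<nu>)\<in>stencil (K1m q (int m)) (K2m p P (int m)).
      ft m (of_int \<mu> * (a / real N), of_int \<nu> * (a / real N)) * w m (\<mu>, \<nu>)) * (a / real N) powr (2 - real (p + 2 * m))
      + (\<Sum>l\<in>I m. tcoeff (ft m) l * ((a / real N) powr (dg (p + 2 * m) l + 2) * lattice_const (p + 2 * m) l)))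
      \<in> O[sequentially](\<lambda>N. (a / real N) ^ P)"
      by (rule stencil_correction[OF a ws _ finI])
    then show ?thesis unfolding Y_def[abs_def] using True by (simp only: if_True)
  next
    \<comment> \<open>Beyond \<open>Mbig\<close> every term of even degree is already of order P,
      and the constants of odd degree are 0.\<close>
    case False
    have "(\<lambda>N. tcoeff (ft m) l * ((a / real N) powr (dg (p + 2 * m) l + 2) * lattice_const (p + 2 * m) l))
        \<in> O[sequentially](\<lambda>N. (a / real N) ^ P)" if l: "l \<in> I m" for l
    proof (cases "even (fst l + snd l)")
      case True
      have "real P \<le> dg (p + 2 * m) l + 2"
        by (rule order_bounds(3)[OF Ib[OF l] True]) (use False in simp)
      from bigo_cmult[OF powr_bigo[OF a this], of "tcoeff (ft m) l * lattice_const (p + 2 * m) l"]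
      show ?thesis by (simp only: mult_ac)
    qed (simp add: lattice_const_odd)
    then show ?thesis unfolding Y_def[abs_def] using False by (simp add: big_sum_in_bigo)
  qed
  have 3: "corr \<rho> \<phi> p P q (a / real N) + Z N = (\<Sum>m<M. (\<beta> gchoose m) * Y m N)" for N
  proof -
    define F where "F m = (\<Sum>(\<mu>, \<nu>)\<in>stencil (K1m q (int m)) (K2m p P (int m)).
      ft m (of_int \<mu> * (a / real N), of_int \<nu> * (a / real N)) * w m (\<mu>, \<nu>)) * (a / real N) powr (2 - real (p + 2 * m))" for m
    \<comment> \<open>All correction layers fall among the \<open>M\<close> layers of the expansion,
      so both can be summed over m < M.\<close>
    have Mb: "Mbig p P q < int M"
    proof -
      define c' where "c' = \<lceil>(real P + real p) / 2\<rceil>"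
      have "real_of_int c' < (real P + real p) / 2 + 1" unfolding c'_def by linarith
      then have "real_of_int (2 * c') < real_of_int (int P + int p + 2)" by (simp add: field_simps)
      then have "2 * c' < int P + int p + 2" by (simp only: of_int_less_iff)
      then show ?thesis unfolding Mbig_def M_def c'_def[symmetric] by simp
    qed
    have "corr \<rho> \<phi> p P q (a / real N) = (\<Sum>m\<in>{0..Mbig p P q}. (\<beta> gchoose nat m) * F (nat m))"
      unfolding corr_def
    proof (intro sum.cong refl)
      fix m assume "m \<in> {0..Mbig p P q}"
      then have m: "int (nat m) = m" "real_of_int m = real (nat m)" by auto
      have e: "2 - real p - 2 * real (nat m) = 2 - real (p + 2 * nat m)" by simp
      show "(\<Sum>(\<mu>, \<nu>) \<in> stencil (K1m q m) (K2m p P m).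
          ((- real p / 2) gchoose nat m)
          * ((rdist \<rho> (of_int \<mu> * (a / real N), of_int \<nu> * (a / real N))) ^ 2 - fff \<rho> (of_int \<mu> * (a / real N), of_int \<nu> * (a / real N))) ^ nat m
          * \<phi> (of_int \<mu> * (a / real N), of_int \<nu> * (a / real N))
          * weights (fff \<rho>) (real_of_int (2 * m + int p)) (K1m q m) (K2m p P m) (\<mu>, \<nu>)
          * (a / real N) powr (2 - real p - 2 * real_of_int m)) = (\<beta> gchoose nat m) * F (nat m)"
        unfolding F_def w_def m(1) m(2) e ft_def \<beta>_def sum_distrib_left sum_distrib_right split_beta
        by (simp only: mult_ac)
    qed
    also have "\<dots> = (\<Sum>m\<in>{m. m < M \<and> int m \<le> Mbig p P q}. (\<beta> gchoose m) * F m)"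
      by (rule sum.reindex_bij_witness[of _ int nat]) (use Mb in auto)
    also have "\<dots> = (\<Sum>m<M. if int m \<le> Mbig p P q then (\<beta> gchoose m) * F m else 0)"
      by (rule sum.mono_neutral_cong_left) auto
    finally have "corr \<rho> \<phi> p P q (a / real N) = (\<Sum>m<M. if int m \<le> Mbig p P q then (\<beta> gchoose m) * F m else 0)" .
    moreover have "Z N = (\<Sum>m<M. (\<beta> gchoose m) * (\<Sum>l\<in>I m. tcoeff (ft m) l * ((a / real N) powr (dg (p + 2 * m) l + 2) * lattice_const (p + 2 * m) l)))"
      unfolding Z_def sum_distrib_left using finI by (subst sum.Sigma) (auto simp: split_beta mult_ac intro!: sum.cong)
    ultimately show ?thesis
      unfolding Y_def F_def[symmetric] by (auto simp: sum.distrib[symmetric] distrib_left intro!: sum.cong)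
  qed
  \<comment> \<open>The predicted error \<open>Z\<close> enters both estimates and cancels in the
    difference.\<close>
  have "(\<lambda>N. (x - (a / real N)\<^sup>2 * T N + Z N) - (\<Sum>m<M. (\<beta> gchoose m) * Y m N)) \<in> O[sequentially](\<lambda>N. (a / real N) ^ P)"
    by (intro sum_in_bigo 1 big_sum_in_bigo bigo_cmult 2) auto
  also have "?this \<longleftrightarrow> ?thesis"
  proof (rule landau_o.big.in_cong)
    show "\<forall>\<^sub>F N in sequentially. (x - (a / real N)\<^sup>2 * T N + Z N) - (\<Sum>m<M. (\<beta> gchoose m) * Y m N) =
      fp_integral (\<lambda>u. \<phi> u / rdist \<rho> u ^ p) a
            - (\<Sum>(i, j) \<in> ({- int N..int N - 1} \<times> {- int N..int N - 1}) - {(0, 0)}.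
                 \<phi> (of_int i * (a / real N), of_int j * (a / real N))
                 / rdist \<rho> (of_int i * (a / real N), of_int j * (a / real N)) ^ p
                 * (a / real N) ^ 2)
            - corr \<rho> \<phi> p P q (a / real N)"
      using eventually_gt_at_top[of 0]
    proof eventually_elim
      case (elim N)
      show ?case unfolding fpx sums[OF elim] 3[symmetric] by simp
    qed
  qed
  finally show ?thesis .
qed

end
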